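(* There exists a nonzero Banach algebra which is both amenable and radical.
   Context: Banach algebras are complex and associative and need not be commutative or unital. For a Banach algebra $A$, a Banach $A$-module means a Banach $A$-bimodule $E$. Its dual $E^*$ is a Banach $A$-bimodule via $\langle x, a.\phi\rangle := \langle x.a,\phi\rangle$ and $\langle x,\phi.a\rangle := \langle a.x,\phi\rangle$ for $a\in A$, $x\in E$, $\phi\in E^*$. A derivation $D: A\to E$ is a bounded linear map with $D(ab)=a.Db+(Da).b$ for all $a,b\in A$; it is inner if there is $x\in E$ with $Da = x.a-a.x$ for all $a\in A$. The Banach algebra $A$ is amenable if, for each Banach $A$-module $E$, every derivation $D:A\to E^*$ is inner. A Banach algebra is radical if it equals its Jacobson radical, i.e. if it has no primitive ideals (kernels of algebraically irreducible representations). *)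

theory Defs
  imports "HOL-Analysis.Analysis" "HOL-Algebra.Module"
begin

section \<open>Banach spaces and Banach algebras with explicit carriers\<close>

text \<open>
  The underlying vector space is a module over the ring \<open>\<C>\<close> in the sense of
  HOL-Algebra. Its records also have fields \<^const>\<open>monoid.mult\<close> and \<^const>\<open>monoid.one\<close>:
  the multiplication is used for Banach algebras only, and \<^const>\<open>monoid.one\<close> is never
  used (algebras need not be unital).
\<close>

definition complex_ring :: "complex ring" (\<open>\<C>\<close>)
  where "\<C> = \<lparr>carrier = UNIV, monoid.mult = (*), one = 1, zero = 0, add = (+)\<rparr>"

record 'e normed = "(complex, 'e) module" +
  nrm :: "'e \<Rightarrow> real" (\<open>\<parallel>_\<parallel>\<index>\<close>)

text \<open>
  The locale \<^locale>\<open>Metric_space\<close> requires a nonnegative symmetric function on the whole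
  type, hence the case distinction.
\<close>

definition ndist :: "('e, 'm) normed_scheme \<Rightarrow> 'e \<Rightarrow> 'e \<Rightarrow> real"
  where "ndist E x y =
    (if x \<in> carrier E \<and> y \<in> carrier E then nrm E (x \<ominus>\<^bsub>E\<^esub> y) else 0)"

locale complex_normed_space = Module.module \<C> E
  for E :: "('e, 'm) normed_scheme" (structure) +
  assumes nrm_nonneg: "x \<in> carrier E \<Longrightarrow> 0 \<le> \<parallel>x\<parallel>"
    and nrm_eq_0: "x \<in> carrier E \<Longrightarrow> \<parallel>x\<parallel> = 0 \<longleftrightarrow> x = \<zero>\<^bsub>E\<^esub>"
    and nrm_triangle: "\<lbrakk>x \<in> carrier E; y \<in> carrier E\<rbrakk> \<Longrightarrow> \<parallel>x \<oplus>\<^bsub>E\<^esub> y\<parallel> \<le> \<parallel>x\<parallel> + \<parallel>y\<parallel>"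
    and nrm_smult: "x \<in> carrier E \<Longrightarrow> \<parallel>c \<odot>\<^bsub>E\<^esub> x\<parallel> = cmod c * \<parallel>x\<parallel>"

locale complex_banach_space = complex_normed_space +
  assumes mcomplete: "Metric_space.mcomplete (carrier E) (ndist E)"

locale banach_algebra = complex_banach_space A
  for A :: "('a, 'm) normed_scheme" (structure) +
  assumes mult_closed: "\<lbrakk>a \<in> carrier A; b \<in> carrier A\<rbrakk> \<Longrightarrow> a \<otimes>\<^bsub>A\<^esub> b \<in> carrier A"
    and mult_assoc: "\<lbrakk>a \<in> carrier A; b \<in> carrier A; c \<in> carrier A\<rbrakk>
      \<Longrightarrow> (a \<otimes>\<^bsub>A\<^esub> b) \<otimes>\<^bsub>A\<^esub> c = a \<otimes>\<^bsub>A\<^esub> (b \<otimes>\<^bsub>A\<^esub> c)"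
    and mult_add_left: "\<lbrakk>a \<in> carrier A; b \<in> carrier A; c \<in> carrier A\<rbrakk>
      \<Longrightarrow> (a \<oplus>\<^bsub>A\<^esub> b) \<otimes>\<^bsub>A\<^esub> c = a \<otimes>\<^bsub>A\<^esub> c \<oplus>\<^bsub>A\<^esub> b \<otimes>\<^bsub>A\<^esub> c"
    and mult_add_right: "\<lbrakk>a \<in> carrier A; b \<in> carrier A; c \<in> carrier A\<rbrakk>
      \<Longrightarrow> a \<otimes>\<^bsub>A\<^esub> (b \<oplus>\<^bsub>A\<^esub> c) = a \<otimes>\<^bsub>A\<^esub> b \<oplus>\<^bsub>A\<^esub> a \<otimes>\<^bsub>A\<^esub> c"
    and mult_smult_left: "\<lbrakk>a \<in> carrier A; b \<in> carrier A\<rbrakk>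
      \<Longrightarrow> (z \<odot>\<^bsub>A\<^esub> a) \<otimes>\<^bsub>A\<^esub> b = z \<odot>\<^bsub>A\<^esub> (a \<otimes>\<^bsub>A\<^esub> b)"
    and mult_smult_right: "\<lbrakk>a \<in> carrier A; b \<in> carrier A\<rbrakk>
      \<Longrightarrow> a \<otimes>\<^bsub>A\<^esub> (z \<odot>\<^bsub>A\<^esub> b) = z \<odot>\<^bsub>A\<^esub> (a \<otimes>\<^bsub>A\<^esub> b)"
    and nrm_mult: "\<lbrakk>a \<in> carrier A; b \<in> carrier A\<rbrakk> \<Longrightarrow> \<parallel>a \<otimes>\<^bsub>A\<^esub> b\<parallel> \<le> \<parallel>a\<parallel> * \<parallel>b\<parallel>"


section \<open>Banach bimodules, duals and derivations\<close>

record ('a, 'e) bimodule = "'e normed" +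
  lact :: "'a \<Rightarrow> 'e \<Rightarrow> 'e"
  ract :: "'e \<Rightarrow> 'a \<Rightarrow> 'e"

text \<open>The module actions are jointly continuous, not necessarily contractive.\<close>

locale banach_bimodule = A: banach_algebra A + E: complex_banach_space E
  for A :: "('a, 'm) normed_scheme" and E :: "('a, 'e, 'k) bimodule_scheme" +
  assumes lact_closed: "\<lbrakk>a \<in> carrier A; x \<in> carrier E\<rbrakk> \<Longrightarrow> lact E a x \<in> carrier E"
    and lact_add_left: "\<lbrakk>a \<in> carrier A; b \<in> carrier A; x \<in> carrier E\<rbrakk>
      \<Longrightarrow> lact E (a \<oplus>\<^bsub>A\<^esub> b) x = lact E a x \<oplus>\<^bsub>E\<^esub> lact E b x"
    and lact_add_right: "\<lbrakk>a \<in> carrier A; x \<in> carrier E; y \<in> carrier E\<rbrakk>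
      \<Longrightarrow> lact E a (x \<oplus>\<^bsub>E\<^esub> y) = lact E a x \<oplus>\<^bsub>E\<^esub> lact E a y"
    and lact_smult_left: "\<lbrakk>a \<in> carrier A; x \<in> carrier E\<rbrakk>
      \<Longrightarrow> lact E (z \<odot>\<^bsub>A\<^esub> a) x = z \<odot>\<^bsub>E\<^esub> lact E a x"
    and lact_smult_right: "\<lbrakk>a \<in> carrier A; x \<in> carrier E\<rbrakk>
      \<Longrightarrow> lact E a (z \<odot>\<^bsub>E\<^esub> x) = z \<odot>\<^bsub>E\<^esub> lact E a x"
    and lact_bounded: "\<exists>K. \<forall>a\<in>carrier A. \<forall>x\<in>carrier E.
      nrm E (lact E a x) \<le> K * nrm A a * nrm E x"
    and ract_closed: "\<lbrakk>a \<in> carrier A; x \<in> carrier E\<rbrakk> \<Longrightarrow> ract E x a \<in> carrier E"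
    and ract_add_left: "\<lbrakk>a \<in> carrier A; x \<in> carrier E; y \<in> carrier E\<rbrakk>
      \<Longrightarrow> ract E (x \<oplus>\<^bsub>E\<^esub> y) a = ract E x a \<oplus>\<^bsub>E\<^esub> ract E y a"
    and ract_add_right: "\<lbrakk>a \<in> carrier A; b \<in> carrier A; x \<in> carrier E\<rbrakk>
      \<Longrightarrow> ract E x (a \<oplus>\<^bsub>A\<^esub> b) = ract E x a \<oplus>\<^bsub>E\<^esub> ract E x b"
    and ract_smult_left: "\<lbrakk>a \<in> carrier A; x \<in> carrier E\<rbrakk>
      \<Longrightarrow> ract E (z \<odot>\<^bsub>E\<^esub> x) a = z \<odot>\<^bsub>E\<^esub> ract E x a"
    and ract_smult_right: "\<lbrakk>a \<in> carrier A; x \<in> carrier E\<rbrakk>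
      \<Longrightarrow> ract E x (z \<odot>\<^bsub>A\<^esub> a) = z \<odot>\<^bsub>E\<^esub> ract E x a"
    and ract_bounded: "\<exists>K. \<forall>a\<in>carrier A. \<forall>x\<in>carrier E.
      nrm E (ract E x a) \<le> K * nrm A a * nrm E x"
    and lact_lact: "\<lbrakk>a \<in> carrier A; b \<in> carrier A; x \<in> carrier E\<rbrakk>
      \<Longrightarrow> lact E a (lact E b x) = lact E (a \<otimes>\<^bsub>A\<^esub> b) x"
    and ract_ract: "\<lbrakk>a \<in> carrier A; b \<in> carrier A; x \<in> carrier E\<rbrakk>
      \<Longrightarrow> ract E (ract E x a) b = ract E x (a \<otimes>\<^bsub>A\<^esub> b)"
    and lact_ract: "\<lbrakk>a \<in> carrier A; b \<in> carrier A; x \<in> carrier E\<rbrakk>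
      \<Longrightarrow> lact E a (ract E x b) = ract E (lact E a x) b"

text \<open>For \<open>w = nrm E\<close> on \<open>I = carrier E\<close> this is the operator norm of a functional on \<open>E\<close>.\<close>

definition bound_norm :: "'i set \<Rightarrow> ('i \<Rightarrow> real) \<Rightarrow> ('i \<Rightarrow> complex) \<Rightarrow> real"
  where "bound_norm I w f = Inf {K. 0 \<le> K \<and> (\<forall>i\<in>I. cmod (f i) \<le> K * w i)}"

text \<open>
  Functionals on \<open>E\<close> are normalised to vanish outside the carrier, so that equality of
  functionals is equality of functions.
\<close>

definition dual :: "('a, 'e, 'k) bimodule_scheme \<Rightarrow> ('a, 'e \<Rightarrow> complex) bimodule"
  where "dual E = \<lparr>
    carrier = {\<phi>. (\<forall>x. x \<notin> carrier E \<longrightarrow> \<phi> x = 0) \<and>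
      (\<forall>x\<in>carrier E. \<forall>y\<in>carrier E. \<phi> (x \<oplus>\<^bsub>E\<^esub> y) = \<phi> x + \<phi> y) \<and>
      (\<forall>c. \<forall>x\<in>carrier E. \<phi> (c \<odot>\<^bsub>E\<^esub> x) = c * \<phi> x) \<and>
      (\<exists>K. \<forall>x\<in>carrier E. cmod (\<phi> x) \<le> K * nrm E x)},
    monoid.mult = undefined, one = undefined,
    zero = (\<lambda>_. 0), add = (\<lambda>\<phi> \<psi> x. \<phi> x + \<psi> x), smult = (\<lambda>c \<phi> x. c * \<phi> x),
    nrm = bound_norm (carrier E) (nrm E),
    lact = (\<lambda>a \<phi> x. if x \<in> carrier E then \<phi> (ract E x a) else 0),
    ract = (\<lambda>\<phi> a x. if x \<in> carrier E then \<phi> (lact E a x) else 0)\<rparr>"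

definition derivation ::
  "('a, 'm) normed_scheme \<Rightarrow> ('a, 'e, 'k) bimodule_scheme \<Rightarrow> ('a \<Rightarrow> 'e) \<Rightarrow> bool"
  where "derivation A E D \<longleftrightarrow>
    (\<forall>a\<in>carrier A. D a \<in> carrier E) \<and>
    (\<forall>a\<in>carrier A. \<forall>b\<in>carrier A. D (a \<oplus>\<^bsub>A\<^esub> b) = D a \<oplus>\<^bsub>E\<^esub> D b) \<and>
    (\<forall>c. \<forall>a\<in>carrier A. D (c \<odot>\<^bsub>A\<^esub> a) = c \<odot>\<^bsub>E\<^esub> D a) \<and>
    (\<exists>K. \<forall>a\<in>carrier A. nrm E (D a) \<le> K * nrm A a) \<and>
    (\<forall>a\<in>carrier A. \<forall>b\<in>carrier A. D (a \<otimes>\<^bsub>A\<^esub> b) = lact E a (D b) \<oplus>\<^bsub>E\<^esub> ract E (D a) b)"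

definition inner_derivation ::
  "('a, 'm) normed_scheme \<Rightarrow> ('a, 'e, 'k) bimodule_scheme \<Rightarrow> ('a \<Rightarrow> 'e) \<Rightarrow> bool"
  where "inner_derivation A E D \<longleftrightarrow>
    (\<exists>x\<in>carrier E. \<forall>a\<in>carrier A. D a = ract E x a \<ominus>\<^bsub>E\<^esub> lact E a x)"

text \<open>
  A definition in HOL cannot quantify over all types, so the modules \<open>E\<close> are taken inside a
  fixed type depending on the type of the algebra. This is no restriction: for amenable \<open>A\<close>,
  derivations into duals of Banach bimodules over arbitrary types are inner, see
  \<open>amenable_imp_inner\<close> below.
\<close>

definition amenable :: "('a, 'm) normed_scheme \<Rightarrow> bool"
  where "amenable A \<longleftrightarrow>
    (\<forall>(E :: ('a, 'a option \<times> 'a \<Rightarrow> complex) bimodule) D.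
      banach_bimodule A E \<longrightarrow> derivation A (dual E) D \<longrightarrow> inner_derivation A (dual E) D)"


section \<open>Primitive ideals and the Jacobson radical\<close>

text \<open>
  Representations are on complex vector spaces without topology. Irreducibility includes
  \<open>A V \<noteq> 0\<close>, so that kernels of irreducible representations are proper ideals.
\<close>

locale irreducible_rep = V: Module.module \<C> V
  for A :: "('a, 'm) normed_scheme" and V :: "(complex, 'v, 'n) module_scheme"
    and \<rho> :: "'a \<Rightarrow> 'v \<Rightarrow> 'v" +
  assumes rep_closed: "\<lbrakk>a \<in> carrier A; v \<in> carrier V\<rbrakk> \<Longrightarrow> \<rho> a v \<in> carrier V"
    and rep_add_left: "\<lbrakk>a \<in> carrier A; b \<in> carrier A; v \<in> carrier V\<rbrakk>
      \<Longrightarrow> \<rho> (a \<oplus>\<^bsub>A\<^esub> b) v = \<rho> a v \<oplus>\<^bsub>V\<^esub> \<rho> b v"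
    and rep_smult_left: "\<lbrakk>a \<in> carrier A; v \<in> carrier V\<rbrakk>
      \<Longrightarrow> \<rho> (c \<odot>\<^bsub>A\<^esub> a) v = c \<odot>\<^bsub>V\<^esub> \<rho> a v"
    and rep_add_right: "\<lbrakk>a \<in> carrier A; v \<in> carrier V; w \<in> carrier V\<rbrakk>
      \<Longrightarrow> \<rho> a (v \<oplus>\<^bsub>V\<^esub> w) = \<rho> a v \<oplus>\<^bsub>V\<^esub> \<rho> a w"
    and rep_smult_right: "\<lbrakk>a \<in> carrier A; v \<in> carrier V\<rbrakk>
      \<Longrightarrow> \<rho> a (c \<odot>\<^bsub>V\<^esub> v) = c \<odot>\<^bsub>V\<^esub> \<rho> a v"
    and rep_mult: "\<lbrakk>a \<in> carrier A; b \<in> carrier A; v \<in> carrier V\<rbrakk>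
      \<Longrightarrow> \<rho> (a \<otimes>\<^bsub>A\<^esub> b) v = \<rho> a (\<rho> b v)"
    and rep_nonzero: "\<exists>a\<in>carrier A. \<exists>v\<in>carrier V. \<rho> a v \<noteq> \<zero>\<^bsub>V\<^esub>"
    and rep_irreducible: "\<lbrakk>submodule W \<C> V; \<And>a w. \<lbrakk>a \<in> carrier A; w \<in> W\<rbrakk> \<Longrightarrow> \<rho> a w \<in> W\<rbrakk>
      \<Longrightarrow> W = {\<zero>\<^bsub>V\<^esub>} \<or> W = carrier V"

definition rep_kernel ::
  "('a, 'm) normed_scheme \<Rightarrow> (complex, 'v, 'n) module_scheme \<Rightarrow> ('a \<Rightarrow> 'v \<Rightarrow> 'v) \<Rightarrow> 'a set"
  where "rep_kernel A V \<rho> = {a \<in> carrier A. \<forall>v\<in>carrier V. \<rho> a v = \<zero>\<^bsub>V\<^esub>}"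

text \<open>
  Representation spaces inside the type of the algebra suffice, see
  \<open>primitive_ideal_rep_kernel\<close> below.
\<close>

definition primitive_ideal :: "('a, 'm) normed_scheme \<Rightarrow> 'a set \<Rightarrow> bool"
  where "primitive_ideal A P \<longleftrightarrow>
    (\<exists>(V :: (complex, 'a) module) \<rho>. irreducible_rep A V \<rho> \<and> P = rep_kernel A V \<rho>)"

definition jacobson_radical :: "('a, 'm) normed_scheme \<Rightarrow> 'a set"
  where "jacobson_radical A = {a \<in> carrier A. \<forall>P. primitive_ideal A P \<longrightarrow> a \<in> P}"

definition radical_algebra :: "('a, 'm) normed_scheme \<Rightarrow> bool"
  where "radical_algebra A \<longleftrightarrow> jacobson_radical A = carrier A"

section \<open>Independence of the types carrying modules and representations\<close>

lemma ring_C [simp]: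
  "carrier \<C> = UNIV" "one \<C> = 1" "zero \<C> = 0"
  "x \<oplus>\<^bsub>\<C>\<^esub> y = x + y" "x \<otimes>\<^bsub>\<C>\<^esub> y = x * y"
  by (simp_all add: complex_ring_def)

lemma cring_C: "cring \<C>"
proof -
  have "\<exists>y. x + y = 0" for x :: complex
    using add.right_inverse by blast
  thus ?thesis unfolding complex_ring_def
    by unfold_locales (auto simp: algebra_simps Units_def)
qed

lemma (in complex_normed_space) ndist_metric: "Metric_space (carrier E) (ndist E)"
proof
  have minus: "\<parallel>\<ominus>\<^bsub>E\<^esub> x\<parallel> = \<parallel>x\<parallel>" if "x \<in> carrier E" for x
  proof -
    have "(-1) \<odot>\<^bsub>E\<^esub> x \<oplus>\<^bsub>E\<^esub> 1 \<odot>\<^bsub>E\<^esub> x = \<zero>\<^bsub>E\<^esub>"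
      using that smult_l_distr[of "-1" 1 x] smult_l_null[of x] by simp
    then have "(-1) \<odot>\<^bsub>E\<^esub> x = \<ominus>\<^bsub>E\<^esub> x"
      using that smult_one[of x] smult_closed[of "-1" x] by (intro M.minus_equality[symmetric]) auto
    then show ?thesis using nrm_smult[OF that, of "-1"] by simp
  qed
  fix x y
  show "0 \<le> ndist E x y" by (simp add: ndist_def nrm_nonneg)
  show "ndist E x y = ndist E y x"
  proof (cases "x \<in> carrier E \<and> y \<in> carrier E")
    case True
    then have "\<ominus>\<^bsub>E\<^esub> (x \<ominus>\<^bsub>E\<^esub> y) = y \<ominus>\<^bsub>E\<^esub> x"
      by (simp add: a_minus_def M.minus_add M.a_comm)
    then show ?thesis using True minus[of "x \<ominus>\<^bsub>E\<^esub> y"] by (simp add: ndist_def)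
  qed (auto simp: ndist_def)
  assume x: "x \<in> carrier E" and y: "y \<in> carrier E"
  have "x = y" if "x \<ominus>\<^bsub>E\<^esub> y = \<zero>\<^bsub>E\<^esub>"
  proof -
    have "x = (x \<ominus>\<^bsub>E\<^esub> y) \<oplus>\<^bsub>E\<^esub> y"
      using x y by (simp add: a_minus_def M.a_assoc M.l_neg)
    then show ?thesis using that y by simp
  qed
  moreover have "x \<ominus>\<^bsub>E\<^esub> y = \<zero>\<^bsub>E\<^esub>" if "x = y"
    using that y by (simp add: a_minus_def M.r_neg)
  ultimately show "ndist E x y = 0 \<longleftrightarrow> x = y"
    using x y by (auto simp: ndist_def nrm_eq_0)
  fix z assume z: "z \<in> carrier E"
  have "x \<ominus>\<^bsub>E\<^esub> z = (x \<ominus>\<^bsub>E\<^esub> y) \<oplus>\<^bsub>E\<^esub> (y \<ominus>\<^bsub>E\<^esub> z)"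
    using x y z by (simp add: a_minus_def M.a_assoc[symmetric]) (simp add: M.a_assoc M.l_neg)
  then show "ndist E x z \<le> ndist E x y + ndist E y z"
    using x y z nrm_triangle[of "x \<ominus>\<^bsub>E\<^esub> y" "y \<ominus>\<^bsub>E\<^esub> z"] by (simp add: ndist_def)
qed

lemma bound_norm_nonneg: "0 \<le> bound_norm I w f"
  if "\<exists>K. 0 \<le> K \<and> (\<forall>i\<in>I. cmod (f i) \<le> K * w i)"
  unfolding bound_norm_def using that by (intro cInf_greatest) auto

lemma bound_norm_le: "bound_norm I w f \<le> K" if "0 \<le> K" "\<And>i. i \<in> I \<Longrightarrow> cmod (f i) \<le> K * w i"
  unfolding bound_norm_def using that by (intro cInf_lower bdd_belowI[of _ 0]) auto

lemma bound_normD: "cmod (f i) \<le> bound_norm I w f * w i"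
  if ex: "\<exists>K. 0 \<le> K \<and> (\<forall>i\<in>I. cmod (f i) \<le> K * w i)" and i: "i \<in> I" and w: "0 \<le> w i"
proof (cases "w i = 0")
  case True
  then show ?thesis using ex i by auto
next
  case False
  then have "0 < w i" using w by simp
  then have "cmod (f i) / w i \<le> bound_norm I w f"
    unfolding bound_norm_def using ex i
    by (intro cInf_greatest) (auto simp: divide_le_eq)
  then show ?thesis using \<open>0 < w i\<close> by (simp add: divide_le_eq)
qed

lemma function_normed_space:
  fixes E :: "('i \<Rightarrow> complex, 'm) normed_scheme"
  assumes ops: "add E = (\<lambda>f g x. f x + g x)" "zero E = (\<lambda>_. 0)"
      "smult E = (\<lambda>c f x. c * f x)" "nrm E = bound_norm I w"
    and w: "\<And>i. i \<in> I \<Longrightarrow> 0 \<le> w i"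
    and supp: "\<And>f i. f \<in> carrier E \<Longrightarrow> i \<notin> I \<Longrightarrow> f i = 0"
    and bd: "\<And>f. f \<in> carrier E \<Longrightarrow> \<exists>K. 0 \<le> K \<and> (\<forall>i\<in>I. cmod (f i) \<le> K * w i)"
    and cl: "(\<lambda>_. 0) \<in> carrier E"
      "\<And>f g. f \<in> carrier E \<Longrightarrow> g \<in> carrier E \<Longrightarrow> (\<lambda>x. f x + g x) \<in> carrier E"
      "\<And>c f. f \<in> carrier E \<Longrightarrow> (\<lambda>x. c * f x) \<in> carrier E"
    and lim: "\<And>s f K. (\<And>n. s n \<in> carrier E) \<Longrightarrow> (\<And>i. (\<lambda>n. s n i) \<longlonglongrightarrow> f i) \<Longrightarrow> 0 \<le> K \<Longrightarrow>
      (\<And>i. i \<in> I \<Longrightarrow> cmod (f i) \<le> K * w i) \<Longrightarrow> f \<in> carrier E"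
  shows "complex_normed_space E"
    and "\<And>f g. f \<in> carrier E \<Longrightarrow> g \<in> carrier E \<Longrightarrow> f \<ominus>\<^bsub>E\<^esub> g = (\<lambda>x. f x - g x)"
    and "complex_banach_space E"
proof -
  have neg: "(\<lambda>x. - f x) \<in> carrier E" if "f \<in> carrier E" for f
    using cl(3)[OF that, of "-1"] by simp
  have ab: "abelian_group E"
  proof (rule abelian_groupI)
    fix f assume "f \<in> carrier E"
    then show "\<exists>y\<in>carrier E. y \<oplus>\<^bsub>E\<^esub> f = \<zero>\<^bsub>E\<^esub>"
      using neg by (intro bexI[of _ "\<lambda>x. - f x"]) (auto simp: ops)
  qed (auto simp: ops cl add.assoc add.commute)
  interpret abelian_group E by fact
  have mod: "Module.module \<C> E"
    by (rule moduleI) (auto simp: ops cl ab algebra_simps cring_C)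
  interpret Module.module \<C> E by fact
  note D = bound_normD[OF bd _ w]
  have minus: "f \<ominus>\<^bsub>E\<^esub> g = (\<lambda>x. f x - g x)" if "f \<in> carrier E" "g \<in> carrier E" for f g
  proof -
    have "\<ominus>\<^bsub>E\<^esub> g = (\<lambda>x. - g x)"
      using that neg by (intro abelian_group.minus_equality[OF ab]) (auto simp: ops)
    then show ?thesis by (simp add: a_minus_def ops)
  qed
  have sm: "bound_norm I w (\<lambda>x. c * f x) \<le> cmod c * bound_norm I w f" if "f \<in> carrier E" for c f
    using that by (intro bound_norm_le)
      (auto simp: bound_norm_nonneg bd norm_mult mult.assoc intro!: mult_left_mono D)
  show N: "complex_normed_space E"
  proof
    fix f assume f: "f \<in> carrier E"
    show "0 \<le> \<parallel>f\<parallel>\<^bsub>E\<^esub>" using f by (simp add: ops bound_norm_nonneg bd)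
    show "\<parallel>f\<parallel>\<^bsub>E\<^esub> = 0 \<longleftrightarrow> f = \<zero>\<^bsub>E\<^esub>"
    proof
      assume 0: "\<parallel>f\<parallel>\<^bsub>E\<^esub> = 0"
      show "f = \<zero>\<^bsub>E\<^esub>"
      proof
        fix i show "f i = \<zero>\<^bsub>E\<^esub> i"
          using D[OF f, of i] supp[OF f, of i] 0 by (cases "i \<in> I") (auto simp: ops)
      qed
    next
      assume f0: "f = \<zero>\<^bsub>E\<^esub>"
      have "bound_norm I w f \<le> 0" by (rule bound_norm_le) (auto simp: f0 ops)
      then show "\<parallel>f\<parallel>\<^bsub>E\<^esub> = 0" using bound_norm_nonneg[OF bd[OF f]] by (simp add: ops)
    qed
    show "\<parallel>c \<odot>\<^bsub>E\<^esub> f\<parallel>\<^bsub>E\<^esub> = cmod c * \<parallel>f\<parallel>\<^bsub>E\<^esub>" for c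
    proof (cases "c = 0")
      case True
      have "bound_norm I w (\<lambda>_. 0) \<le> 0" by (rule bound_norm_le) auto
      moreover have "0 \<le> bound_norm I w (\<lambda>_. 0)" using bound_norm_nonneg[OF bd[OF cl(1)]] .
      ultimately show ?thesis using True by (simp add: ops)
    next
      case False
      have "bound_norm I w f = bound_norm I w (\<lambda>x. inverse c * (c * f x))"
        using False by (simp add: mult.assoc[symmetric])
      also have "\<dots> \<le> inverse (cmod c) * bound_norm I w (\<lambda>x. c * f x)"
        using sm[OF cl(3)[OF f, of c], of "inverse c"] by (simp add: norm_inverse)
      finally have "cmod c * bound_norm I w f \<le> bound_norm I w (\<lambda>x. c * f x)"
        using False by (simp add: field_simps)
      then show ?thesis using sm[OF f, of c] by (simp add: ops)
    qed
    fix g assume g: "g \<in> carrier E"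
    show "\<parallel>f \<oplus>\<^bsub>E\<^esub> g\<parallel>\<^bsub>E\<^esub> \<le> \<parallel>f\<parallel>\<^bsub>E\<^esub> + \<parallel>g\<parallel>\<^bsub>E\<^esub>"
      unfolding ops
    proof (rule bound_norm_le)
      fix i assume i: "i \<in> I"
      show "cmod (f i + g i) \<le> (bound_norm I w f + bound_norm I w g) * w i"
        using D[OF f i i] D[OF g i i] norm_triangle_ineq[of "f i" "g i"] by (simp add: distrib_right)
    qed (simp add: bound_norm_nonneg bd f g)
  qed
  then interpret complex_normed_space E .
  show "f \<ominus>\<^bsub>E\<^esub> g = (\<lambda>x. f x - g x)" if "f \<in> carrier E" "g \<in> carrier E" for f g
    using minus that .
  interpret M: Metric_space "carrier E" "ndist E" by (rule ndist_metric)
  have "M.mcomplete"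
    unfolding M.mcomplete_def
  proof safe
    fix s assume C: "M.MCauchy s"
    then have s: "s n \<in> carrier E" for n by (auto simp: M.MCauchy_def)
    have dm: "(\<lambda>x. s m x - s n x) \<in> carrier E" for m n
      using cl(2)[OF s neg[OF s], of m n] by simp
    have nd: "ndist E (s m) (s n) = bound_norm I w (\<lambda>x. s m x - s n x)" for m n
      using s by (simp add: ndist_def minus ops)
    have key: "\<exists>N. \<forall>m\<ge>N. \<forall>n\<ge>N. \<forall>i\<in>I. cmod (s m i - s n i) \<le> e * w i" if e: "0 < e" for e
    proof -
      obtain N where N: "\<And>m n. N \<le> m \<Longrightarrow> N \<le> n \<Longrightarrow> ndist E (s m) (s n) < e"
        using C e unfolding M.MCauchy_def by blast
      have "cmod (s m i - s n i) \<le> e * w i" if "m \<ge> N" "n \<ge> N" "i \<in> I" for m n i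
      proof -
        have "cmod (s m i - s n i) \<le> bound_norm I w (\<lambda>x. s m x - s n x) * w i"
          using D[OF dm] that by blast
        also have "\<dots> \<le> e * w i" using N[of m n] that w[of i] by (intro mult_right_mono) (auto simp: nd)
        finally show ?thesis .
      qed
      then show ?thesis by blast
    qed
    have "Cauchy (\<lambda>n. s n i)" for i
    proof (cases "i \<in> I")
      case False then show ?thesis using supp[OF s] by (simp add: Cauchy_def)
    next
      case True
      show ?thesis
      proof (rule metric_CauchyI)
        fix e :: real assume e: "0 < e"
        define d where "d = e / (w i + 1)"
        have wi: "0 \<le> w i" using w True by blast
        have d: "0 < d" "d * w i < e" unfolding d_def using e wi
          by (auto simp: field_simps add_pos_nonneg)
        obtain N where "\<forall>m\<ge>N. \<forall>n\<ge>N. \<forall>i\<in>I. cmod (s m i - s n i) \<le> d * w i"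
          using key[OF d(1)] by blast
        then show "\<exists>N. \<forall>m\<ge>N. \<forall>n\<ge>N. dist (s m i) (s n i) < e"
          using True d(2) by (force simp: dist_norm intro!: exI[of _ N])
      qed
    qed
    then have "\<exists>l. (\<lambda>n. s n i) \<longlonglongrightarrow> l" for i
      by (meson Cauchy_convergent convergent_def)
    then obtain f where f: "\<And>i. (\<lambda>n. s n i) \<longlonglongrightarrow> f i" by metis
    have lb: "cmod (s m i - f i) \<le> e * w i"
      if "\<forall>m\<ge>N. \<forall>n\<ge>N. \<forall>i\<in>I. cmod (s m i - s n i) \<le> e * w i" "m \<ge> N" "i \<in> I" for e N m i
      using that by (intro Lim_bounded[where M=N and f="\<lambda>n. cmod (s m i - s n i)"])
        (auto intro!: tendsto_intros f)
    obtain N1 where N1: "\<forall>m\<ge>N1. \<forall>n\<ge>N1. \<forall>i\<in>I. cmod (s m i - s n i) \<le> 1 * w i"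
      using key[of 1] by auto
    obtain K where K: "0 \<le> K" "\<And>i. i \<in> I \<Longrightarrow> cmod (s N1 i) \<le> K * w i"
      using bd[OF s] by metis
    have fE: "f \<in> carrier E"
    proof (rule lim[OF s f])
      fix i assume i: "i \<in> I"
      show "cmod (f i) \<le> (K + 1) * w i"
        using lb[OF N1 order_refl i] K(2)[OF i] norm_triangle_ineq3[of "s N1 i" "f i"]
        by (simp add: distrib_right)
    qed (use K in auto)
    have "limitin M.mtopology s f sequentially"
      unfolding M.limitin_metric
    proof (intro conjI allI impI fE)
      fix e :: real assume e: "0 < e"
      obtain N where N: "\<forall>m\<ge>N. \<forall>n\<ge>N. \<forall>i\<in>I. cmod (s m i - s n i) \<le> (e/2) * w i"
        using key[of "e/2"] e by auto
      have "ndist E (s m) f < e" if "m \<ge> N" for m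
      proof -
        have "bound_norm I w (\<lambda>x. s m x - f x) \<le> e/2"
          using lb[OF N that] e by (intro bound_norm_le) auto
        then show ?thesis using e s fE by (simp add: ndist_def minus ops)
      qed
      then show "\<forall>\<^sub>F m in sequentially. s m \<in> carrier E \<and> ndist E (s m) f < e"
        using s eventually_sequentially by blast
    qed
    then show "\<exists>f. limitin M.mtopology s f sequentially" by blast
  qed
  then show "complex_banach_space E" by unfold_locales
qed


lemma ex_bound_nonneg: "\<exists>K. 0 \<le> K \<and> (\<forall>i\<in>I. f i \<le> K * w i)"
  if ex: "\<exists>K. \<forall>i\<in>I. f i \<le> K * w i" and w: "\<And>i. i \<in> I \<Longrightarrow> 0 \<le> w i" for f w :: "'i \<Rightarrow> real"
proof -
  obtain K where K: "\<forall>i\<in>I. f i \<le> K * w i" using ex by blast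
  have "f i \<le> \<bar>K\<bar> * w i" if "i \<in> I" for i
    using K that w[OF that] by (meson abs_ge_self mult_right_mono order_trans)
  then show ?thesis by (intro exI[of _ "\<bar>K\<bar>"]) auto
qed

lemma dual_ops:
  "add (dual E) = (\<lambda>f g x. f x + g x)" "zero (dual E) = (\<lambda>_. 0)"
  "smult (dual E) = (\<lambda>c f x. c * f x)" "nrm (dual E) = bound_norm (carrier E) (nrm E)"
  "lact (dual E) a \<phi> = (\<lambda>x. if x \<in> carrier E then \<phi> (ract E x a) else 0)"
  "ract (dual E) \<phi> a = (\<lambda>x. if x \<in> carrier E then \<phi> (lact E a x) else 0)"
  by (simp_all add: dual_def)

lemma dual_carrier: "\<phi> \<in> carrier (dual E) \<longleftrightarrow> (\<forall>x. x \<notin> carrier E \<longrightarrow> \<phi> x = 0) \<and>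
      (\<forall>x\<in>carrier E. \<forall>y\<in>carrier E. \<phi> (x \<oplus>\<^bsub>E\<^esub> y) = \<phi> x + \<phi> y) \<and>
      (\<forall>c. \<forall>x\<in>carrier E. \<phi> (c \<odot>\<^bsub>E\<^esub> x) = c * \<phi> x) \<and>
      (\<exists>K. \<forall>x\<in>carrier E. cmod (\<phi> x) \<le> K * nrm E x)"
  by (simp add: dual_def)

lemma ex_bound_add:
  fixes f g :: "'i \<Rightarrow> complex"
  assumes "\<exists>K. \<forall>i\<in>I. cmod (f i) \<le> K * w i" "\<exists>K. \<forall>i\<in>I. cmod (g i) \<le> K * w i"
  shows "\<exists>K. \<forall>i\<in>I. cmod (f i + g i) \<le> K * w i"
proof -
  obtain K L where "\<forall>i\<in>I. cmod (f i) \<le> K * w i" "\<forall>i\<in>I. cmod (g i) \<le> L * w i"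
    using assms by blast
  then show ?thesis
    by (intro exI[of _ "K + L"]) (auto simp: distrib_right intro: norm_triangle_le add_mono)
qed

lemma ex_bound_smult:
  fixes f :: "'i \<Rightarrow> complex"
  assumes "\<exists>K. \<forall>i\<in>I. cmod (f i) \<le> K * w i"
  shows "\<exists>K. \<forall>i\<in>I. cmod (c * f i) \<le> K * w i"
proof -
  obtain K where "\<forall>i\<in>I. cmod (f i) \<le> K * w i" using assms by blast
  then show ?thesis
    by (intro exI[of _ "cmod c * K"]) (auto simp: norm_mult mult.assoc intro: mult_left_mono)
qed

lemma limit_add:
  fixes s :: "nat \<Rightarrow> 'i \<Rightarrow> complex"
  assumes "\<And>i. (\<lambda>n. s n i) \<longlonglongrightarrow> f i" "\<And>n. s n i = s n j + s n k"
  shows "f i = f j + f k"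
proof -
  have "(\<lambda>n. s n i) \<longlonglongrightarrow> f j + f k" unfolding assms(2) by (intro tendsto_intros assms)
  then show ?thesis using LIMSEQ_unique assms(1) by blast
qed

lemma limit_smult:
  fixes s :: "nat \<Rightarrow> 'i \<Rightarrow> complex"
  assumes "\<And>i. (\<lambda>n. s n i) \<longlonglongrightarrow> f i" "\<And>n. s n i = c * s n j"
  shows "f i = c * f j"
proof -
  have "(\<lambda>n. s n i) \<longlonglongrightarrow> c * f j" unfolding assms(2) by (intro tendsto_intros assms)
  then show ?thesis using LIMSEQ_unique assms(1) by blast
qed

lemma limit_zero:
  fixes s :: "nat \<Rightarrow> 'i \<Rightarrow> complex"
  assumes "\<And>i. (\<lambda>n. s n i) \<longlonglongrightarrow> f i" "\<And>n. s n i = 0"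
  shows "f i = 0"
  using limit_smult[of s f i 0 i] assms by simp

lemma
  fixes E :: "('a, 'e, 'k) bimodule_scheme"
  assumes "complex_normed_space E"
  shows dual_banach_space: "complex_banach_space (dual E)"
    and dual_minus: "\<lbrakk>\<phi> \<in> carrier (dual E); \<psi> \<in> carrier (dual E)\<rbrakk>
      \<Longrightarrow> \<phi> \<ominus>\<^bsub>dual E\<^esub> \<psi> = (\<lambda>x. \<phi> x - \<psi> x)"
    and dual_bound: "\<lbrakk>\<phi> \<in> carrier (dual E); x \<in> carrier E\<rbrakk>
      \<Longrightarrow> cmod (\<phi> x) \<le> nrm (dual E) \<phi> * nrm E x"
proof -
  interpret complex_normed_space E by fact
  have bd: "\<exists>K. 0 \<le> K \<and> (\<forall>x\<in>carrier E. cmod (\<phi> x) \<le> K * \<parallel>x\<parallel>\<^bsub>E\<^esub>)" if "\<phi> \<in> carrier (dual E)" for \<phi>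
    using that by (intro ex_bound_nonneg) (auto simp: dual_carrier nrm_nonneg)
  have add: "(\<lambda>x. \<phi> x + \<psi> x) \<in> carrier (dual E)"
    if "\<phi> \<in> carrier (dual E)" "\<psi> \<in> carrier (dual E)" for \<phi> \<psi>
    using that ex_bound_add[of "carrier E" \<phi> "nrm E" \<psi>] by (auto simp: dual_carrier algebra_simps)
  have sm: "(\<lambda>x. c * \<phi> x) \<in> carrier (dual E)" if "\<phi> \<in> carrier (dual E)" for c \<phi>
    using that ex_bound_smult[of "carrier E" \<phi> "nrm E" c] by (auto simp: dual_carrier algebra_simps)
  have z: "(\<lambda>_. 0) \<in> carrier (dual E)"
    by (auto simp: dual_carrier intro!: exI[of _ 0])
  have lim: "\<phi> \<in> carrier (dual E)" if s: "\<And>n. s n \<in> carrier (dual E)"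
      and l: "\<And>i. (\<lambda>n. s n i) \<longlonglongrightarrow> \<phi> i" and "0 \<le> K" and K: "\<And>i. i \<in> carrier E \<Longrightarrow> cmod (\<phi> i) \<le> K * nrm E i"
    for s \<phi> K
    unfolding dual_carrier
  proof (intro conjI allI impI ballI)
    show "\<exists>K. \<forall>x\<in>carrier E. cmod (\<phi> x) \<le> K * \<parallel>x\<parallel>\<^bsub>E\<^esub>" using K by blast
  next
    fix x assume "x \<notin> carrier E"
    then show "\<phi> x = 0" using s by (intro limit_zero[OF l]) (auto simp: dual_carrier)
  next
    fix x y assume "x \<in> carrier E" "y \<in> carrier E"
    then show "\<phi> (x \<oplus>\<^bsub>E\<^esub> y) = \<phi> x + \<phi> y" using s by (intro limit_add[OF l]) (auto simp: dual_carrier)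
  next
    fix c x assume "x \<in> carrier E"
    then show "\<phi> (c \<odot>\<^bsub>E\<^esub> x) = c * \<phi> x" using s by (intro limit_smult[OF l]) (auto simp: dual_carrier)
  qed
  have supp: "\<phi> x = 0" if "\<phi> \<in> carrier (dual E)" "x \<notin> carrier E" for \<phi> x
    using that by (simp add: dual_carrier)
  show "complex_banach_space (dual E)"
    by (rule function_normed_space(3)[where I="carrier E" and w="nrm E"])
      (fact dual_ops nrm_nonneg supp bd z add sm lim)+
  show "\<phi> \<ominus>\<^bsub>dual E\<^esub> \<psi> = (\<lambda>x. \<phi> x - \<psi> x)"
    if \<phi>: "\<phi> \<in> carrier (dual E)" and \<psi>: "\<psi> \<in> carrier (dual E)" for \<phi> \<psi>
    by (rule function_normed_space(2)[where I="carrier E" and w="nrm E"])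
      (fact dual_ops nrm_nonneg supp bd z add sm lim \<phi> \<psi>)+
  show "\<lbrakk>\<phi> \<in> carrier (dual E); x \<in> carrier E\<rbrakk> \<Longrightarrow> cmod (\<phi> x) \<le> nrm (dual E) \<phi> * nrm E x" for \<phi> x
    unfolding dual_ops by (intro bound_normD bd nrm_nonneg)
qed

lemma (in banach_bimodule) lact_bound:
  "\<exists>K. 0 \<le> K \<and> (\<forall>a\<in>carrier A. \<forall>x\<in>carrier E. nrm E (lact E a x) \<le> K * nrm A a * nrm E x)"
  using lact_bounded ex_bound_nonneg[of "carrier A \<times> carrier E" "\<lambda>(a, x). nrm E (lact E a x)"
      "\<lambda>(a, x). nrm A a * nrm E x"]
  by (auto simp: A.nrm_nonneg E.nrm_nonneg mult.assoc)

lemma (in banach_bimodule) ract_bound: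
  "\<exists>K. 0 \<le> K \<and> (\<forall>a\<in>carrier A. \<forall>x\<in>carrier E. nrm E (ract E x a) \<le> K * nrm A a * nrm E x)"
  using ract_bounded ex_bound_nonneg[of "carrier A \<times> carrier E" "\<lambda>(a, x). nrm E (ract E x a)"
      "\<lambda>(a, x). nrm A a * nrm E x"]
  by (auto simp: A.nrm_nonneg E.nrm_nonneg mult.assoc)

lemma (in banach_bimodule) dual_bimodule: "banach_bimodule A (dual E)"
proof -
  interpret D: complex_banach_space "dual E"
    by (rule dual_banach_space) unfold_locales
  note DB = dual_bound[OF E.complex_normed_space_axioms]
  note DN = D.nrm_nonneg
  obtain K where K: "0 \<le> K" "\<And>a x. a \<in> carrier A \<Longrightarrow> x \<in> carrier E \<Longrightarrow>
      nrm E (lact E a x) \<le> K * nrm A a * nrm E x" using lact_bound by blast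
  obtain L where L: "0 \<le> L" "\<And>a x. a \<in> carrier A \<Longrightarrow> x \<in> carrier E \<Longrightarrow>
      nrm E (ract E x a) \<le> L * nrm A a * nrm E x" using ract_bound by blast
  have bl: "cmod (\<phi> (ract E x a)) \<le> (L * nrm A a * nrm (dual E) \<phi>) * nrm E x"
    if "\<phi> \<in> carrier (dual E)" "a \<in> carrier A" "x \<in> carrier E" for \<phi> a x
  proof -
    have "cmod (\<phi> (ract E x a)) \<le> nrm (dual E) \<phi> * nrm E (ract E x a)"
      using that by (intro DB ract_closed)
    also have "\<dots> \<le> nrm (dual E) \<phi> * (L * nrm A a * nrm E x)"
      using that by (intro mult_left_mono L DN)
    finally show ?thesis by (simp add: mult_ac)
  qed
  have br: "cmod (\<phi> (lact E a x)) \<le> (K * nrm A a * nrm (dual E) \<phi>) * nrm E x"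
    if "\<phi> \<in> carrier (dual E)" "a \<in> carrier A" "x \<in> carrier E" for \<phi> a x
  proof -
    have "cmod (\<phi> (lact E a x)) \<le> nrm (dual E) \<phi> * nrm E (lact E a x)"
      using that by (intro DB lact_closed)
    also have "\<dots> \<le> nrm (dual E) \<phi> * (K * nrm A a * nrm E x)"
      using that by (intro mult_left_mono K DN)
    finally show ?thesis by (simp add: mult_ac)
  qed
  have dlin: "\<phi> (x \<oplus>\<^bsub>E\<^esub> y) = \<phi> x + \<phi> y" "\<phi> (c \<odot>\<^bsub>E\<^esub> x) = c * \<phi> x"
    if "\<phi> \<in> carrier (dual E)" "x \<in> carrier E" "y \<in> carrier E" for \<phi> x y c
    using that by (auto simp: dual_carrier)
  have E1: "x \<oplus>\<^bsub>E\<^esub> y \<in> carrier E" "c \<odot>\<^bsub>E\<^esub> x \<in> carrier E"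
    if "x \<in> carrier E" "y \<in> carrier E" for x y c using that by auto
  show ?thesis
  proof
    fix a \<phi> assume a: "a \<in> carrier A" and \<phi>: "\<phi> \<in> carrier (dual E)"
    show "lact (dual E) a \<phi> \<in> carrier (dual E)"
      using a \<phi> bl[OF \<phi> a]
      by (subst dual_carrier) (auto simp: dual_ops dlin ract_add_left ract_smult_left ract_closed E1)
    show "ract (dual E) \<phi> a \<in> carrier (dual E)"
      using a \<phi> br[OF \<phi> a]
      by (subst dual_carrier) (auto simp: dual_ops dlin lact_add_right lact_smult_right lact_closed E1)
    fix z
    show "lact (dual E) (z \<odot>\<^bsub>A\<^esub> a) \<phi> = z \<odot>\<^bsub>dual E\<^esub> lact (dual E) a \<phi>"
      "lact (dual E) a (z \<odot>\<^bsub>dual E\<^esub> \<phi>) = z \<odot>\<^bsub>dual E\<^esub> lact (dual E) a \<phi>"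
      "ract (dual E) (z \<odot>\<^bsub>dual E\<^esub> \<phi>) a = z \<odot>\<^bsub>dual E\<^esub> ract (dual E) \<phi> a"
      "ract (dual E) \<phi> (z \<odot>\<^bsub>A\<^esub> a) = z \<odot>\<^bsub>dual E\<^esub> ract (dual E) \<phi> a"
      using a \<phi> by (auto simp: dual_ops dlin ract_smult_right lact_smult_left ract_closed lact_closed fun_eq_iff)
    fix b assume b: "b \<in> carrier A"
    show "lact (dual E) (a \<oplus>\<^bsub>A\<^esub> b) \<phi> = lact (dual E) a \<phi> \<oplus>\<^bsub>dual E\<^esub> lact (dual E) b \<phi>"
      "ract (dual E) \<phi> (a \<oplus>\<^bsub>A\<^esub> b) = ract (dual E) \<phi> a \<oplus>\<^bsub>dual E\<^esub> ract (dual E) \<phi> b"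
      "lact (dual E) a (lact (dual E) b \<phi>) = lact (dual E) (a \<otimes>\<^bsub>A\<^esub> b) \<phi>"
      "ract (dual E) (ract (dual E) \<phi> a) b = ract (dual E) \<phi> (a \<otimes>\<^bsub>A\<^esub> b)"
      "lact (dual E) a (ract (dual E) \<phi> b) = ract (dual E) (lact (dual E) a \<phi>) b"
      using a b \<phi> by (auto simp: dual_ops dlin ract_add_right lact_add_left ract_closed lact_closed
          ract_ract lact_lact lact_ract fun_eq_iff)
  next
    fix a \<phi> \<psi> assume "a \<in> carrier A" "\<phi> \<in> carrier (dual E)" "\<psi> \<in> carrier (dual E)"
    then show "lact (dual E) a (\<phi> \<oplus>\<^bsub>dual E\<^esub> \<psi>) = lact (dual E) a \<phi> \<oplus>\<^bsub>dual E\<^esub> lact (dual E) a \<psi>"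
      "ract (dual E) (\<phi> \<oplus>\<^bsub>dual E\<^esub> \<psi>) a = ract (dual E) \<phi> a \<oplus>\<^bsub>dual E\<^esub> ract (dual E) \<psi> a"
      by (auto simp: dual_ops)
  next
    have "nrm (dual E) (lact (dual E) a \<phi>) \<le> L * nrm A a * nrm (dual E) \<phi>"
      if "a \<in> carrier A" "\<phi> \<in> carrier (dual E)" for a \<phi>
      using that bl[OF that(2,1)] DN[OF that(2)] A.nrm_nonneg[OF that(1)] L(1)
      unfolding dual_ops(4) by (intro bound_norm_le) (auto simp: dual_ops(5))
    then show "\<exists>K. \<forall>a\<in>carrier A. \<forall>x\<in>carrier (dual E).
      nrm (dual E) (lact (dual E) a x) \<le> K * nrm A a * nrm (dual E) x" by blast
    have "nrm (dual E) (ract (dual E) \<phi> a) \<le> K * nrm A a * nrm (dual E) \<phi>"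
      if "a \<in> carrier A" "\<phi> \<in> carrier (dual E)" for a \<phi>
      using that br[OF that(2,1)] DN[OF that(2)] A.nrm_nonneg[OF that(1)] K(1)
      unfolding dual_ops(4) by (intro bound_norm_le) (auto simp: dual_ops(6))
    then show "\<exists>K. \<forall>a\<in>carrier A. \<forall>x\<in>carrier (dual E).
      nrm (dual E) (ract (dual E) x a) \<le> K * nrm A a * nrm (dual E) x" by blast
  qed
qed

definition Pset :: "('a, 'm) normed_scheme \<Rightarrow> 'a option set"
  where "Pset A = insert None (Some ` carrier A)"
definition Pnrm :: "('a, 'm) normed_scheme \<Rightarrow> 'a option \<Rightarrow> real"
  where "Pnrm A p = (case p of None \<Rightarrow> 1 | Some a \<Rightarrow> nrm A a)"
definition Plm :: "('a, 'm) normed_scheme \<Rightarrow> 'a \<Rightarrow> 'a option \<Rightarrow> 'a option"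
  where "Plm A c p = (case p of None \<Rightarrow> Some c | Some a \<Rightarrow> Some (c \<otimes>\<^bsub>A\<^esub> a))"
definition Prm :: "('a, 'm) normed_scheme \<Rightarrow> 'a option \<Rightarrow> 'a \<Rightarrow> 'a option"
  where "Prm A p c = (case p of None \<Rightarrow> Some c | Some a \<Rightarrow> Some (a \<otimes>\<^bsub>A\<^esub> c))"
definition Pwt :: "('a, 'm) normed_scheme \<Rightarrow> 'a option \<times> 'a \<Rightarrow> real"
  where "Pwt A i = Pnrm A (fst i) * nrm A (snd i)"

text \<open>
  The Banach bimodule of bounded bilinear forms \<open>f\<close> on \<open>A\<^sup># \<times> A\<close>, where \<open>A\<^sup># = \<C>1 + A\<close> is the
  unitization; \<open>f(1, b)\<close> is encoded as \<open>f (None, b)\<close> and \<open>f(a, b)\<close> as \<open>f (Some a, b)\<close>. The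
  actions are \<open>(c.f)(a, b) = f(a, bc) - f(ab, c)\<close> and \<open>(f.c)(a, b) = f(ca, b)\<close>. Then
  \<open>\<langle>f, D\<^sub>0 b\<rangle> = f(1, b)\<close> is a derivation into the dual, and a derivation \<open>D : A \<rightarrow> E\<^sup>*\<close> is
  the pull-back of \<open>D\<^sub>0\<close> along the module map \<open>x \<mapsto> ((a, b) \<mapsto> \<langle>x.a, D b\<rangle>)\<close>.
\<close>

definition bilin_mod :: "('a, 'm) normed_scheme \<Rightarrow> ('a, 'a option \<times> 'a \<Rightarrow> complex) bimodule"
  where "bilin_mod A = \<lparr>
    carrier = {f. (\<forall>i. i \<notin> Pset A \<times> carrier A \<longrightarrow> f i = 0) \<and>
      (\<forall>p\<in>Pset A. \<forall>b\<in>carrier A. \<forall>c\<in>carrier A. f (p, b \<oplus>\<^bsub>A\<^esub> c) = f (p, b) + f (p, c)) \<and>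
      (\<forall>z. \<forall>p\<in>Pset A. \<forall>b\<in>carrier A. f (p, z \<odot>\<^bsub>A\<^esub> b) = z * f (p, b)) \<and>
      (\<forall>a\<in>carrier A. \<forall>b\<in>carrier A. \<forall>c\<in>carrier A.
        f (Some (a \<oplus>\<^bsub>A\<^esub> b), c) = f (Some a, c) + f (Some b, c)) \<and>
      (\<forall>z. \<forall>a\<in>carrier A. \<forall>c\<in>carrier A. f (Some (z \<odot>\<^bsub>A\<^esub> a), c) = z * f (Some a, c)) \<and>
      (\<exists>K. \<forall>i\<in>Pset A \<times> carrier A. cmod (f i) \<le> K * Pwt A i)},
    monoid.mult = undefined, one = undefined,
    zero = (\<lambda>_. 0), add = (\<lambda>\<phi> \<psi> x. \<phi> x + \<psi> x), smult = (\<lambda>c \<phi> x. c * \<phi> x),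
    nrm = bound_norm (Pset A \<times> carrier A) (Pwt A),
    lact = (\<lambda>c f i. if i \<in> Pset A \<times> carrier A
      then f (fst i, snd i \<otimes>\<^bsub>A\<^esub> c) - f (Prm A (fst i) (snd i), c) else 0),
    ract = (\<lambda>f c i. if i \<in> Pset A \<times> carrier A then f (Plm A c (fst i), snd i) else 0)\<rparr>"

lemma bilin_ops:
  "add (bilin_mod A) = (\<lambda>f g x. f x + g x)" "zero (bilin_mod A) = (\<lambda>_. 0)"
  "smult (bilin_mod A) = (\<lambda>c f x. c * f x)"
  "nrm (bilin_mod A) = bound_norm (Pset A \<times> carrier A) (Pwt A)"
  "lact (bilin_mod A) c f = (\<lambda>i. if i \<in> Pset A \<times> carrier A
      then f (fst i, snd i \<otimes>\<^bsub>A\<^esub> c) - f (Prm A (fst i) (snd i), c) else 0)"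
  "ract (bilin_mod A) f c = (\<lambda>i. if i \<in> Pset A \<times> carrier A
      then f (Plm A c (fst i), snd i) else 0)"
  by (simp_all add: bilin_mod_def)

lemma bilin_carrier: "f \<in> carrier (bilin_mod A) \<longleftrightarrow>
      (\<forall>i. i \<notin> Pset A \<times> carrier A \<longrightarrow> f i = 0) \<and>
      (\<forall>p\<in>Pset A. \<forall>b\<in>carrier A. \<forall>c\<in>carrier A. f (p, b \<oplus>\<^bsub>A\<^esub> c) = f (p, b) + f (p, c)) \<and>
      (\<forall>z. \<forall>p\<in>Pset A. \<forall>b\<in>carrier A. f (p, z \<odot>\<^bsub>A\<^esub> b) = z * f (p, b)) \<and>
      (\<forall>a\<in>carrier A. \<forall>b\<in>carrier A. \<forall>c\<in>carrier A.
        f (Some (a \<oplus>\<^bsub>A\<^esub> b), c) = f (Some a, c) + f (Some b, c)) \<and>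
      (\<forall>z. \<forall>a\<in>carrier A. \<forall>c\<in>carrier A. f (Some (z \<odot>\<^bsub>A\<^esub> a), c) = z * f (Some a, c)) \<and>
      (\<exists>K. \<forall>i\<in>Pset A \<times> carrier A. cmod (f i) \<le> K * Pwt A i)"
  by (simp add: bilin_mod_def)

context banach_algebra
begin

lemma Pset_cases [consumes 1]:
  assumes "p \<in> Pset A"
  obtains "p = None" | a where "p = Some a" "a \<in> carrier A"
  using assms by (auto simp: Pset_def)

lemma Pset_simps [simp]: "None \<in> Pset A" "Some a \<in> Pset A \<longleftrightarrow> a \<in> carrier A"
  by (auto simp: Pset_def)

lemma Pnrm_nonneg: "p \<in> Pset A \<Longrightarrow> 0 \<le> Pnrm A p"
  by (auto simp: Pset_def Pnrm_def nrm_nonneg)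

lemma Pwt_nonneg: "i \<in> Pset A \<times> carrier A \<Longrightarrow> 0 \<le> Pwt A i"
  by (auto simp: Pwt_def Pnrm_nonneg nrm_nonneg)

lemma Plm_closed: "p \<in> Pset A \<Longrightarrow> c \<in> carrier A \<Longrightarrow> Plm A c p \<in> Pset A"
  by (auto simp: Pset_def Plm_def mult_closed)

lemma Prm_closed: "p \<in> Pset A \<Longrightarrow> c \<in> carrier A \<Longrightarrow> Prm A p c \<in> Pset A"
  by (auto simp: Pset_def Prm_def mult_closed)

lemma Plm_nrm: "p \<in> Pset A \<Longrightarrow> c \<in> carrier A \<Longrightarrow> Pnrm A (Plm A c p) \<le> nrm A c * Pnrm A p"
  by (auto simp: Pset_def Plm_def Pnrm_def nrm_mult)

lemma Prm_nrm: "p \<in> Pset A \<Longrightarrow> c \<in> carrier A \<Longrightarrow> Pnrm A (Prm A p c) \<le> Pnrm A p * nrm A c"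
  by (auto simp: Pset_def Prm_def Pnrm_def nrm_mult)

lemma
  shows bilin_banach_space: "complex_banach_space (bilin_mod A)"
    and bilin_bound: "\<lbrakk>f \<in> carrier (bilin_mod A); i \<in> Pset A \<times> carrier A\<rbrakk>
      \<Longrightarrow> cmod (f i) \<le> nrm (bilin_mod A) f * Pwt A i"
proof -
  let ?U = "bilin_mod A" and ?I = "Pset A \<times> carrier A"
  have bd: "\<exists>K. 0 \<le> K \<and> (\<forall>i\<in>?I. cmod (f i) \<le> K * Pwt A i)" if "f \<in> carrier ?U" for f
    by (rule ex_bound_nonneg) (use that Pwt_nonneg in \<open>auto simp: bilin_carrier\<close>)
  have add: "(\<lambda>x. f x + g x) \<in> carrier ?U"
    if "f \<in> carrier ?U" "g \<in> carrier ?U" for f g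
    using that ex_bound_add[of ?I f "Pwt A" g] unfolding bilin_carrier by (auto simp: algebra_simps)
  have sm: "(\<lambda>x. c * f x) \<in> carrier ?U" if "f \<in> carrier ?U" for c f
    using that ex_bound_smult[of ?I f "Pwt A" c] unfolding bilin_carrier by (auto simp: algebra_simps)
  have z: "(\<lambda>_. 0) \<in> carrier ?U"
    by (auto simp: bilin_carrier intro!: exI[of _ 0])
  have supp: "f x = 0" if "f \<in> carrier ?U" "x \<notin> ?I" for f x
    using that unfolding bilin_carrier by blast
  have lim: "f \<in> carrier ?U" if s: "\<And>n. s n \<in> carrier ?U"
      and l: "\<And>i. (\<lambda>n. s n i) \<longlonglongrightarrow> f i" and "0 \<le> K" and K: "\<And>i. i \<in> ?I \<Longrightarrow> cmod (f i) \<le> K * Pwt A i"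
    for s f K
    unfolding bilin_carrier
  proof (intro conjI allI impI ballI)
    show "\<exists>K. \<forall>x\<in>?I. cmod (f x) \<le> K * Pwt A x" using K by blast
  next
    fix x assume "x \<notin> ?I"
    then show "f x = 0" by (intro limit_zero[OF l] supp[OF s])
  next
    fix p b c assume "p \<in> Pset A" "b \<in> carrier A" "c \<in> carrier A"
    then show "f (p, b \<oplus>\<^bsub>A\<^esub> c) = f (p, b) + f (p, c)"
      using s by (intro limit_add[OF l]) (auto simp: bilin_carrier)
  next
    fix z p b assume "p \<in> Pset A" "b \<in> carrier A"
    then show "f (p, z \<odot>\<^bsub>A\<^esub> b) = z * f (p, b)"
      using s by (intro limit_smult[OF l]) (auto simp: bilin_carrier)
  next
    fix a b c assume "a \<in> carrier A" "b \<in> carrier A" "c \<in> carrier A"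
    then show "f (Some (a \<oplus>\<^bsub>A\<^esub> b), c) = f (Some a, c) + f (Some b, c)"
      using s by (intro limit_add[OF l]) (auto simp: bilin_carrier)
  next
    fix z a c assume "a \<in> carrier A" "c \<in> carrier A"
    then show "f (Some (z \<odot>\<^bsub>A\<^esub> a), c) = z * f (Some a, c)"
      using s by (intro limit_smult[OF l]) (auto simp: bilin_carrier)
  qed
  show "complex_banach_space ?U"
    by (rule function_normed_space(3)[where I="?I" and w="Pwt A"])
      (fact bilin_ops Pwt_nonneg supp bd z add sm lim)+
  show "\<lbrakk>f \<in> carrier ?U; i \<in> ?I\<rbrakk> \<Longrightarrow> cmod (f i) \<le> nrm ?U f * Pwt A i" for f i
    unfolding bilin_ops by (intro bound_normD bd Pwt_nonneg)
qed

lemma bilin_bimodule: "banach_bimodule A (bilin_mod A)"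
proof -
  let ?U = "bilin_mod A" and ?I = "Pset A \<times> carrier A"
  interpret U: complex_banach_space ?U by (rule bilin_banach_space)
  note UN = U.nrm_nonneg
  have Ulin: "f (p, b \<oplus>\<^bsub>A\<^esub> c) = f (p, b) + f (p, c)" "f (p, z \<odot>\<^bsub>A\<^esub> b) = z * f (p, b)"
    if "f \<in> carrier ?U" "p \<in> Pset A" "b \<in> carrier A" "c \<in> carrier A" for f p b c z
    using that by (auto simp: bilin_carrier)
  have Ulin2: "f (Some (a \<oplus>\<^bsub>A\<^esub> b), c) = f (Some a, c) + f (Some b, c)"
      "f (Some (z \<odot>\<^bsub>A\<^esub> a), c) = z * f (Some a, c)"
    if "f \<in> carrier ?U" "a \<in> carrier A" "b \<in> carrier A" "c \<in> carrier A" for f a b c z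
    using that by (auto simp: bilin_carrier)
  have A1: "x \<oplus>\<^bsub>A\<^esub> y \<in> carrier A" "c \<odot>\<^bsub>A\<^esub> x \<in> carrier A"
    if "x \<in> carrier A" "y \<in> carrier A" for x y c using that by auto
  have br: "cmod (f (Plm A c (fst i), snd i)) \<le> (nrm A c * nrm ?U f) * Pwt A i"
    if "f \<in> carrier ?U" "c \<in> carrier A" "i \<in> ?I" for f c i
  proof -
    have "cmod (f (Plm A c (fst i), snd i)) \<le> nrm ?U f * Pwt A (Plm A c (fst i), snd i)"
      using that by (intro bilin_bound) (auto simp: Plm_closed)
    also have "\<dots> \<le> nrm ?U f * ((nrm A c * Pnrm A (fst i)) * nrm A (snd i))"
      unfolding Pwt_def using that by (intro mult_left_mono mult_mono) (auto simp: UN Plm_nrm nrm_nonneg Pnrm_nonneg)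
    finally show ?thesis by (simp add: mult_ac Pwt_def)
  qed
  have bl: "cmod (f (fst i, snd i \<otimes>\<^bsub>A\<^esub> c) - f (Prm A (fst i) (snd i), c)) \<le> (2 * nrm A c * nrm ?U f) * Pwt A i"
    if "f \<in> carrier ?U" "c \<in> carrier A" "i \<in> ?I" for f c i
  proof -
    have "cmod (f (fst i, snd i \<otimes>\<^bsub>A\<^esub> c)) \<le> nrm ?U f * Pwt A (fst i, snd i \<otimes>\<^bsub>A\<^esub> c)"
      using that by (intro bilin_bound) (auto simp: mult_closed)
    also have "\<dots> \<le> nrm ?U f * (Pnrm A (fst i) * (nrm A (snd i) * nrm A c))"
      unfolding Pwt_def using that by (auto simp: UN nrm_mult Pnrm_nonneg intro!: mult_left_mono)
    finally have 1: "cmod (f (fst i, snd i \<otimes>\<^bsub>A\<^esub> c)) \<le> (nrm A c * nrm ?U f) * Pwt A i"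
      by (simp add: mult_ac Pwt_def)
    have "cmod (f (Prm A (fst i) (snd i), c)) \<le> nrm ?U f * Pwt A (Prm A (fst i) (snd i), c)"
      using that by (intro bilin_bound) (auto simp: Prm_closed)
    also have "\<dots> \<le> nrm ?U f * ((Pnrm A (fst i) * nrm A (snd i)) * nrm A c)"
      unfolding Pwt_def using that by (intro mult_left_mono mult_mono) (auto simp: UN Prm_nrm nrm_nonneg Pnrm_nonneg)
    finally have 2: "cmod (f (Prm A (fst i) (snd i), c)) \<le> (nrm A c * nrm ?U f) * Pwt A i"
      by (simp add: mult_ac Pwt_def)
    show ?thesis
      using 1 2 norm_triangle_ineq4[of "f (fst i, snd i \<otimes>\<^bsub>A\<^esub> c)" "f (Prm A (fst i) (snd i), c)"]
      by (simp add: mult.assoc)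
  qed
  show ?thesis
  proof
    fix c f assume c: "c \<in> carrier A" and f: "f \<in> carrier ?U"
    have B: "\<exists>K. \<forall>i\<in>?I. cmod (lact ?U c f i) \<le> K * Pwt A i" using bl[OF f c]
      by (intro exI[of _ "2 * nrm A c * nrm ?U f"]) (simp add: bilin_ops)
    show "lact ?U c f \<in> carrier ?U"
      unfolding bilin_carrier using B
      apply (intro conjI allI ballI impI)
      using c f
      by (auto simp: bilin_ops Prm_def Ulin Ulin2 A1 mult_closed mult_add_left mult_add_right
          mult_smult_left mult_smult_right algebra_simps elim!: Pset_cases)
    have B: "\<exists>K. \<forall>i\<in>?I. cmod (ract ?U f c i) \<le> K * Pwt A i" using br[OF f c]
      by (intro exI[of _ "nrm A c * nrm ?U f"]) (simp add: bilin_ops)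
    show "ract ?U f c \<in> carrier ?U"
      unfolding bilin_carrier using B
      apply (intro conjI allI ballI impI)
      using c f
      by (auto simp: bilin_ops Plm_def Ulin Ulin2 A1 mult_closed mult_add_left mult_add_right
          mult_smult_left mult_smult_right algebra_simps elim!: Pset_cases)
    fix z
    show "lact ?U (z \<odot>\<^bsub>A\<^esub> c) f = z \<odot>\<^bsub>?U\<^esub> lact ?U c f"
      "lact ?U c (z \<odot>\<^bsub>?U\<^esub> f) = z \<odot>\<^bsub>?U\<^esub> lact ?U c f"
      "ract ?U (z \<odot>\<^bsub>?U\<^esub> f) c = z \<odot>\<^bsub>?U\<^esub> ract ?U f c"
      "ract ?U f (z \<odot>\<^bsub>A\<^esub> c) = z \<odot>\<^bsub>?U\<^esub> ract ?U f c"
      using c f by (auto simp: bilin_ops Prm_def Plm_def Ulin Ulin2 mult_closed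
          mult_smult_left mult_smult_right algebra_simps fun_eq_iff elim!: Pset_cases)
    fix d assume d: "d \<in> carrier A"
    show "lact ?U (c \<oplus>\<^bsub>A\<^esub> d) f = lact ?U c f \<oplus>\<^bsub>?U\<^esub> lact ?U d f"
      "ract ?U f (c \<oplus>\<^bsub>A\<^esub> d) = ract ?U f c \<oplus>\<^bsub>?U\<^esub> ract ?U f d"
      "lact ?U c (lact ?U d f) = lact ?U (c \<otimes>\<^bsub>A\<^esub> d) f"
      "ract ?U (ract ?U f c) d = ract ?U f (c \<otimes>\<^bsub>A\<^esub> d)"
      "lact ?U c (ract ?U f d) = ract ?U (lact ?U c f) d"
      using c d f by (auto simp: bilin_ops Prm_def Plm_def Ulin Ulin2 mult_closed mult_assoc
          mult_add_left mult_add_right algebra_simps fun_eq_iff elim!: Pset_cases)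
  next
    fix c f g assume "c \<in> carrier A" "f \<in> carrier ?U" "g \<in> carrier ?U"
    then show "lact ?U c (f \<oplus>\<^bsub>?U\<^esub> g) = lact ?U c f \<oplus>\<^bsub>?U\<^esub> lact ?U c g"
      "ract ?U (f \<oplus>\<^bsub>?U\<^esub> g) c = ract ?U f c \<oplus>\<^bsub>?U\<^esub> ract ?U g c"
      by (auto simp: bilin_ops fun_eq_iff)
  next
    have "nrm ?U (lact ?U c f) \<le> 2 * nrm A c * nrm ?U f"
      if "c \<in> carrier A" "f \<in> carrier ?U" for c f
      using that bl[OF that(2,1)] UN[OF that(2)] nrm_nonneg[OF that(1)]
      unfolding bilin_ops(4) by (intro bound_norm_le) (auto simp: bilin_ops(5))
    then show "\<exists>K. \<forall>a\<in>carrier A. \<forall>x\<in>carrier ?U.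
      nrm ?U (lact ?U a x) \<le> K * nrm A a * nrm ?U x" by blast
    have "nrm ?U (ract ?U f c) \<le> 1 * nrm A c * nrm ?U f"
      if "c \<in> carrier A" "f \<in> carrier ?U" for c f
      using that br[OF that(2,1)] UN[OF that(2)] nrm_nonneg[OF that(1)]
      unfolding bilin_ops(4) by (intro bound_norm_le) (auto simp: bilin_ops(6))
    then show "\<exists>K. \<forall>a\<in>carrier A. \<forall>x\<in>carrier ?U.
      nrm ?U (ract ?U x a) \<le> K * nrm A a * nrm ?U x" by blast
  qed
qed

end

theorem amenable_imp_inner:
  fixes A :: "('a, 'm) normed_scheme" and E :: "('a, 'e, 'k) bimodule_scheme"
  assumes am: "amenable A" and E: "banach_bimodule A E" and der: "derivation A (dual E) D"
  shows "inner_derivation A (dual E) D"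
proof -
  interpret banach_bimodule A E by fact
  let ?U = "bilin_mod A" and ?I = "Pset A \<times> carrier A"
  interpret U: banach_bimodule A ?U by (rule A.bilin_bimodule)
  interpret DU: banach_bimodule A "dual ?U" by (rule U.dual_bimodule)
  interpret DE: banach_bimodule A "dual E" by (rule dual_bimodule)
  define D0 where "D0 = (\<lambda>b f. if f \<in> carrier ?U then f (None, b) else 0)"
  have D0b: "cmod (f (None, b)) \<le> nrm A b * nrm ?U f" if "f \<in> carrier ?U" "b \<in> carrier A" for f b
    using A.bilin_bound[OF that(1), of "(None, b)"] that(2) by (simp add: Pwt_def Pnrm_def mult.commute)
  have Ucl: "(\<lambda>x. f x + g x) \<in> carrier ?U" "(\<lambda>x. z * f x) \<in> carrier ?U"
    if "f \<in> carrier ?U" "g \<in> carrier ?U" for f g z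
    using U.E.M.add.m_closed[OF that] U.E.smult_closed[of z f] that by (simp_all add: bilin_ops)
  have Uadd: "f (None, b \<oplus>\<^bsub>A\<^esub> c) = f (None, b) + f (None, c)"
      "f (None, z \<odot>\<^bsub>A\<^esub> b) = z * f (None, b)"
    if "f \<in> carrier ?U" "b \<in> carrier A" "c \<in> carrier A" for f b c z
    using that by (auto simp: bilin_carrier)
  have "derivation A (dual ?U) D0"
    unfolding derivation_def
  proof (intro conjI ballI allI)
    fix b assume b: "b \<in> carrier A"
    show "D0 b \<in> carrier (dual ?U)"
      unfolding dual_carrier
    proof (intro conjI ballI allI impI)
      show "\<exists>K. \<forall>f\<in>carrier ?U. cmod (D0 b f) \<le> K * nrm ?U f"
        using D0b[OF _ b] by (auto simp: D0_def)
    qed (use Ucl in \<open>simp_all add: D0_def bilin_ops(1,3)\<close>)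
    show "D0 (c \<odot>\<^bsub>A\<^esub> b) = c \<odot>\<^bsub>dual ?U\<^esub> D0 b" for c
      using b by (simp add: D0_def dual_ops Uadd fun_eq_iff)
    fix c assume c: "c \<in> carrier A"
    show "D0 (b \<oplus>\<^bsub>A\<^esub> c) = D0 b \<oplus>\<^bsub>dual ?U\<^esub> D0 c"
      using b c by (simp add: D0_def dual_ops Uadd fun_eq_iff)
    show "D0 (b \<otimes>\<^bsub>A\<^esub> c) = lact (dual ?U) b (D0 c) \<oplus>\<^bsub>dual ?U\<^esub> ract (dual ?U) (D0 b) c"
    proof
      fix f
      show "D0 (b \<otimes>\<^bsub>A\<^esub> c) f = (lact (dual ?U) b (D0 c) \<oplus>\<^bsub>dual ?U\<^esub> ract (dual ?U) (D0 b) c) f"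
      proof (cases "f \<in> carrier ?U")
        case f: True
        have "lact ?U c f (None, b) = f (None, b \<otimes>\<^bsub>A\<^esub> c) - f (Some b, c)"
          "ract ?U f b (None, c) = f (Some b, c)"
          using b c by (simp_all add: bilin_ops Plm_def Prm_def)
        then show ?thesis using f U.lact_closed[OF c f] U.ract_closed[OF b f]
          by (simp add: D0_def dual_ops)
      qed (simp add: D0_def dual_ops)
    qed
  next
    have "nrm (dual ?U) (D0 b) \<le> 1 * nrm A b" if b: "b \<in> carrier A" for b
      unfolding dual_ops using D0b[OF _ b] b by (intro bound_norm_le) (auto simp: D0_def A.nrm_nonneg)
    then show "\<exists>K. \<forall>a\<in>carrier A. nrm (dual ?U) (D0 a) \<le> K * nrm A a" by blast
  qed
  then have "inner_derivation A (dual ?U) D0"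
    using am U.banach_bimodule_axioms unfolding amenable_def by blast
  then obtain \<Psi> where \<Psi>: "\<Psi> \<in> carrier (dual ?U)"
    and D0\<Psi>: "\<And>a. a \<in> carrier A \<Longrightarrow> D0 a = ract (dual ?U) \<Psi> a \<ominus>\<^bsub>dual ?U\<^esub> lact (dual ?U) a \<Psi>"
    unfolding inner_derivation_def by blast
  have inn: "f (None, a) = \<Psi> (lact ?U a f) - \<Psi> (ract ?U f a)"
    if "a \<in> carrier A" "f \<in> carrier ?U" for a f
    using fun_cong[OF D0\<Psi>[OF that(1)], of f] that
    unfolding dual_minus[OF U.E.complex_normed_space_axioms DU.ract_closed[OF that(1) \<Psi>]
        DU.lact_closed[OF that(1) \<Psi>]]
    by (simp add: D0_def dual_ops)
  have Dc: "D b \<in> carrier (dual E)" if "b \<in> carrier A" for b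
    using der that by (auto simp: derivation_def)
  have Dlin: "D b (x \<oplus>\<^bsub>E\<^esub> y) = D b x + D b y" "D b (z \<odot>\<^bsub>E\<^esub> x) = z * D b x"
    if "b \<in> carrier A" "x \<in> carrier E" "y \<in> carrier E" for b x y z
    using Dc[OF that(1)] that by (auto simp: dual_carrier)
  have Dadd: "D (b \<oplus>\<^bsub>A\<^esub> c) x = D b x + D c x" "D (z \<odot>\<^bsub>A\<^esub> b) x = z * D b x"
    if "b \<in> carrier A" "c \<in> carrier A" for b c x z
    using der that by (auto simp: derivation_def dual_ops)
  have Dmult: "D (b \<otimes>\<^bsub>A\<^esub> c) x = D c (ract E x b) + D b (lact E c x)"
    if "b \<in> carrier A" "c \<in> carrier A" "x \<in> carrier E" for b c x
    using der that by (auto simp: derivation_def dual_ops)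
  obtain K where K: "\<And>b. b \<in> carrier A \<Longrightarrow> nrm (dual E) (D b) \<le> K * nrm A b"
    using der unfolding derivation_def by blast
  obtain L where L: "0 \<le> L" "\<And>a x. a \<in> carrier A \<Longrightarrow> x \<in> carrier E \<Longrightarrow>
      nrm E (ract E x a) \<le> L * nrm A a * nrm E x" using ract_bound by blast
  define K' where "K' = \<bar>K\<bar>"
  have K': "0 \<le> K'" "nrm (dual E) (D b) \<le> K' * nrm A b" if "b \<in> carrier A" for b
    using K[OF that] mult_right_mono[OF abs_ge_self A.nrm_nonneg[OF that], of K] unfolding K'_def by auto
  have K'0: "0 \<le> K'" by (simp add: K'_def)
  have Db: "cmod (D b x) \<le> K' * nrm A b * nrm E x" if "b \<in> carrier A" "x \<in> carrier E" for b x
    using dual_bound[OF E.complex_normed_space_axioms Dc[OF that(1)] that(2)]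
      mult_right_mono[OF K'(2)[OF that(1)] E.nrm_nonneg[OF that(2)]] by linarith
  define xp where "xp = (\<lambda>x p. case p of None \<Rightarrow> x | Some a \<Rightarrow> ract E x a)"
  define \<theta> where "\<theta> = (\<lambda>x i. if i \<in> ?I then D (snd i) (xp x (fst i)) else 0)"
  have xp_closed: "xp x p \<in> carrier E" if "x \<in> carrier E" "p \<in> Pset A" for x p
    using that by (auto simp: xp_def ract_closed elim!: A.Pset_cases)
  have xpb: "nrm E (xp x p) \<le> (L + 1) * Pnrm A p * nrm E x" if "x \<in> carrier E" "p \<in> Pset A" for x p
    using that(2)
  proof (cases rule: A.Pset_cases)
    case 1
    then show ?thesis using L(1) E.nrm_nonneg[OF that(1)] by (simp add: xp_def Pnrm_def distrib_right)
  next
    case (2 a)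
    have "L * nrm A a * nrm E x \<le> (L + 1) * nrm A a * nrm E x"
      using that 2 by (intro mult_right_mono) (auto simp: E.nrm_nonneg A.nrm_nonneg)
    then show ?thesis using 2 L(2)[OF 2(2) that(1)] by (simp add: xp_def Pnrm_def)
  qed
  have \<theta>b: "cmod (\<theta> x i) \<le> (K' * (L + 1) * nrm E x) * Pwt A i" if "x \<in> carrier E" "i \<in> ?I" for x i
  proof -
    have "cmod (\<theta> x i) \<le> K' * nrm A (snd i) * nrm E (xp x (fst i))"
      using that by (auto simp: \<theta>_def intro!: Db xp_closed)
    also have "\<dots> \<le> K' * nrm A (snd i) * ((L + 1) * Pnrm A (fst i) * nrm E x)"
      using that K'0 by (intro mult_left_mono xpb) (auto simp: A.nrm_nonneg)
    finally show ?thesis by (simp add: Pwt_def mult_ac)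
  qed
  have \<theta>_closed: "\<theta> x \<in> carrier ?U" if x: "x \<in> carrier E" for x
    unfolding bilin_carrier
    apply (intro conjI allI ballI impI)
    subgoal by (auto simp: \<theta>_def)
    subgoal using x by (auto simp: \<theta>_def Dadd)
    subgoal using x by (auto simp: \<theta>_def Dadd)
    subgoal using x by (auto simp: \<theta>_def xp_def ract_add_right Dlin ract_closed)
    subgoal using x by (auto simp: \<theta>_def xp_def ract_smult_right Dlin ract_closed)
    subgoal using \<theta>b[OF x] by blast
    done
  have \<theta>_add: "\<theta> (x \<oplus>\<^bsub>E\<^esub> y) = \<theta> x \<oplus>\<^bsub>?U\<^esub> \<theta> y" if "x \<in> carrier E" "y \<in> carrier E" for x y
    using that by (auto simp: \<theta>_def bilin_ops xp_def ract_add_left Dlin ract_closed fun_eq_iff elim!: A.Pset_cases)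
  have \<theta>_smult: "\<theta> (z \<odot>\<^bsub>E\<^esub> x) = z \<odot>\<^bsub>?U\<^esub> \<theta> x" if "x \<in> carrier E" for x z
    using that by (auto simp: \<theta>_def bilin_ops xp_def ract_smult_left Dlin ract_closed fun_eq_iff elim!: A.Pset_cases)
  have \<theta>_lact: "\<theta> (lact E c x) = lact ?U c (\<theta> x)" if "x \<in> carrier E" "c \<in> carrier A" for x c
    using that by (auto simp: \<theta>_def bilin_ops xp_def Prm_def lact_ract[symmetric] ract_ract Dmult A.mult_closed
        ract_closed lact_closed fun_eq_iff elim!: A.Pset_cases)
  have \<theta>_ract: "\<theta> (ract E x c) = ract ?U (\<theta> x) c" if "x \<in> carrier E" "c \<in> carrier A" for x c
    using that by (auto simp: \<theta>_def bilin_ops xp_def Plm_def ract_ract A.mult_closed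
        ract_closed fun_eq_iff elim!: A.Pset_cases)
  have \<theta>n: "nrm ?U (\<theta> x) \<le> K' * (L + 1) * nrm E x" if x: "x \<in> carrier E" for x
    unfolding bilin_ops using \<theta>b[OF x] K'0 L(1) E.nrm_nonneg[OF x] by (intro bound_norm_le) auto
  define \<phi> where "\<phi> = (\<lambda>x. if x \<in> carrier E then \<Psi> (\<theta> x) else 0)"
  have \<Psi>lin: "\<Psi> (f \<oplus>\<^bsub>?U\<^esub> g) = \<Psi> f + \<Psi> g" "\<Psi> (z \<odot>\<^bsub>?U\<^esub> f) = z * \<Psi> f"
    if "f \<in> carrier ?U" "g \<in> carrier ?U" for f g z
    using \<Psi> that by (auto simp: dual_carrier)
  have \<phi>b: "cmod (\<phi> x) \<le> (nrm (dual ?U) \<Psi> * (K' * (L + 1))) * nrm E x" if x: "x \<in> carrier E" for x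
  proof -
    have "cmod (\<phi> x) \<le> nrm (dual ?U) \<Psi> * nrm ?U (\<theta> x)"
      using x by (simp add: \<phi>_def dual_bound[OF U.E.complex_normed_space_axioms \<Psi> \<theta>_closed])
    also have "\<dots> \<le> nrm (dual ?U) \<Psi> * (K' * (L + 1) * nrm E x)"
      by (intro mult_left_mono \<theta>n x DU.E.nrm_nonneg \<Psi>)
    finally show ?thesis by (simp add: mult_ac)
  qed
  have \<phi>: "\<phi> \<in> carrier (dual E)"
    unfolding dual_carrier
  proof (intro conjI allI impI ballI)
    show "\<exists>K. \<forall>x\<in>carrier E. cmod (\<phi> x) \<le> K * nrm E x" using \<phi>b by blast
    show "\<phi> (x \<oplus>\<^bsub>E\<^esub> y) = \<phi> x + \<phi> y" if "x \<in> carrier E" "y \<in> carrier E" for x y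
      using that by (simp add: \<phi>_def \<theta>_add \<Psi>lin \<theta>_closed)
    show "\<phi> (c \<odot>\<^bsub>E\<^esub> x) = c * \<phi> x" if "x \<in> carrier E" for c x
      using that by (simp add: \<phi>_def \<theta>_smult \<Psi>lin(2)[OF \<theta>_closed \<theta>_closed])
  qed (simp add: \<phi>_def)
  show ?thesis
    unfolding inner_derivation_def
  proof (intro bexI[OF _ \<phi>] ballI)
    fix a assume a: "a \<in> carrier A"
    note minus = dual_minus[OF E.complex_normed_space_axioms DE.ract_closed[OF a \<phi>]
        DE.lact_closed[OF a \<phi>]]
    show "D a = ract (dual E) \<phi> a \<ominus>\<^bsub>dual E\<^esub> lact (dual E) a \<phi>"
    proof
      fix x
      show "D a x = (ract (dual E) \<phi> a \<ominus>\<^bsub>dual E\<^esub> lact (dual E) a \<phi>) x"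
      proof (cases "x \<in> carrier E")
        case x: True
        have "D a x = \<theta> x (None, a)" using x a by (simp add: \<theta>_def xp_def)
        also have "\<dots> = \<Psi> (\<theta> (lact E a x)) - \<Psi> (\<theta> (ract E x a))"
          using inn[OF a \<theta>_closed[OF x]] x a by (simp add: \<theta>_lact \<theta>_ract)
        finally show ?thesis
          unfolding minus using x a by (simp add: dual_ops \<phi>_def lact_closed ract_closed)
      next
        case False
        then show ?thesis
          unfolding minus using Dc[OF a] by (simp add: dual_carrier dual_ops)
      qed
    qed
  qed
qed

theorem primitive_ideal_rep_kernel:
  fixes A :: "('a, 'm) normed_scheme" and V :: "(complex, 'v, 'n) module_scheme"
  assumes "banach_algebra A" "irreducible_rep A V \<rho>"
  shows "primitive_ideal A (rep_kernel A V \<rho>)"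
proof -
  interpret A: banach_algebra A by fact
  interpret irreducible_rep A V \<rho> by fact
  obtain a0 v0 where v0: "a0 \<in> carrier A" "v0 \<in> carrier V" "\<rho> a0 v0 \<noteq> \<zero>\<^bsub>V\<^esub>"
    using rep_nonzero by blast
  have neg: "\<ominus>\<^bsub>V\<^esub> v = (-1) \<odot>\<^bsub>V\<^esub> v" if "v \<in> carrier V" for v
  proof -
    have "(-1) \<odot>\<^bsub>V\<^esub> v \<oplus>\<^bsub>V\<^esub> 1 \<odot>\<^bsub>V\<^esub> v = \<zero>\<^bsub>V\<^esub>"
      using that V.smult_l_distr[of "-1" 1 v] V.smult_l_null[of v] by simp
    then show ?thesis
      using that V.smult_one[of v] V.smult_closed[of "-1" v] by (intro V.M.minus_equality) auto
  qed
  have subI: "submodule W \<C> V" if sub: "W \<subseteq> carrier V" and ne: "W \<noteq> {}"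
      and ad: "\<And>v w. v \<in> W \<Longrightarrow> w \<in> W \<Longrightarrow> v \<oplus>\<^bsub>V\<^esub> w \<in> W"
      and sm: "\<And>c v. v \<in> W \<Longrightarrow> c \<odot>\<^bsub>V\<^esub> v \<in> W" for W
  proof (rule V.submoduleI)
    obtain w where w: "w \<in> W" using ne by blast
    then have "0 \<odot>\<^bsub>V\<^esub> w = \<zero>\<^bsub>V\<^esub>" using sub V.smult_l_null[of w] by auto
    then show "\<zero>\<^bsub>V\<^esub> \<in> W" using sm[OF w, of 0] by simp
    show "\<ominus>\<^bsub>V\<^esub> w \<in> W" if "w \<in> W" for w
      using neg[of w] that sub sm[OF that, of "-1"] by auto
  qed (use sub ad sm in auto)
  have "submodule ((\<lambda>a. \<rho> a v0) ` carrier A) \<C> V"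
  proof (rule subI)
    show "(\<lambda>a. \<rho> a v0) ` carrier A \<subseteq> carrier V" using v0 by (auto simp: rep_closed)
    show "(\<lambda>a. \<rho> a v0) ` carrier A \<noteq> {}" using v0 by auto
  next
    fix v w assume "v \<in> (\<lambda>a. \<rho> a v0) ` carrier A" "w \<in> (\<lambda>a. \<rho> a v0) ` carrier A"
    then obtain a b where "a \<in> carrier A" "b \<in> carrier A" "v = \<rho> a v0" "w = \<rho> b v0" by blast
    then show "v \<oplus>\<^bsub>V\<^esub> w \<in> (\<lambda>a. \<rho> a v0) ` carrier A"
      using v0 rep_add_left[of a b v0] by (intro image_eqI[of _ _ "a \<oplus>\<^bsub>A\<^esub> b"]) auto
  next
    fix c v assume "v \<in> (\<lambda>a. \<rho> a v0) ` carrier A"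
    then obtain a where "a \<in> carrier A" "v = \<rho> a v0" by blast
    then show "c \<odot>\<^bsub>V\<^esub> v \<in> (\<lambda>a. \<rho> a v0) ` carrier A"
      using v0 rep_smult_left[of a v0 c] by (intro image_eqI[of _ _ "c \<odot>\<^bsub>A\<^esub> a"]) auto
  qed
  moreover have "\<rho> a w \<in> (\<lambda>a. \<rho> a v0) ` carrier A"
    if "a \<in> carrier A" "w \<in> (\<lambda>a. \<rho> a v0) ` carrier A" for a w
    using that v0 by (auto simp: rep_mult[symmetric] A.mult_closed)
  ultimately have "(\<lambda>a. \<rho> a v0) ` carrier A = {\<zero>\<^bsub>V\<^esub>} \<or> (\<lambda>a. \<rho> a v0) ` carrier A = carrier V"
    by (rule rep_irreducible)
  then have cyc: "(\<lambda>a. \<rho> a v0) ` carrier A = carrier V" using v0 by blast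
  define h where "h = (\<lambda>a. \<rho> a v0)"
  define g where "g = (\<lambda>v. SOME a. a \<in> carrier A \<and> h a = v)"
  have hg: "h (g v) = v" if "v \<in> carrier V" for v
  proof -
    have "\<exists>a. a \<in> carrier A \<and> h a = v"
      using that unfolding cyc[symmetric] h_def by blast
    then show ?thesis unfolding g_def by (rule someI2_ex) simp
  qed
  define V' :: "(complex, 'a) module" where "V' = \<lparr>carrier = g ` carrier V,
    monoid.mult = undefined, one = undefined, zero = g \<zero>\<^bsub>V\<^esub>,
    add = (\<lambda>y z. g (h y \<oplus>\<^bsub>V\<^esub> h z)), smult = (\<lambda>c y. g (c \<odot>\<^bsub>V\<^esub> h y))\<rparr>"
  define \<rho>' where "\<rho>' = (\<lambda>a y. g (\<rho> a (h y)))"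
  have V': "carrier V' = g ` carrier V" "\<zero>\<^bsub>V'\<^esub> = g \<zero>\<^bsub>V\<^esub>"
    "y \<oplus>\<^bsub>V'\<^esub> z = g (h y \<oplus>\<^bsub>V\<^esub> h z)" "c \<odot>\<^bsub>V'\<^esub> y = g (c \<odot>\<^bsub>V\<^esub> h y)" for y z c
    by (simp_all add: V'_def)
  have sc: "c \<odot>\<^bsub>V\<^esub> v \<in> carrier V" if "v \<in> carrier V" for c v
    using that by simp
  have ginj: "g v = g w \<longleftrightarrow> v = w" if "v \<in> carrier V" "w \<in> carrier V" for v w
    using hg that by metis
  have ab: "abelian_group V'"
  proof (rule abelian_groupI)
    fix x assume "x \<in> carrier V'"
    then obtain v where v: "v \<in> carrier V" "x = g v" by (auto simp: V')
    then have "g (\<ominus>\<^bsub>V\<^esub> v) \<oplus>\<^bsub>V'\<^esub> x = \<zero>\<^bsub>V'\<^esub>" by (simp add: V' hg V.M.l_neg)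
    then show "\<exists>y\<in>carrier V'. y \<oplus>\<^bsub>V'\<^esub> x = \<zero>\<^bsub>V'\<^esub>" using v by (auto simp: V')
  qed (auto simp: V' hg V.M.a_ac V.M.add.m_closed)
  have "Module.module \<C> V'"
  proof (rule moduleI[OF cring_C ab])
    fix a b x assume "x \<in> carrier V'"
    then show "(a \<oplus>\<^bsub>\<C>\<^esub> b) \<odot>\<^bsub>V'\<^esub> x = a \<odot>\<^bsub>V'\<^esub> x \<oplus>\<^bsub>V'\<^esub> b \<odot>\<^bsub>V'\<^esub> x"
      "(a \<otimes>\<^bsub>\<C>\<^esub> b) \<odot>\<^bsub>V'\<^esub> x = a \<odot>\<^bsub>V'\<^esub> (b \<odot>\<^bsub>V'\<^esub> x)"
      using V.smult_l_distr[of a b] V.smult_assoc1[of a b] by (auto simp: V' hg sc)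
  next
    fix x assume "x \<in> carrier V'"
    then show "\<one>\<^bsub>\<C>\<^esub> \<odot>\<^bsub>V'\<^esub> x = x" using V.smult_one by (auto simp: V' hg)
  qed (auto simp: V' hg sc V.smult_r_distr)
  then interpret V': Module.module \<C> V' .
  have "irreducible_rep A V' \<rho>'"
  proof
    obtain v where "v \<in> carrier V" "\<rho> a0 v \<noteq> \<zero>\<^bsub>V\<^esub>" using v0 by blast
    then show "\<exists>a\<in>carrier A. \<exists>v\<in>carrier V'. \<rho>' a v \<noteq> \<zero>\<^bsub>V'\<^esub>"
      using v0(1) by (intro bexI[of _ a0] bexI[of _ "g v"]) (auto simp: V' \<rho>'_def hg ginj rep_closed)
  next
    fix W assume W: "submodule W \<C> V'" and inv: "\<And>a w. \<lbrakk>a \<in> carrier A; w \<in> W\<rbrakk> \<Longrightarrow> \<rho>' a w \<in> W"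
    note WE = V'.submoduleE[OF W]
    have Wg: "\<exists>v. v \<in> carrier V \<and> w = g v" if "w \<in> W" for w using WE(1) that by (auto simp: V')
    have Wgh: "g (h w) = w" "h w \<in> carrier V" if "w \<in> W" for w using Wg[OF that] hg by auto
    have "submodule (h ` W) \<C> V"
    proof (rule subI)
      show "h ` W \<subseteq> carrier V" using Wgh by auto
      show "h ` W \<noteq> {}" using WE(2) by auto
    next
      fix v w assume "v \<in> h ` W" "w \<in> h ` W"
      then obtain x y where xy: "x \<in> W" "y \<in> W" "v = h x" "w = h y" by blast
      then have "h (x \<oplus>\<^bsub>V'\<^esub> y) = v \<oplus>\<^bsub>V\<^esub> w" using Wgh by (simp add: V' hg)
      then show "v \<oplus>\<^bsub>V\<^esub> w \<in> h ` W" using WE(5) xy by (metis image_eqI)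
    next
      fix c v assume "v \<in> h ` W"
      then obtain x where x: "x \<in> W" "v = h x" by blast
      then have "h (c \<odot>\<^bsub>V'\<^esub> x) = c \<odot>\<^bsub>V\<^esub> v" using Wgh by (simp add: V' hg sc)
      moreover have "c \<odot>\<^bsub>V'\<^esub> x \<in> W" using WE(4)[of c x] x by simp
      ultimately show "c \<odot>\<^bsub>V\<^esub> v \<in> h ` W" by (metis image_eqI)
    qed
    moreover have "\<rho> a w \<in> h ` W" if a: "a \<in> carrier A" and w: "w \<in> h ` W" for a w
    proof -
      obtain x where x: "x \<in> W" "w = h x" using w by blast
      have "h (\<rho>' a x) = \<rho> a w" using x a Wgh by (simp add: \<rho>'_def hg rep_closed)
      then show ?thesis using inv[OF a x(1)] by (metis image_eqI)
    qed
    ultimately have "h ` W = {\<zero>\<^bsub>V\<^esub>} \<or> h ` W = carrier V" by (rule rep_irreducible)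
    moreover have "W = g ` h ` W" using Wgh by (force simp: image_image)
    ultimately show "W = {\<zero>\<^bsub>V'\<^esub>} \<or> W = carrier V'" by (auto simp: V')
  qed (auto simp: V' \<rho>'_def hg sc rep_closed rep_add_left rep_add_right rep_smult_left
      rep_smult_right rep_mult)
  moreover have "rep_kernel A V \<rho> = rep_kernel A V' \<rho>'"
    by (auto simp: rep_kernel_def V' \<rho>'_def hg ginj rep_closed)
  ultimately show ?thesis unfolding primitive_ideal_def by blast
qed

lemma radical_algebra_iff_no_primitive_ideal:
  "radical_algebra A \<longleftrightarrow> (\<nexists>P. primitive_ideal A P)"
proof
  assume r: "radical_algebra A"
  show "\<nexists>P. primitive_ideal A P"
  proof
    assume "\<exists>P. primitive_ideal A P"
    then obtain V :: "(complex, 'a) module" and \<rho>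
      where i: "irreducible_rep A V \<rho>" and p: "primitive_ideal A (rep_kernel A V \<rho>)"
      by (auto simp: primitive_ideal_def)
    have "carrier A \<subseteq> rep_kernel A V \<rho>"
      using r p by (auto simp: radical_algebra_def jacobson_radical_def)
    then show False using irreducible_rep.rep_nonzero[OF i] by (auto simp: rep_kernel_def)
  qed
qed (auto simp: radical_algebra_def jacobson_radical_def)

end

theory Submission
  imports Defs
begin

text \<open>
  The algebra is generated by a central, quasinilpotent element \<open>V\<close> and matrix units
  \<open>e\<^bsub>xy\<^esub>\<close> indexed by dyadic intervals of the half line, where \<open>e\<^bsub>xy\<^esub>\<close> sends \<open>f\<close> to the mean of
  \<open>f\<close> over \<open>y\<close> times the indicator of \<open>x\<close>. Its norm on \<open>L\<^sup>\<infinity>\<close> is \<open>1\<close> and on \<open>L\<^sup>1\<close> is \<open>|x| / |y|\<close>; it is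
  made contractive by giving it the degree \<open>j = log\<^sub>2 (|y| / |x|)\<close>, that is, multiplying it by \<open>(1 + V)\<^sup>j\<close>.
  For this the powers of \<open>(1 + V)\<^sup>-\<^sup>1\<close> must be bounded while \<open>V\<close> is quasinilpotent and nonzero, as for
  the Volterra operator on \<open>L\<^sup>2\<close>. Here \<open>V\<close> is realized as the forward difference acting on the sequence
  of values of \<open>cosh (sqrt t)\<close> at the integers, which is bounded by \<open>1\<close> on the negative half line and by
  \<open>2 powr t\<close> on the positive one, and whose \<open>k\<close>-th differences decay like \<open>2\<^sup>k / k!\<close>.
  A bounded functional on the free monoid built from this sequence shows that the largest norm making
  all signed partial permutations of equally long intervals contractive does not vanish.

  The closed subalgebra generated by the \<open>V e\<^bsub>xy\<^esub>\<close> is radical because the central multipliers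
  \<open>1 - (1 / n) (\<Sum>i=1..n. (1 + V)\<^sup>-\<^sup>i)\<close> form an approximate identity and
  are divisible by \<open>V\<close>. An approximate diagonal is obtained from
  \<open>(1 / m) (\<Sum>x y. e\<^bsub>xy\<^esub> \<otimes> e\<^bsub>yx\<^esub>)\<close>, a mean of tensors \<open>g \<otimes> g\<^sup>-\<^sup>1\<close> over signed permutations, where
  \<open>x\<close> runs through intervals of length \<open>2\<^sup>-\<^sup>r\<close> and \<open>y\<close> through intervals of length \<open>1\<close>. Multiplied by a coarser
  \<open>e\<^bsub>uv\<^esub>\<close>, it depends on \<open>r\<close> only through a factor \<open>(1 + V)\<^sup>r \<otimes> (1 + V)\<^sup>-\<^sup>r\<close>, so that averaging over \<open>r\<close>
  makes it commute asymptotically with \<open>V\<close>.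
\<close>

section \<open>Differences of an entire function of order one half\<close>

text \<open>A bounded approximate identity of a radical algebra cannot consist of nonzero
  idempotents such as sums of matrix units, since these are never quasinilpotent. The factor V
  removes this obstruction, and boundedness of the powers of (1 + V)^-1 keeps suitable multipliers
  divisible by V bounded. The powers of 1 + V cannot be bounded too: by a theorem of Gelfand, an
  element with spectrum {1} whose positive and negative powers are all bounded is 1. For the
  sequence this means that an entire function of exponential type zero that is bounded on the whole
  line is constant, whereas order one half allows boundedness on a half line. This one-sidedness
  shapes everything. Degrees carry a sign, and where the sequence grows like 2^j the operators on
  L^1 must shrink like 2^-j, so two function spaces are used at once. Likewise (1 + V)^r \<otimes>
  (1 + V)^-r has no uniform bound of its own; it is controlled only where it occurs as the diagonal
  multiplied by a matrix unit.\<close>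

definition hcoeff :: "nat \<Rightarrow> nat \<Rightarrow> real"
  where "hcoeff k i = fact (i + k) / (fact i * fact (2 * (i + k)))"

text \<open>This is \<open>cosh (sqrt t)\<close> for \<open>t \<ge> 0\<close> and \<open>cos (sqrt (- t))\<close> for \<open>t \<le> 0\<close> if \<open>k = 0\<close>, and its \<open>k\<close>-th
  derivative in general.\<close>

definition hfun :: "nat \<Rightarrow> real \<Rightarrow> real"
  where "hfun k t = (\<Sum>i. hcoeff k i * t ^ i)"

lemma fact_double_ge: "2 ^ n * fact n * fact n \<le> (fact (2 * n) :: real)"
proof (induction n)
  case (Suc n)
  have "2 ^ Suc n * fact (Suc n) * fact (Suc n) = (2 * (1 + real n) ^ 2) * (2 ^ n * fact n * fact n)"
    by (simp add: power2_eq_square algebra_simps)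
  also have "\<dots> \<le> ((2 * real n + 2) * (2 * real n + 1)) * fact (2 * n)"
  proof (rule mult_mono)
    have "0 \<le> 2 * (real n * real n) + 2 * real n" by simp
    then show "2 * (1 + real n)\<^sup>2 \<le> (2 * real n + 2) * (2 * real n + 1)"
      by (simp add: power2_eq_square algebra_simps)
  qed (use Suc.IH in auto)
  also have "\<dots> = fact (2 * Suc n)" by (simp add: algebra_simps)
  finally show ?case .
qed simp

lemma hcoeff_nonneg: "0 \<le> hcoeff k i"
  by (simp add: hcoeff_def)

text \<open>The bound \<open>(2 n)! \<ge> 2 ^ n * n! * n!\<close> with \<open>n = i + k\<close>
  splits off \<open>1 / k!\<close> and leaves the Taylor coefficients of
  \<open>exp (t / 2)\<close>.\<close>

lemma hcoeff_le: "hcoeff k i \<le> (1/2) ^ i / (fact i * fact k)"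
proof -
  have "2 ^ i * fact (i + k) * fact k \<le> (2 ^ (i + k) * fact (i + k) * fact (i + k) :: real)"
    by (intro mult_mono) (auto intro: fact_mono power_increasing)
  also have "\<dots> \<le> fact (2 * (i + k))" by (rule fact_double_ge)
  finally have "2 ^ i * fact (i + k) * fact k \<le> (fact (2 * (i + k)) :: real)" .
  then show ?thesis by (simp add: hcoeff_def field_simps power_one_over)
qed

lemma exp_half_sums: "(\<lambda>i. (1/2) ^ i / (fact i * fact k) * \<bar>t\<bar> ^ i) sums (exp (\<bar>t\<bar> / 2) / fact k :: real)"
proof -
  have "(\<lambda>i. (\<bar>t\<bar> / 2) ^ i /\<^sub>R fact i / fact k) sums (exp (\<bar>t\<bar> / 2) / fact k :: real)"
    by (intro sums_divide exp_converges)
  then show ?thesis by (simp add: power_divide field_simps)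
qed

lemma summable_hcoeff: "summable (\<lambda>i. hcoeff k i * t ^ i)"
proof (rule summable_comparison_test'[of _ 0])
  show "summable (\<lambda>i. (1/2) ^ i / (fact i * fact k) * \<bar>t\<bar> ^ i)"
    using exp_half_sums by (rule sums_summable)
  show "norm (hcoeff k n * t ^ n) \<le> (1/2) ^ n / (fact n * fact k) * \<bar>t\<bar> ^ n" for n
    using mult_right_mono[OF hcoeff_le[of k n], of "\<bar>t\<bar> ^ n"] hcoeff_nonneg[of k n]
    by (simp add: abs_mult power_abs)
qed

lemma hfun_le_exp: "0 \<le> t \<Longrightarrow> \<bar>hfun k t\<bar> \<le> exp (t / 2) / fact k"
proof -
  assume t: "0 \<le> t"
  have 1: "(\<lambda>i. (1/2) ^ i / (fact i * fact k) * t ^ i) sums (exp (t / 2) / fact k)"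
    using exp_half_sums[of k t] t by simp
  have 2: "(\<lambda>i. hcoeff k i * t ^ i) sums hfun k t"
    unfolding hfun_def by (rule summable_sums[OF summable_hcoeff])
  have "hcoeff k i * t ^ i \<le> (1/2) ^ i / (fact i * fact k) * t ^ i" for i
    by (rule mult_right_mono[OF hcoeff_le]) (use t in simp)
  then have "hfun k t \<le> exp (t / 2) / fact k"
    by (rule sums_le[OF _ 2 1])
  moreover have "0 \<le> hfun k t"
    unfolding hfun_def using t hcoeff_nonneg by (intro suminf_nonneg summable_hcoeff) simp
  ultimately show ?thesis by simp
qed

lemma diffs_hcoeff: "diffs (hcoeff k) = hcoeff (Suc k)"
proof
  fix i
  have "diffs (hcoeff k) i = (1 + real i) * fact (Suc i + k) / ((1 + real i) * fact i * fact (2 * (Suc i + k)))"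
    by (simp add: diffs_def hcoeff_def)
  also have "\<dots> = hcoeff (Suc k) i" by (simp add: hcoeff_def)
  finally show "diffs (hcoeff k) i = hcoeff (Suc k) i" .
qed

lemma hfun_deriv: "(hfun k has_real_derivative hfun (Suc k) t) (at t)"
  using termdiffs_strong_converges_everywhere[of "hcoeff k" t] summable_hcoeff
  by (simp add: hfun_def[abs_def] diffs_hcoeff)

text \<open>These are the derivatives of the differential equation \<open>4 t f'' + 2 f' = f\<close>
  of \<open>cosh (sqrt t)\<close>, obtained by comparing coefficients. For \<open>t = - s^2\<close>
  the left side becomes the derivative of a single product, which \<open>hfun_neg_le\<close>
  integrates.\<close>

lemma hfun_recurrence: "(2 * real k + 1) * hfun (Suc k) t + 2 * t * hfun (Suc (Suc k)) t = hfun k t / 2"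
proof -
  have 1: "(\<lambda>i. (2 * real k + 1) * (hcoeff (Suc k) i * t ^ i)) sums ((2 * real k + 1) * hfun (Suc k) t)"
    unfolding hfun_def by (intro sums_mult summable_sums summable_hcoeff)
  have "(\<lambda>i. 2 * t * (hcoeff (Suc (Suc k)) i * t ^ i)) sums (2 * t * hfun (Suc (Suc k)) t)"
    unfolding hfun_def by (intro sums_mult summable_sums summable_hcoeff)
  moreover have "2 * t * (hcoeff (Suc (Suc k)) i * t ^ i) = 2 * real (Suc i) * hcoeff (Suc k) (Suc i) * t ^ Suc i" for i
    unfolding diffs_hcoeff[symmetric, of "Suc k"] diffs_def by (simp add: mult_ac del: of_nat_Suc)
  ultimately have "(\<lambda>i. 2 * real (Suc i) * hcoeff (Suc k) (Suc i) * t ^ Suc i) sums (2 * t * hfun (Suc (Suc k)) t)"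
    by simp
  then have "(\<lambda>i. 2 * real i * hcoeff (Suc k) i * t ^ i) sums (2 * t * hfun (Suc (Suc k)) t)"
    using sums_Suc[of "\<lambda>i. 2 * real i * hcoeff (Suc k) i * t ^ i"] by simp
  note sums_add[OF 1 this]
  moreover have "(2 * real k + 1) * (hcoeff (Suc k) i * t ^ i) + 2 * real i * hcoeff (Suc k) i * t ^ i =
      (2 * real k + 1 + 2 * real i) * hcoeff (Suc k) i * t ^ i" for i
    by (simp only: distrib_right mult.assoc)
  moreover have "(2 * real k + 1 + 2 * real i) * hcoeff (Suc k) i = hcoeff k i / 2" for i
  proof -
    have f: "fact (2 * (i + Suc k)) = 2 * (real (i + k) + 1) * (2 * real k + 1 + 2 * real i) * fact (2 * (i + k))"
    proof -
      have "2 * (i + Suc k) = Suc (Suc (2 * (i + k)))" by simp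
      then have "fact (2 * (i + Suc k)) = (real (Suc (Suc (2 * (i + k)))) * real (Suc (2 * (i + k)))) * fact (2 * (i + k))"
        by (simp only: fact_Suc mult.assoc of_nat_fact)
      also have "real (Suc (Suc (2 * (i + k)))) = 2 * (real (i + k) + 1)" by simp
      also have "real (Suc (2 * (i + k))) = 2 * real k + 1 + 2 * real i" by simp
      finally show ?thesis .
    qed
    have g: "fact (i + Suc k) = (real (i + k) + 1) * fact (i + k)" by simp
    have "2 * real k + 1 + 2 * real i \<noteq> 0" "real (i + k) + 1 \<noteq> 0" by linarith+
    moreover have "b * (a * G / (F * (2 * a * b * H))) = G / (F * H) / 2"
      if "a \<noteq> 0" "b \<noteq> 0" "F \<noteq> 0" "H \<noteq> 0" for a b F G H :: real
      using that by (simp add: divide_simps)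
    ultimately show ?thesis unfolding hcoeff_def f g by (simp only: fact_nonzero not_False_eq_True)
  qed
  ultimately have "(\<lambda>i. hcoeff k i / 2 * t ^ i) sums
      ((2 * real k + 1) * hfun (Suc k) t + 2 * t * hfun (Suc (Suc k)) t)"
    by (simp only:)
  moreover have "(\<lambda>i. hcoeff k i / 2 * t ^ i) sums (hfun k t / 2)"
    using sums_divide[OF summable_sums[OF summable_hcoeff[of k t]], of 2]
    unfolding hfun_def by simp
  ultimately show ?thesis by (rule sums_unique2)
qed

lemma hfun_0_neg: "hfun 0 (- (s\<^sup>2)) = cos s"
proof -
  have "(\<lambda>n. (- 1) ^ n / fact (2 * n) * s ^ (2 * n)) sums cos s" by (rule cos_paired)
  moreover have "(- 1) ^ n / fact (2 * n) * s ^ (2 * n) = hcoeff 0 n * (- (s\<^sup>2)) ^ n" for n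
    by (simp add: hcoeff_def power_mult power_mult_distrib[of "-1" "s\<^sup>2" n, simplified])
  ultimately show ?thesis unfolding hfun_def by (simp add: sums_iff)
qed

text \<open>By the recurrence, \<open>s ^ (2 k + 1) * hfun (Suc k) (- s^2)\<close> has derivative
  \<open>s ^ (2 k) * hfun k (- s^2) / 2\<close>. Integrating from \<open>0\<close> turns the bound
  \<open>1 / k!\<close> into \<open>1 / (2 (2 k + 1) k!)\<close>, which is at most
  \<open>1 / (k + 1)!\<close>. The integration is expressed as monotonicity of \<open>Q + G\<close>
  and \<open>Q - G\<close>.\<close>

lemma hfun_neg_le: "0 \<le> s \<Longrightarrow> \<bar>hfun k (- (s\<^sup>2))\<bar> \<le> 1 / fact k"
proof (induction k arbitrary: s)
  case 0
  then show ?case by (simp add: hfun_0_neg)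
next
  case (Suc k)
  define G where "G = (\<lambda>s. s ^ Suc (2 * k) * hfun (Suc k) (- (s\<^sup>2)))"
  define Q where "Q = (\<lambda>s. s ^ Suc (2 * k) / (2 * (2 * real k + 1) * fact k))"
  have dG: "(G has_real_derivative s ^ (2 * k) * (hfun k (- (s\<^sup>2)) / 2)) (at s)" for s
  proof -
    have "(G has_real_derivative
        s ^ (2 * k) * ((2 * real k + 1) * hfun (Suc k) (- (s\<^sup>2)) + 2 * - (s\<^sup>2) * hfun (Suc (Suc k)) (- (s\<^sup>2)))) (at s)"
      unfolding G_def
      by (rule derivative_eq_intros DERIV_chain2[OF hfun_deriv] refl)+
        (simp add: algebra_simps power2_eq_square)
    then show ?thesis unfolding hfun_recurrence .
  qed
  have dQ: "(Q has_real_derivative s ^ (2 * k) / (2 * fact k)) (at s)" for s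
  proof -
    have "2 * real k + 1 \<noteq> 0" by linarith
    then show ?thesis unfolding Q_def
      by (auto intro!: derivative_eq_intros simp: divide_simps) (cases k; simp add: algebra_simps)
  qed
  have key: "0 \<le> Q s + c * G s" if c: "\<bar>c\<bar> = 1" for c
  proof -
    have "Q 0 + c * G 0 \<le> Q s + c * G s"
    proof (rule DERIV_nonneg_imp_nondecreasing[OF Suc.prems])
      fix x :: real assume x: "0 \<le> x"
      let ?D = "x ^ (2 * k) / (2 * fact k) + c * (x ^ (2 * k) * (hfun k (- (x\<^sup>2)) / 2))"
      have "\<bar>c * hfun k (- (x\<^sup>2))\<bar> \<le> 1 / fact k"
        using Suc.IH[OF x] c by (simp add: abs_mult)
      then have "- (c * hfun k (- (x\<^sup>2))) \<le> 1 / fact k" by linarith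
      then have "0 \<le> x ^ (2 * k) / 2 * (1 / fact k + c * hfun k (- (x\<^sup>2)))"
        using x by (intro mult_nonneg_nonneg) auto
      also have "\<dots> = ?D" by (simp add: algebra_simps)
      finally have "0 \<le> ?D" .
      moreover have "((\<lambda>s. Q s + c * G s) has_real_derivative ?D) (at x)"
        by (intro DERIV_add DERIV_cmult dG dQ)
      ultimately show "\<exists>y. ((\<lambda>s. Q s + c * G s) has_real_derivative y) (at x) \<and> 0 \<le> y" by blast
    qed
    then show ?thesis by (simp add: Q_def G_def)
  qed
  have "\<bar>G s\<bar> \<le> Q s" using key[of 1] key[of "-1"] by simp
  show ?case
  proof (cases "s = 0")
    case True
    have "hfun (Suc k) 0 = hcoeff (Suc k) 0" unfolding hfun_def by (simp add: powser_zero)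
    then show ?thesis using True hcoeff_le[of "Suc k" 0] hcoeff_nonneg[of "Suc k" 0] by simp
  next
    case False
    then have s: "0 < s" using Suc.prems by simp
    have "s ^ Suc (2 * k) * \<bar>hfun (Suc k) (- (s\<^sup>2))\<bar> \<le> s ^ Suc (2 * k) * (1 / (2 * (2 * real k + 1) * fact k))"
      using \<open>\<bar>G s\<bar> \<le> Q s\<close> s unfolding G_def Q_def by (simp add: abs_mult)
    then have "\<bar>hfun (Suc k) (- (s\<^sup>2))\<bar> \<le> 1 / (2 * (2 * real k + 1) * fact k)"
      using s by (subst (asm) mult_le_cancel_left_pos) auto
    also have "\<dots> \<le> 1 / fact (Suc k)"
      by (intro divide_left_mono) (auto intro!: mult_right_mono)
    finally show ?thesis .
  qed
qed

lemma exp_half_le: "0 \<le> t \<Longrightarrow> exp (t / 2) \<le> (2::real) powr t"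
proof -
  assume t: "0 \<le> t"
  have "1 / 2 \<le> ln (2::real)" using ln2_ge_two_thirds by linarith
  then have "t * (1 / 2) \<le> t * ln 2" using t by (intro mult_left_mono)
  then show ?thesis by (simp add: powr_def mult.commute)
qed

lemma hfun_bound: "\<bar>hfun k t\<bar> \<le> max 1 (2 powr t) / fact k"
proof (cases "0 \<le> t")
  case True
  have "\<bar>hfun k t\<bar> \<le> exp (t / 2) / fact k" by (rule hfun_le_exp[OF True])
  also have "\<dots> \<le> max 1 (2 powr t) / fact k"
    using exp_half_le[OF True] by (intro divide_right_mono) auto
  finally show ?thesis .
next
  case False
  have "\<bar>hfun k (- ((sqrt (- t))\<^sup>2))\<bar> \<le> 1 / fact k" using False by (intro hfun_neg_le) simp
  then have "\<bar>hfun k t\<bar> \<le> 1 / fact k" using False by simp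
  also have "\<dots> \<le> max 1 (2 powr t) / fact k" by (intro divide_right_mono) auto
  finally show ?thesis .
qed

section \<open>Finite differences at the integers\<close>

primrec fdiff :: "nat \<Rightarrow> (real \<Rightarrow> real) \<Rightarrow> real \<Rightarrow> real"
  where "fdiff 0 f x = f x"
  | "fdiff (Suc k) f x = fdiff k f (x + 1) - fdiff k f x"

lemma fdiff_diff: "fdiff k (\<lambda>x. f (x + 1) - f x) x = fdiff (Suc k) f x"
  by (induction k arbitrary: x) auto

text \<open>Differences are traded for derivatives one at a time: the first differences of the
  family \<open>h\<close> again form a chain of derivatives, and the mean value theorem bounds their
  \<open>k\<close>-th member by \<open>h (Suc k)\<close> on an interval longer by one.\<close>

lemma fdiff_bound:
  assumes "\<And>i x. (h i has_real_derivative h (Suc i) x) (at x)"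
    and "\<And>x. a \<le> x \<Longrightarrow> x \<le> a + real k \<Longrightarrow> \<bar>h k x\<bar> \<le> B"
  shows "\<bar>fdiff k (h 0) a\<bar> \<le> B"
  using assms
proof (induction k arbitrary: h)
  case 0
  then show ?case by simp
next
  case (Suc k)
  define g where "g = (\<lambda>i x. h i (x + 1) - h i x)"
  have "\<bar>fdiff k (g 0) a\<bar> \<le> B"
  proof (rule Suc.IH)
    show "(g i has_real_derivative g (Suc i) x) (at x)" for i x
      unfolding g_def using DERIV_shift[of "h i" "h (Suc i) (x + 1)" x 1] Suc.prems(1)
      by (intro DERIV_diff) auto
    fix x assume x: "a \<le> x" "x \<le> a + real k"
    obtain z where z: "x < z" "z < x + 1" "h k (x + 1) - h k x = (x + 1 - x) * h (Suc k) z"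
      using MVT2[of x "x + 1" "h k" "h (Suc k)"] Suc.prems(1) by auto
    have "\<bar>h (Suc k) z\<bar> \<le> B" using x z by (intro Suc.prems(2)) auto
    then show "\<bar>g k x\<bar> \<le> B" using z by (simp add: g_def)
  qed
  then show ?case unfolding g_def using fdiff_diff by simp
qed

text \<open>The value planned for the functional at \<open>(1 + V) ^ j * V ^ k\<close>, with
  \<open>j\<close> of either sign.\<close>

definition newton :: "nat \<Rightarrow> int \<Rightarrow> real"
  where "newton k j = fdiff k (hfun 0) (of_int j)"

lemma newton_step: "newton k (j + 1) = newton k j + newton (Suc k) j"
  by (simp add: newton_def)

text \<open>The difference at \<open>j\<close> involves the function up to \<open>j + k\<close>,
  where the bound may have grown by \<open>2 ^ k\<close>; the factorial from the derivatives absorbs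
  this.\<close>

lemma newton_bound: "\<bar>newton k j\<bar> \<le> 2 ^ k / fact k * max 1 (2 powr of_int j)"
  unfolding newton_def
proof (rule fdiff_bound[where h = hfun, OF hfun_deriv])
  fix x assume x: "of_int j \<le> x" "x \<le> of_int j + real k"
  have "(2::real) powr x \<le> 2 powr (of_int j + real k)" using x by simp
  also have "\<dots> = 2 ^ k * 2 powr of_int j" by (simp add: powr_add powr_realpow)
  also have "\<dots> \<le> 2 ^ k * max 1 (2 powr of_int j)" by simp
  finally have "max 1 (2 powr x) \<le> 2 ^ k * max 1 (2 powr of_int j)"
    using mult_mono[of 1 "2 ^ k" 1 "max 1 (2 powr real_of_int j)"] by simp
  then have "max 1 (2 powr x) / fact k \<le> 2 ^ k * max 1 (2 powr of_int j) / fact k"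
    by (intro divide_right_mono) auto
  with hfun_bound[of k x] show "\<bar>hfun k x\<bar> \<le> 2 ^ k / fact k * max 1 (2 powr of_int j)"
    by simp
qed

text \<open>Keeps the quotient from collapsing: this number is the value of the functional at
  \<open>vee\<close> and at \<open>vee * mu 0 0 0 0\<close>.\<close>

lemma newton_1_0: "newton 1 0 > 0"
proof -
  have "hfun 0 0 < hfun 0 1"
  proof -
    have s: "summable (\<lambda>i. hcoeff 0 i)" using summable_hcoeff[of 0 1] by simp
    have "hfun 0 0 = hcoeff 0 0" unfolding hfun_def by (simp add: powser_zero)
    also have "\<dots> < hcoeff 0 0 + hcoeff 0 1" by (simp add: hcoeff_def)
    also have "\<dots> \<le> (\<Sum>i. hcoeff 0 i)"
      using sum_le_suminf[OF s, of "{0,1}"] hcoeff_nonneg by simp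
    finally show ?thesis by (simp add: hfun_def)
  qed
  then show ?thesis by (simp add: newton_def)
qed

section \<open>Signed partial permutations of dyadic intervals\<close>

definition cell :: "nat \<Rightarrow> nat \<Rightarrow> real set"
  where "cell r i = {real i / 2 ^ r ..< (real i + 1) / 2 ^ r}"

definition cellavg :: "nat \<Rightarrow> nat \<Rightarrow> (real \<Rightarrow> complex) \<Rightarrow> complex"
  where "cellavg r i f = 2 ^ r * (LINT t:cell r i|lborel. f t)"

definition cellfun :: "nat \<Rightarrow> nat \<Rightarrow> real \<Rightarrow> complex"
  where "cellfun r i = indicator (cell r i)"

lemma cell_measurable [measurable]: "cell r i \<in> sets borel"
  by (simp add: cell_def)

lemma emeasure_cell: "emeasure lborel (cell r i) = ennreal (1 / 2 ^ r)"
proof -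
  have "(real i + 1) / 2 ^ r - real i / 2 ^ r = 1 / 2 ^ r" by (simp add: diff_divide_distrib[symmetric])
  then show ?thesis by (simp add: cell_def divide_right_mono)
qed

lemma measure_cell: "measure lborel (cell r i) = 1 / 2 ^ r"
  by (simp add: measure_def emeasure_cell)

lemma mem_cell_iff: "t \<in> cell r i \<longleftrightarrow> \<lfloor>t * 2 ^ r\<rfloor> = int i"
  by (auto simp: cell_def floor_eq_iff field_simps)

lemma disjoint_cells: "i \<noteq> k \<Longrightarrow> cell r i \<inter> cell r k = {}"
  by (auto simp: mem_cell_iff)

lemma cellfun_eq: "cellfun r i t = indicator (cell r i) t *\<^sub>R 1"
  by (simp add: cellfun_def indicator_def)

lemma integrable_cellfun [simp]: "integrable lborel (cellfun r i)"
proof -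
  have "integrable lborel (\<lambda>t. indicat_real (cell r i) t *\<^sub>R (1 :: complex))"
    by (rule integrable_scaleR_left) (auto simp: emeasure_cell)
  then show ?thesis by (simp add: cellfun_eq[abs_def, symmetric] flip: cellfun_eq)
qed

lemma sum_indicator_cells_le:
  assumes "finite K"
  shows "(\<Sum>k\<in>K. indicat_real (cell r k) t) \<le> 1"
proof -
  have "card (K \<inter> {k. t \<in> cell r k}) \<le> Suc 0"
    using assms by (subst card_le_Suc0_iff_eq) (auto simp: mem_cell_iff)
  then show ?thesis using assms by (simp add: indicator_def of_bool_def sum.If_cases)
qed

lemma set_integrable_cell: "integrable lborel f \<Longrightarrow> set_integrable lborel (cell r i) f"
  for f :: "real \<Rightarrow> complex"
  unfolding set_integrable_def by (rule integrable_mult_indicator) auto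

lemma cell_split: "cell r i = cell (Suc r) (2 * i) \<union> cell (Suc r) (2 * i + 1)"
  "cell (Suc r) (2 * i) \<inter> cell (Suc r) (2 * i + 1) = {}"
  by (auto simp: cell_def field_simps)

lemma cellfun_split: "cellfun r i t = cellfun (Suc r) (2 * i) t + cellfun (Suc r) (2 * i + 1) t"
  unfolding cellfun_def by (subst cell_split) (use cell_split(2)[of r i] in \<open>auto simp: indicator_def\<close>)

lemma cellavg_split:
  assumes "integrable lborel f"
  shows "cellavg r i f = (cellavg (Suc r) (2 * i) f + cellavg (Suc r) (2 * i + 1) f) / 2"
  unfolding cellavg_def cell_split(1)[of r i]
  by (subst set_integral_Un) (use assms cell_split(2)[of r i] set_integrable_cell in \<open>auto simp: algebra_simps\<close>)

lemma cellavg_add: "integrable lborel f \<Longrightarrow> integrable lborel g \<Longrightarrow>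
    cellavg r i (\<lambda>t. f t + g t) = cellavg r i f + cellavg r i g"
  by (simp add: cellavg_def set_integrable_cell algebra_simps)

lemma cellavg_mult: "cellavg r i (\<lambda>t. c * f t) = c * cellavg r i f"
  by (simp add: cellavg_def)

lemma cellavg_cellfun: "cellavg r i (cellfun r k) = (if i = k then 1 else 0)"
proof -
  have "(LINT t:cell r i|lborel. cellfun r k t) = (LINT t|lborel. indicat_real (cell r i \<inter> cell r k) t *\<^sub>R 1)"
    unfolding set_lebesgue_integral_def cellfun_def by (rule Bochner_Integration.integral_cong) (auto simp: indicator_def)
  also have "\<dots> = of_real (measure lborel (cell r i \<inter> cell r k))"
    by (subst integral_scaleR_left)
      (use disjoint_cells[of i k r] in \<open>cases "i = k"; auto simp: emeasure_cell scaleR_conv_of_real\<close>)+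
  finally show ?thesis
    using disjoint_cells[of i k r] by (auto simp: cellavg_def measure_cell)
qed

lemma norm_cellavg_le:
  assumes "integrable lborel f"
  shows "cmod (cellavg r i f) \<le> 2 ^ r * (LINT t:cell r i|lborel. cmod (f t))"
  unfolding cellavg_def norm_mult
  by (simp add: norm_power set_integrable_cell[OF assms] set_integral_norm_bound)

lemma sum_cell_integral_le:
  assumes f: "integrable lborel f" and K: "finite K"
  shows "(\<Sum>k\<in>K. LINT t:cell r k|lborel. cmod (f t)) \<le> (LINT t|lborel. cmod (f t))"
proof -
  have "(\<Sum>k\<in>K. LINT t:cell r k|lborel. cmod (f t)) = (LINT t|lborel. (\<Sum>k\<in>K. indicator (cell r k) t * cmod (f t)))"
    unfolding set_lebesgue_integral_def
    by (subst Bochner_Integration.integral_sum)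
      (auto intro!: integrable_real_mult_indicator f integrable_norm simp: mult.commute)
  also have "\<dots> \<le> (LINT t|lborel. cmod (f t))"
  proof (rule integral_mono)
    show "integrable lborel (\<lambda>t. \<Sum>k\<in>K. indicator (cell r k) t * cmod (f t))"
      by (auto intro!: integrable_real_mult_indicator f integrable_norm simp: mult.commute)
    fix t
    note sum_indicator_cells_le[OF K, of r t]
    then show "(\<Sum>k\<in>K. indicator (cell r k) t * cmod (f t)) \<le> cmod (f t)"
      unfolding sum_distrib_right[symmetric] by (simp add: mult_left_le_one_le sum_nonneg)
  qed (use f in auto)
  finally show ?thesis .
qed

lemma norm_cellavg_le_bound:
  assumes "integrable lborel f" "\<And>t. cmod (f t) \<le> B"
  shows "cmod (cellavg r i f) \<le> B"
proof -
  have "(LINT t:cell r i|lborel. cmod (f t)) \<le> (LINT t:cell r i|lborel. B)"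
    unfolding set_lebesgue_integral_def
  proof (rule integral_mono)
    show "integrable lborel (\<lambda>t. indicat_real (cell r i) t *\<^sub>R cmod (f t))"
      by (rule integrable_mult_indicator) (use assms(1) in \<open>auto intro: integrable_norm\<close>)
  qed (use assms in \<open>auto intro!: mult_left_mono simp: emeasure_cell\<close>)
  also have "\<dots> = B / 2 ^ r" by (simp add: set_lebesgue_integral_def measure_cell)
  finally show ?thesis
    using norm_cellavg_le[OF assms(1), of r i] by (simp add: field_simps)
qed

section \<open>Words in the generators and the functional on them\<close>

datatype letter = Psi | Vee | Gen nat nat "(nat \<times> bool \<times> nat) list"

text \<open>Countability of the words allows elements of the quotient to be coded as functions on
  the reals, see \<open>enc\<close>.\<close>

instance letter :: countable
  by countable_datatype

definition sgn_of :: "bool \<Rightarrow> complex" where "sgn_of b = (if b then 1 else - 1)"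

text \<open>An entry \<open>(i, b, k)\<close> sends cell \<open>k\<close> of level \<open>r'\<close>
  to cell \<open>i\<close> of level \<open>r\<close> with sign \<open>b\<close>.\<close>

definition genop :: "nat \<Rightarrow> nat \<Rightarrow> (nat \<times> bool \<times> nat) list \<Rightarrow> (real \<Rightarrow> complex) \<Rightarrow> real \<Rightarrow> complex"
  where "genop r r' l f t = (\<Sum>(i, b, k)\<leftarrow>l. sgn_of b * cellavg r' k f * cellfun r i t)"

definition partial_inj :: "(nat \<times> bool \<times> nat) list \<Rightarrow> bool"
  where "partial_inj l \<longleftrightarrow> distinct (map fst l) \<and> distinct (map (snd \<circ> snd) l)"

text \<open>\<open>Psi\<close> and \<open>Vee\<close> stand for \<open>(1 + V) ^ (-1)\<close> and
  \<open>V\<close>. They fix all functions, because central elements are recorded by the degree and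
  the order of the difference alone. Lists that repeat a cell act as \<open>0\<close>, so that every
  letter is contractive.\<close>

fun lop :: "letter \<Rightarrow> (real \<Rightarrow> complex) \<Rightarrow> real \<Rightarrow> complex"
  where "lop (Gen r r' l) f = (if partial_inj l then genop r r' l f else (\<lambda>_. 0))"
  | "lop _ f = f"

text \<open>A letter \<open>a\<close> contracts \<open>L\<^sup>\<infinity>\<close> and has norm at most \<open>2 powr - ldeg a\<close> on \<open>L\<^sup>1\<close>.\<close>

fun ldeg :: "letter \<Rightarrow> int"
  where "ldeg Psi = - 1" | "ldeg Vee = 0" | "ldeg (Gen r r' l) = int r - int r'"

abbreviation wop :: "letter list \<Rightarrow> (real \<Rightarrow> complex) \<Rightarrow> real \<Rightarrow> complex"
  where "wop \<equiv> foldr lop"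

definition wdeg :: "letter list \<Rightarrow> int" where "wdeg w = sum_list (map ldeg w)"

definition nvee :: "letter list \<Rightarrow> nat" where "nvee w = length (filter ((=) Vee) w)"

text \<open>A vector state at the indicator of the unit interval for the action on functions, times
  the sequence for the central part.\<close>

definition state :: "letter list \<Rightarrow> complex"
  where "state w = cellavg 0 0 (wop w (cellfun 0 0)) * of_real (newton (nvee w) (wdeg w))"

text \<open>The factorial makes \<^const>\<open>Vee\<close> quasinilpotent; the bound on \<^const>\<open>newton\<close> allows it.\<close>

definition weight :: "letter list \<Rightarrow> real"
  where "weight w = 2 ^ nvee w / fact (nvee w)"

text \<open>Both norms are tracked because \<open>state_le\<close> uses the first for negative and
  the second for positive degree.\<close>

definition admissible :: "int \<Rightarrow> (real \<Rightarrow> complex) \<Rightarrow> bool"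
  where "admissible j f \<longleftrightarrow> integrable lborel f \<and> (\<forall>t. cmod (f t) \<le> 1) \<and>
    (LINT t|lborel. cmod (f t)) \<le> 2 powr (- of_int j)"

lemma genop_bound:
  assumes l: "partial_inj l" and f: "\<And>k. cmod (cellavg r' k f) \<le> 1"
  shows "cmod (genop r r' l f t) \<le> 1"
proof -
  have "cmod (genop r r' l f t) \<le> (\<Sum>x\<leftarrow>l. indicator (cell r (fst x)) t)"
    unfolding genop_def
  proof (induction l)
    case (Cons x l)
    obtain i b k where x: "x = (i, b, k)" by (cases x)
    have "cmod (sgn_of b * cellavg r' k f * cellfun r i t) \<le> indicator (cell r i) t"
      using f[of k] by (auto simp: norm_mult sgn_of_def cellfun_def indicator_def)
    moreover have "cmod (\<Sum>(i, b, k)\<leftarrow>x # l. sgn_of b * cellavg r' k f * cellfun r i t) \<le>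
        cmod (sgn_of b * cellavg r' k f * cellfun r i t) + cmod (\<Sum>(i, b, k)\<leftarrow>l. sgn_of b * cellavg r' k f * cellfun r i t)"
      by (simp add: x norm_triangle_ineq)
    ultimately show ?case using Cons by (simp add: x)
  qed simp
  also have "\<dots> = (\<Sum>i\<in>set (map fst l). indicator (cell r i) t)"
    using l by (simp add: partial_inj_def sum_list_distinct_conv_sum_set[symmetric] comp_def del: set_map)
  also have "\<dots> \<le> 1" by (rule sum_indicator_cells_le) simp
  finally show ?thesis .
qed

lemma integrable_genop: "integrable lborel (genop r r' l f)"
  unfolding genop_def[abs_def]
proof (induction l)
  case (Cons x l)
  then show ?case by (cases x) auto
qed simp

lemma integrable_lop: "integrable lborel f \<Longrightarrow> integrable lborel (lop a f)"
  by (cases a) (auto simp: integrable_genop)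

lemma integrable_wop: "integrable lborel f \<Longrightarrow> integrable lborel (wop w f)"
  by (induction w) (auto simp: integrable_lop)

text \<open>The means over the source cells are at most \<open>2 ^ r'\<close> times integrals over
  disjoint sets, and each target cell has length \<open>1 / 2 ^ r\<close>.\<close>

lemma genop_integral:
  assumes l: "partial_inj l" and f: "integrable lborel f"
  shows "(LINT t|lborel. cmod (genop r r' l f t)) \<le> 2 ^ r' / 2 ^ r * (LINT t|lborel. cmod (f t))"
proof -
  have "(LINT t|lborel. cmod (genop r r' l f t)) \<le> (\<Sum>x\<leftarrow>l. cmod (cellavg r' (snd (snd x)) f) / 2 ^ r)"
  proof (induction l)
    case (Cons x l)
    obtain i b k where x: "x = (i, b, k)" by (cases x)
    define h where "h = (\<lambda>t. sgn_of b * cellavg r' k f * cellfun r i t)"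
    have h: "integrable lborel h" unfolding h_def by auto
    have "(LINT t|lborel. cmod (h t)) = (LINT t|lborel. cmod (cellavg r' k f) * indicator (cell r i) t)"
      unfolding h_def by (rule Bochner_Integration.integral_cong)
        (auto simp: norm_mult sgn_of_def cellfun_def indicator_def)
    also have "\<dots> = cmod (cellavg r' k f) / 2 ^ r" by (simp add: measure_cell)
    finally have "(LINT t|lborel. cmod (h t)) = cmod (cellavg r' k f) / 2 ^ r" .
    moreover have "(LINT t|lborel. cmod (genop r r' (x # l) f t)) \<le> (LINT t|lborel. cmod (h t) + cmod (genop r r' l f t))"
    proof (rule integral_mono)
      show "cmod (genop r r' (x # l) f t) \<le> cmod (h t) + cmod (genop r r' l f t)" for t
        by (simp add: x genop_def h_def norm_triangle_ineq)
    qed (auto intro!: integrable_norm integrable_genop h Bochner_Integration.integrable_add)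
    ultimately show ?case
      using Cons h integrable_genop by (simp add: x)
  qed (simp add: genop_def)
  also have "\<dots> = (\<Sum>k\<leftarrow>map (snd \<circ> snd) l. cmod (cellavg r' k f)) / 2 ^ r"
    by (induction l) (auto simp: add_divide_distrib)
  also have "\<dots> = (\<Sum>k\<in>set (map (snd \<circ> snd) l). cmod (cellavg r' k f)) / 2 ^ r"
    by (subst sum_list_distinct_conv_sum_set) (use l in \<open>auto simp: partial_inj_def\<close>)
  also have "\<dots> \<le> (\<Sum>k\<in>set (map (snd \<circ> snd) l). 2 ^ r' * (LINT t:cell r' k|lborel. cmod (f t))) / 2 ^ r"
    by (intro divide_right_mono sum_mono norm_cellavg_le f) auto
  also have "\<dots> \<le> 2 ^ r' * (LINT t|lborel. cmod (f t)) / 2 ^ r"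
    unfolding sum_distrib_left[symmetric]
    by (intro divide_right_mono mult_left_mono sum_cell_integral_le f) auto
  finally show ?thesis by simp
qed

lemma admissible_lop:
  assumes "admissible j f"
  shows "admissible (ldeg a + j) (lop a f)"
proof (cases a)
  case Psi
  have "(2::real) powr (- of_int j) \<le> 2 powr (1 - of_int j)" by simp
  with assms Psi show ?thesis by (auto simp: admissible_def simp del: powr_le_cancel_iff intro: order_trans)
next
  case Vee
  then show ?thesis using assms by simp
next
  case (Gen r r' l)
  show ?thesis
  proof (cases "partial_inj l")
    case True
    have f: "integrable lborel f" "\<And>t. cmod (f t) \<le> 1" "(LINT t|lborel. cmod (f t)) \<le> 2 powr (- of_int j)"
      using assms by (auto simp: admissible_def)
    have "(LINT t|lborel. cmod (genop r r' l f t)) \<le> 2 ^ r' / 2 ^ r * 2 powr (- of_int j)"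
      using genop_integral[OF True f(1), of r r'] f(3)
      by (meson divide_nonneg_nonneg mult_left_mono order_trans zero_le_numeral zero_le_power)
    also have "\<dots> = 2 powr (- of_int (int r - int r' + j))"
      by (simp add: powr_diff powr_add powr_realpow powr_minus field_simps)
    finally show ?thesis
      using True Gen integrable_genop genop_bound[OF True norm_cellavg_le_bound[OF f(1,2)]]
      by (auto simp: admissible_def)
  qed (simp add: Gen admissible_def)
qed

lemma admissible_wop: "admissible (wdeg w) (wop w (cellfun 0 0))"
proof (induction w)
  case Nil
  have "(LINT t|lborel. cmod (cellfun 0 0 t)) = (LINT t|lborel. indicator (cell 0 0) t)"
    by (rule Bochner_Integration.integral_cong) (auto simp: cellfun_def indicator_def)
  then show ?case by (auto simp: admissible_def wdeg_def measure_cell) (simp add: cellfun_def indicator_def)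
qed (use admissible_lop in \<open>simp add: wdeg_def\<close>)

lemma weight_pos: "0 < weight w"
  by (simp add: weight_def)

lemma weight_Nil: "weight [] = 1"
  by (simp add: weight_def nvee_def)

lemma nvee_append: "nvee (u @ v) = nvee u + nvee v"
  by (simp add: nvee_def)

lemma wdeg_append: "wdeg (u @ v) = wdeg u + wdeg v"
  by (simp add: wdeg_def)

text \<open>Binomial coefficients are at least \<open>1\<close>. Submultiplicativity makes the
  weighted summable functions a convolution algebra.\<close>

lemma weight_append_le: "weight (u @ v) \<le> weight u * weight v"
proof -
  have "fact (nvee u) * fact (nvee v) \<le> (fact (nvee u + nvee v) :: real)"
    using fact_fact_dvd_fact[of "nvee u" "nvee v", THEN dvd_imp_le]
    by (metis fact_nonzero gr0I of_nat_fact of_nat_le_iff of_nat_mult)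
  then show ?thesis
    by (simp add: weight_def nvee_append power_add divide_simps mult_left_mono)
qed

text \<open>A mean over the unit interval is at most the supremum and at most the integral of the
  modulus, hence at most \<open>min 1 (2 powr -j)\<close>. This cancels exactly the factor
  \<open>max 1 (2 powr j)\<close> from \<open>newton_bound\<close>.\<close>

lemma state_le: "cmod (state w) \<le> weight w"
proof -
  define f where "f = wop w (cellfun 0 0)"
  define j where "j = wdeg w"
  have f: "integrable lborel f" "\<And>t. cmod (f t) \<le> 1" "(LINT t|lborel. cmod (f t)) \<le> 2 powr (- of_int j)"
    using admissible_wop[of w] by (auto simp: admissible_def f_def j_def)
  have 1: "cmod (cellavg 0 0 f) \<le> 1" by (rule norm_cellavg_le_bound[OF f(1,2)])
  have "cmod (cellavg 0 0 f) \<le> (LINT t:cell 0 0|lborel. cmod (f t))"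
    using norm_cellavg_le[OF f(1), of 0 0] by simp
  also have "\<dots> \<le> (LINT t|lborel. cmod (f t))"
    using sum_cell_integral_le[OF f(1), of "{0}" 0] by simp
  finally have 2: "cmod (cellavg 0 0 f) \<le> 2 powr (- of_int j)" using f(3) by simp
  have "cmod (cellavg 0 0 f) * max 1 (2 powr of_int j) \<le> 1"
  proof (cases "(2::real) powr of_int j \<le> 1")
    case True
    then show ?thesis using 1 by (simp add: max_def)
  next
    case False
    have "cmod (cellavg 0 0 f) * 2 powr of_int j \<le> 2 powr (- of_int j) * 2 powr of_int j"
      using 2 by (intro mult_right_mono) auto
    also have "\<dots> = 1" by (simp flip: powr_add)
    finally show ?thesis using False by (simp add: max_def)
  qed
  then have "weight w * (cmod (cellavg 0 0 f) * max 1 (2 powr of_int j)) \<le> weight w"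
    using weight_pos[of w] by simp
  moreover have "cmod (state w) \<le> cmod (cellavg 0 0 f) * (2 ^ nvee w / fact (nvee w) * max 1 (2 powr of_int j))"
    unfolding state_def f_def[symmetric] j_def[symmetric] norm_mult
    using newton_bound[of "nvee w" j] by (intro mult_left_mono) auto
  ultimately show ?thesis by (simp add: weight_def mult_ac)
qed

lemma lop_add: "integrable lborel f \<Longrightarrow> integrable lborel g \<Longrightarrow>
    lop a (\<lambda>t. f t + g t) = (\<lambda>t. lop a f t + lop a g t)"
  by (cases a) (auto simp: genop_def cellavg_add fun_eq_iff case_prod_unfold algebra_simps
    sum_list_addf[symmetric])

lemma lop_mult: "lop a (\<lambda>t. c * f t) = (\<lambda>t. c * lop a f t)"
  by (cases a) (auto simp: genop_def cellavg_mult fun_eq_iff case_prod_unfold mult_ac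
    sum_list_const_mult[symmetric])

lemma wop_add: "integrable lborel f \<Longrightarrow> integrable lborel g \<Longrightarrow>
    wop w (\<lambda>t. f t + g t) = (\<lambda>t. wop w f t + wop w g t)"
  by (induction w) (auto simp: lop_add integrable_wop)

lemma wop_mult: "wop w (\<lambda>t. c * f t) = (\<lambda>t. c * wop w f t)"
  by (induction w) (auto simp: lop_mult)

section \<open>Absolutely summable functions on words\<close>

definition l1 :: "(letter list \<Rightarrow> complex) \<Rightarrow> bool"
  where "l1 a \<longleftrightarrow> (\<lambda>w. weight w * cmod (a w)) summable_on UNIV"

definition l1norm :: "(letter list \<Rightarrow> complex) \<Rightarrow> real"
  where "l1norm a = (\<Sum>\<^sub>\<infinity>w. weight w * cmod (a w))"

definition mcoeff :: "(letter list \<Rightarrow> complex) \<Rightarrow> letter list \<Rightarrow> letter list \<Rightarrow> complex"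
  where "mcoeff a p q = (\<Sum>\<^sub>\<infinity>w. a w * state (p @ w @ q))"

lemma weight_nonneg [simp]: "0 \<le> weight w"
  using weight_pos[of w] by simp

lemma l1norm_nonneg: "0 \<le> l1norm a"
  unfolding l1norm_def by (rule infsum_nonneg) simp

lemma state_le3: "cmod (state (p @ w @ q)) \<le> weight p * weight q * weight w"
proof -
  have "cmod (state (p @ w @ q)) \<le> weight (p @ w @ q)" by (rule state_le)
  also have "\<dots> \<le> weight p * weight (w @ q)" by (rule weight_append_le)
  also have "\<dots> \<le> weight p * (weight w * weight q)" by (intro mult_left_mono weight_append_le) simp
  finally show ?thesis by (simp add: mult_ac)
qed

lemma state_le4: "cmod (state (p @ x @ y @ q)) \<le> weight p * weight q * (weight x * weight y)"
proof -
  have "cmod (state (p @ (x @ y) @ q)) \<le> weight p * weight q * weight (x @ y)" by (rule state_le3)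
  also have "\<dots> \<le> weight p * weight q * (weight x * weight y)"
    by (intro mult_left_mono weight_append_le) auto
  finally show ?thesis by simp
qed

lemma l1_pair:
  assumes a: "l1 a" and g: "\<And>w. cmod (g w) \<le> C * weight w"
  shows "(\<lambda>w. cmod (a w * g w)) summable_on UNIV"
    and "(\<lambda>w. a w * g w) summable_on UNIV"
    and "cmod (\<Sum>\<^sub>\<infinity>w. a w * g w) \<le> C * l1norm a"
proof -
  have s: "(\<lambda>w. C * (weight w * cmod (a w))) summable_on UNIV"
    using a unfolding l1_def by (rule summable_on_cmult_right)
  have le: "cmod (a w * g w) \<le> C * (weight w * cmod (a w))" for w
    using mult_left_mono[OF g[of w], of "cmod (a w)"] by (simp add: norm_mult mult_ac)
  show 1: "(\<lambda>w. cmod (a w * g w)) summable_on UNIV"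
    by (rule summable_on_comparison_test[OF s le]) auto
  then show "(\<lambda>w. a w * g w) summable_on UNIV" by (rule abs_summable_summable)
  have "cmod (\<Sum>\<^sub>\<infinity>w. a w * g w) \<le> (\<Sum>\<^sub>\<infinity>w. cmod (a w * g w))" by (rule norm_infsum_bound[OF 1])
  also have "\<dots> \<le> (\<Sum>\<^sub>\<infinity>w. C * (weight w * cmod (a w)))" by (rule infsum_mono[OF 1 s le])
  also have "\<dots> = C * l1norm a" by (simp add: l1norm_def infsum_cmult_right')
  finally show "cmod (\<Sum>\<^sub>\<infinity>w. a w * g w) \<le> C * l1norm a" .
qed

lemma mcoeff_bound: "l1 a \<Longrightarrow> cmod (mcoeff a p q) \<le> weight p * weight q * l1norm a"
  unfolding mcoeff_def by (rule l1_pair(3)) (auto intro: state_le3)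

lemma l1_add:
  assumes "l1 a" "l1 b"
  shows "l1 (\<lambda>w. a w + b w)" "l1norm (\<lambda>w. a w + b w) \<le> l1norm a + l1norm b"
    "mcoeff (\<lambda>w. a w + b w) = (\<lambda>p q. mcoeff a p q + mcoeff b p q)"
proof -
  have s: "(\<lambda>w. weight w * cmod (a w) + weight w * cmod (b w)) summable_on UNIV"
    using assms unfolding l1_def by (rule summable_on_add)
  have le: "weight w * cmod (a w + b w) \<le> weight w * cmod (a w) + weight w * cmod (b w)" for w
    using mult_left_mono[OF norm_triangle_ineq[of "a w" "b w"], of "weight w"] by (simp add: distrib_left)
  show 1: "l1 (\<lambda>w. a w + b w)"
    unfolding l1_def by (rule summable_on_comparison_test[OF s le]) auto
  show "l1norm (\<lambda>w. a w + b w) \<le> l1norm a + l1norm b"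
    unfolding l1norm_def using infsum_mono[OF 1[unfolded l1_def] s le] assms
    by (simp add: infsum_add l1_def)
  show "mcoeff (\<lambda>w. a w + b w) = (\<lambda>p q. mcoeff a p q + mcoeff b p q)"
    unfolding mcoeff_def distrib_right
    by (intro ext infsum_add l1_pair(2)) (auto intro: state_le3 assms)
qed

lemma l1_mult:
  assumes "l1 a"
  shows "l1 (\<lambda>w. c * a w)" "l1norm (\<lambda>w. c * a w) = cmod c * l1norm a"
    "mcoeff (\<lambda>w. c * a w) = (\<lambda>p q. c * mcoeff a p q)"
proof -
  have eq: "weight w * cmod (c * a w) = cmod c * (weight w * cmod (a w))" for w
    by (simp add: norm_mult)
  show "l1 (\<lambda>w. c * a w)" using assms unfolding l1_def eq by (rule summable_on_cmult_right)
  show "l1norm (\<lambda>w. c * a w) = cmod c * l1norm a"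
    unfolding l1norm_def eq by (rule infsum_cmult_right')
  show "mcoeff (\<lambda>w. c * a w) = (\<lambda>p q. c * mcoeff a p q)"
    unfolding mcoeff_def by (simp add: mult.assoc infsum_cmult_right')
qed

lemma l1_zero: "l1 (\<lambda>_. 0)" "mcoeff (\<lambda>_. 0) = (\<lambda>_ _. 0)"
  by (simp_all add: l1_def mcoeff_def fun_eq_iff)

definition delta :: "letter list \<Rightarrow> letter list \<Rightarrow> complex"
  where "delta w = (\<lambda>v. if v = w then 1 else 0)"

lemma l1_delta: "l1 (delta w)" "l1norm (delta w) = weight w"
  "(\<Sum>\<^sub>\<infinity>v. delta w v * g v) = g w"
proof -
  have eq: "(\<lambda>v. weight v * cmod (delta w v)) = (\<lambda>v. if v = w then weight w else 0)"
    by (auto simp: delta_def)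
  have "((\<lambda>v. if v = w then weight w else 0) has_sum weight w) UNIV"
    by (rule has_sum_finite_neutralI[of "{w}"]) auto
  then show "l1 (delta w)" "l1norm (delta w) = weight w"
    unfolding l1_def l1norm_def eq by (auto simp: has_sum_imp_summable infsumI)
  have "((\<lambda>v. delta w v * g v) has_sum g w) UNIV"
    by (rule has_sum_finite_neutralI[of "{w}"]) (auto simp: delta_def)
  then show "(\<Sum>\<^sub>\<infinity>v. delta w v * g v) = g w" by (rule infsumI)
qed

text \<open>The absolute convergence behind the interchanges of double sums over pairs of
  words.\<close>

lemma l1_prod_summable:
  assumes a: "l1 a" and b: "l1 b" and g: "\<And>x y. cmod (g x y) \<le> C * (weight x * weight y)"
  shows "(\<lambda>(x, y). a x * b y * g x y) summable_on UNIV \<times> UNIV"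
    and "(\<lambda>(x, y). cmod (a x * b y * g x y)) summable_on UNIV \<times> UNIV"
    and "(\<Sum>\<^sub>\<infinity>(x, y)\<in>UNIV \<times> UNIV. cmod (a x * b y * g x y)) \<le> C * (l1norm a * l1norm b)"
proof -
  let ?h = "\<lambda>(x, y). (weight x * cmod (a x)) * (weight y * cmod (b y))"
  have h: "?h summable_on UNIV \<times> UNIV"
  proof (rule summable_on_SigmaI)
    show "((\<lambda>y. ?h (x, y)) has_sum (weight x * cmod (a x)) * l1norm b) UNIV" for x
      using has_sum_cmult_right[OF has_sum_infsum[OF b[unfolded l1_def]]] by (simp add: l1norm_def)
    show "(\<lambda>x. weight x * cmod (a x) * l1norm b) summable_on UNIV"
      using summable_on_cmult_left[OF a[unfolded l1_def]] .
  qed auto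
  have "(\<Sum>\<^sub>\<infinity>z\<in>UNIV \<times> UNIV. ?h z) = (\<Sum>\<^sub>\<infinity>x. \<Sum>\<^sub>\<infinity>y. ?h (x, y))"
    by (rule infsum_Sigma_banach[OF h, symmetric])
  also have "\<dots> = l1norm a * l1norm b"
    by (simp add: infsum_cmult_right' infsum_cmult_left' l1norm_def)
  finally have sum_h: "(\<Sum>\<^sub>\<infinity>z\<in>UNIV \<times> UNIV. ?h z) = l1norm a * l1norm b" .
  have s: "(\<lambda>z. C * ?h z) summable_on UNIV \<times> UNIV"
    using h by (rule summable_on_cmult_right)
  have le: "(case z of (x, y) \<Rightarrow> cmod (a x * b y * g x y)) \<le> C * ?h z" for z
    using mult_left_mono[OF g, of "cmod (a (fst z)) * cmod (b (snd z))" "fst z" "snd z"]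
    by (cases z) (simp add: norm_mult mult_ac)
  show 1: "(\<lambda>(x, y). cmod (a x * b y * g x y)) summable_on UNIV \<times> UNIV"
    by (rule summable_on_comparison_test[OF s le]) auto
  then have "(\<lambda>z. cmod (case z of (x, y) \<Rightarrow> a x * b y * g x y)) summable_on UNIV \<times> UNIV"
    by (simp add: case_prod_unfold)
  then show "(\<lambda>(x, y). a x * b y * g x y) summable_on UNIV \<times> UNIV"
    by (rule abs_summable_summable)
  have "(\<Sum>\<^sub>\<infinity>(x, y)\<in>UNIV \<times> UNIV. cmod (a x * b y * g x y)) \<le> (\<Sum>\<^sub>\<infinity>z\<in>UNIV \<times> UNIV. C * ?h z)"
    by (rule infsum_mono[OF 1 s le])
  then show "(\<Sum>\<^sub>\<infinity>(x, y)\<in>UNIV \<times> UNIV. cmod (a x * b y * g x y)) \<le> C * (l1norm a * l1norm b)"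
    by (simp only: infsum_cmult_right' sum_h)
qed

text \<open>Both sides are the double sum of \<open>a x * b y * state (p @ x @ y @ q)\<close>. This
  makes the product well defined on coordinates.\<close>

lemma mcoeff_swap:
  assumes "l1 a" "l1 b"
  shows "(\<Sum>\<^sub>\<infinity>x. a x * mcoeff b (p @ x) q) = (\<Sum>\<^sub>\<infinity>y. b y * mcoeff a p (y @ q))"
proof -
  have "(\<Sum>\<^sub>\<infinity>x. a x * mcoeff b (p @ x) q) = (\<Sum>\<^sub>\<infinity>x. \<Sum>\<^sub>\<infinity>y. a x * b y * state (p @ x @ y @ q))"
    unfolding mcoeff_def by (simp add: infsum_cmult_right'[symmetric] mult.assoc)
  also have "\<dots> = (\<Sum>\<^sub>\<infinity>y. \<Sum>\<^sub>\<infinity>x. a x * b y * state (p @ x @ y @ q))"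
    by (rule infsum_swap_banach[OF l1_prod_summable(1)[OF assms state_le4]])
  also have "\<dots> = (\<Sum>\<^sub>\<infinity>y. b y * mcoeff a p (y @ q))"
    unfolding mcoeff_def by (simp add: infsum_cmult_right'[symmetric] mult.assoc mult.left_commute)
  finally show ?thesis .
qed

lemma l1_conv:
  assumes a: "l1 a" and b: "l1 b"
  shows "\<exists>c. l1 c \<and> l1norm c \<le> l1norm a * l1norm b \<and>
    mcoeff c = (\<lambda>p q. \<Sum>\<^sub>\<infinity>x. a x * mcoeff b (p @ x) q)"
proof -
  define D where "D = (\<lambda>w. {z :: letter list \<times> letter list. fst z @ snd z = w})"
  define c where "c = (\<lambda>w. \<Sum>\<^sub>\<infinity>z\<in>D w. a (fst z) * b (snd z))"
  \<comment> \<open>A pair of words is a word together with one of its finitely many splittings, so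
    a sum over pairs is a sum over words of finite sums.\<close>
  have bij: "bij_betw (\<lambda>z. (fst z @ snd z, z)) UNIV (Sigma UNIV D)"
    by (rule bij_betw_byWitness[of _ snd]) (auto simp: D_def)
  have fin: "finite (D w)" for w
  proof -
    have "D w \<subseteq> (\<lambda>i. (take i w, drop i w)) ` {..length w}"
    proof
      fix z assume "z \<in> D w"
      then have "z = (take (length (fst z)) w, drop (length (fst z)) w)" "length (fst z) \<le> length w"
        by (auto simp: D_def)
      then show "z \<in> (\<lambda>i. (take i w, drop i w)) ` {..length w}" by blast
    qed
    then show ?thesis by (rule finite_subset) simp
  qed
  have reindex: "h summable_on UNIV \<Longrightarrow> (\<lambda>(w, z). h z) summable_on Sigma UNIV D"
      "(\<Sum>\<^sub>\<infinity>(w, z)\<in>Sigma UNIV D. h z) = infsum h UNIV"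
    for h :: "letter list \<times> letter list \<Rightarrow> 'b :: banach"
    using summable_on_reindex_bij_betw[OF bij, of "\<lambda>(w, z). h z"]
      infsum_reindex_bij_betw[OF bij, of "\<lambda>(w, z). h z"] by simp_all
  let ?h = "\<lambda>z. weight (fst z) * weight (snd z) * cmod (a (fst z) * b (snd z))"
  have h1: "?h summable_on UNIV" and h2: "infsum ?h UNIV \<le> l1norm a * l1norm b"
    using l1_prod_summable(2,3)[OF a b, of "\<lambda>x y. of_real (weight x * weight y)" 1]
    by (simp_all add: norm_mult case_prod_unfold mult_ac)
  have H: "(\<lambda>(w, z). ?h z) summable_on Sigma UNIV D" by (rule reindex(1)[OF h1])
  have le: "weight w * cmod (c w) \<le> (\<Sum>\<^sub>\<infinity>z\<in>D w. ?h z)" for w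
  proof -
    have "weight w * cmod (c w) \<le> (\<Sum>z\<in>D w. weight w * cmod (a (fst z) * b (snd z)))"
      unfolding c_def sum_distrib_left[symmetric] infsum_finite[OF fin]
      by (intro mult_left_mono norm_sum) auto
    also have "\<dots> \<le> (\<Sum>z\<in>D w. ?h z)"
      by (intro sum_mono mult_right_mono) (auto simp: D_def weight_append_le)
    finally show ?thesis using fin by simp
  qed
  have s: "(\<lambda>w. \<Sum>\<^sub>\<infinity>z\<in>D w. ?h z) summable_on UNIV"
    using summable_on_Sigma_banach[OF H] by simp
  have l1c: "l1 c" unfolding l1_def by (rule summable_on_comparison_test[OF s le]) auto
  have "l1norm c \<le> (\<Sum>\<^sub>\<infinity>w. \<Sum>\<^sub>\<infinity>z\<in>D w. ?h z)"
    unfolding l1norm_def by (rule infsum_mono[OF l1c[unfolded l1_def] s le])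
  also have "\<dots> = infsum ?h UNIV"
    using infsum_Sigma'_banach[OF H] reindex(2)[of ?h] by simp
  also note h2
  finally have nc: "l1norm c \<le> l1norm a * l1norm b" .
  have "mcoeff c p q = (\<Sum>\<^sub>\<infinity>x. a x * mcoeff b (p @ x) q)" for p q
  proof -
    let ?k = "\<lambda>z. a (fst z) * b (snd z) * state (p @ fst z @ snd z @ q)"
    note k = l1_prod_summable(1)[OF a b state_le4]
    have k': "?k summable_on UNIV" using k by (simp add: case_prod_unfold)
    have "mcoeff c p q = (\<Sum>\<^sub>\<infinity>w. \<Sum>\<^sub>\<infinity>z\<in>D w. ?k z)"
    proof -
      have "c w * state (p @ w @ q) = (\<Sum>\<^sub>\<infinity>z\<in>D w. ?k z)" for w
        unfolding c_def infsum_finite[OF fin] sum_distrib_right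
        by (rule sum.cong) (auto simp: D_def)
      then show ?thesis by (simp add: mcoeff_def)
    qed
    also have "\<dots> = infsum ?k UNIV"
      using infsum_Sigma'_banach[OF reindex(1)[OF k']] reindex(2)[of ?k] by simp
    also have "\<dots> = (\<Sum>\<^sub>\<infinity>x. \<Sum>\<^sub>\<infinity>y. a x * b y * state (p @ x @ y @ q))"
      using infsum_Sigma'_banach[OF k] by (simp add: case_prod_unfold)
    also have "\<dots> = (\<Sum>\<^sub>\<infinity>x. a x * mcoeff b (p @ x) q)"
      unfolding mcoeff_def by (simp add: infsum_cmult_right'[symmetric] mult.assoc)
    finally show ?thesis .
  qed
  with l1c nc show ?thesis by blast
qed

text \<open>Supplies completeness: an absolutely convergent series of representatives represents the
  coordinatewise sum of the classes and obeys the expected norm estimate.\<close>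

lemma l1_series:
  assumes a: "\<And>n. l1 (a n)" and s: "summable (\<lambda>n. l1norm (a n))"
  shows "\<exists>b. l1 b \<and> l1norm b \<le> (\<Sum>n. l1norm (a n)) \<and> (\<forall>p q. (\<lambda>n. mcoeff (a n) p q) sums mcoeff b p q)"
proof -
  have s': "(\<lambda>n. l1norm (a n)) summable_on UNIV"
    using s l1norm_nonneg by (subst summable_on_UNIV_nonneg_real_iff) auto
  let ?h = "\<lambda>(n, w). weight w * cmod (a n w)"
  have h: "?h summable_on UNIV \<times> UNIV"
    by (rule summable_on_SigmaI[OF _ s'])
      (use has_sum_infsum[OF a[unfolded l1_def]] in \<open>auto simp: l1norm_def\<close>)
  have h': "(\<lambda>(w, n). ?h (n, w)) summable_on UNIV \<times> UNIV"
    using h summable_on_swap[of ?h UNIV UNIV] by (simp add: case_prod_unfold prod.swap_def comp_def)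
  define b where "b = (\<lambda>w. \<Sum>\<^sub>\<infinity>n. a n w)"
  have an: "(\<lambda>n. cmod (a n w)) summable_on UNIV" for w
  proof -
    have "(\<lambda>n. weight w * cmod (a n w)) summable_on UNIV"
      using summable_on_SigmaD1[OF h', of w] by simp
    then show ?thesis using weight_pos[of w] by (simp add: summable_on_cmult_right')
  qed
  have le: "weight w * cmod (b w) \<le> (\<Sum>\<^sub>\<infinity>n. weight w * cmod (a n w))" for w
    unfolding b_def using norm_infsum_bound[OF an[of w]]
    by (simp add: infsum_cmult_right' mult_left_mono)
  have sw: "(\<lambda>w. \<Sum>\<^sub>\<infinity>n. weight w * cmod (a n w)) summable_on UNIV"
    using summable_on_Sigma_banach[of "\<lambda>w n. ?h (n, w)" UNIV "\<lambda>_. UNIV"] h' by simp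
  have l1b: "l1 b" unfolding l1_def by (rule summable_on_comparison_test[OF sw le]) auto
  have "l1norm b \<le> (\<Sum>\<^sub>\<infinity>w. \<Sum>\<^sub>\<infinity>n. weight w * cmod (a n w))"
    unfolding l1norm_def by (rule infsum_mono[OF l1b[unfolded l1_def] sw le])
  also have "\<dots> = (\<Sum>\<^sub>\<infinity>n. \<Sum>\<^sub>\<infinity>w. weight w * cmod (a n w))"
    using infsum_swap_banach[of "\<lambda>w n. weight w * cmod (a n w)" UNIV UNIV] h' by simp
  also have "\<dots> = (\<Sum>n. l1norm (a n))"
    unfolding l1norm_def[symmetric] using has_sum_imp_sums[OF has_sum_infsum[OF s']] sums_unique by blast
  finally have nb: "l1norm b \<le> (\<Sum>n. l1norm (a n))" .
  have "(\<lambda>n. mcoeff (a n) p q) sums mcoeff b p q" for p q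
  proof -
    let ?k = "\<lambda>w n. a n w * state (p @ w @ q)"
    have k: "(\<lambda>(w, n). ?k w n) summable_on UNIV \<times> UNIV"
    proof -
      have "(\<lambda>z. weight p * weight q * (case z of (w, n) \<Rightarrow> ?h (n, w))) summable_on UNIV \<times> UNIV"
        by (rule summable_on_cmult_right[OF h'])
      moreover have "cmod (case z of (w, n) \<Rightarrow> ?k w n) \<le> weight p * weight q * (case z of (w, n) \<Rightarrow> ?h (n, w))" for z
        using mult_left_mono[OF state_le3[of p "fst z" q], of "cmod (a (snd z) (fst z))"]
        by (cases z) (simp add: norm_mult mult_ac)
      ultimately have "(\<lambda>z. cmod (case z of (w, n) \<Rightarrow> ?k w n)) summable_on UNIV \<times> UNIV"
        by (rule summable_on_comparison_test) auto
      then show ?thesis by (rule abs_summable_summable)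
    qed
    have "mcoeff b p q = (\<Sum>\<^sub>\<infinity>w. \<Sum>\<^sub>\<infinity>n. ?k w n)"
      unfolding mcoeff_def b_def by (simp add: infsum_cmult_left')
    also have "\<dots> = (\<Sum>\<^sub>\<infinity>n. \<Sum>\<^sub>\<infinity>w. ?k w n)" by (rule infsum_swap_banach[OF k])
    finally have eq: "mcoeff b p q = (\<Sum>\<^sub>\<infinity>n. mcoeff (a n) p q)" by (simp add: mcoeff_def)
    have "(\<lambda>(n, w). ?k w n) summable_on UNIV \<times> UNIV"
      using k summable_on_swap[of "\<lambda>(w, n). ?k w n" UNIV UNIV]
      by (simp add: case_prod_unfold prod.swap_def comp_def)
    then have "(\<lambda>n. mcoeff (a n) p q) summable_on UNIV"
      unfolding mcoeff_def using summable_on_Sigma_banach[of "\<lambda>n w. ?k w n" UNIV "\<lambda>_. UNIV"] by simp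
    from has_sum_imp_sums[OF has_sum_infsum[OF this]] show ?thesis by (simp add: eq)
  qed
  with l1b nb show ?thesis by blast
qed

section \<open>The quotient algebra\<close>

text \<open>The quotient of the convolution algebra of absolutely summable functions on words by the largest
  two-sided ideal in the kernel of \<^const>\<open>state\<close>; the class of \<open>a\<close> is given by the numbers
  \<open>state (p a q)\<close>.\<close>

typedef alg = "{F. \<exists>a. l1 a \<and> F = mcoeff a}" morphisms entries Alg
  using l1_zero by blast

lemma entries_rep: "\<exists>a. l1 a \<and> entries F = mcoeff a"
  using entries[of F] by simp

lemma entries_Alg: "l1 a \<Longrightarrow> entries (Alg (mcoeff a)) = mcoeff a"
  by (rule Alg_inverse) blast

lemma alg_eqI: "(\<And>p q. entries F p q = entries G p q) \<Longrightarrow> F = G"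
  by (simp add: entries_inject[symmetric] fun_eq_iff)

definition rep :: "alg \<Rightarrow> letter list \<Rightarrow> complex"
  where "rep F = (SOME a. l1 a \<and> entries F = mcoeff a)"

lemma rep: "l1 (rep F)" "mcoeff (rep F) = entries F"
  using someI_ex[OF entries_rep[of F]] by (simp_all add: rep_def)

definition scaleC :: "complex \<Rightarrow> alg \<Rightarrow> alg"
  where "scaleC c F = Alg (\<lambda>p q. c * entries F p q)"

lemma entries_scaleC: "entries (scaleC c F) p q = c * entries F p q"
proof -
  have "mcoeff (\<lambda>w. c * rep F w) = (\<lambda>p q. c * entries F p q)"
    using l1_mult(3)[OF rep(1)] by (simp add: rep(2))
  then show ?thesis
    unfolding scaleC_def using l1_mult(1)[OF rep(1)[of F], of c] by (subst Alg_inverse) auto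
qed

definition qnorm :: "alg \<Rightarrow> real"
  where "qnorm F = Inf {l1norm a |a. l1 a \<and> entries F = mcoeff a}"

instantiation alg :: "{zero, one, plus, minus, uminus, times}"
begin

definition "0 = Alg (\<lambda>_ _. 0)"
definition "1 = Alg (mcoeff (delta []))"
definition "F + G = Alg (\<lambda>p q. entries F p q + entries G p q)"
definition "- F = scaleC (- 1) F"
definition "F - G = F + - (G :: alg)"
text \<open>Only the left factor is replaced by a representative; the right one enters through its
  coordinates.\<close>

definition "F * G = Alg (\<lambda>p q. \<Sum>\<^sub>\<infinity>x. rep F x * entries G (p @ x) q)"

instance ..
end

lemma entries_zero: "entries 0 p q = 0"
proof -
  have "entries (Alg (\<lambda>_ _. 0)) = (\<lambda>_ _. 0)" using entries_Alg[OF l1_zero(1)] by (simp add: l1_zero)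
  then show ?thesis by (simp add: zero_alg_def)
qed

lemma entries_add: "entries (F + G) p q = entries F p q + entries G p q"
proof -
  have "mcoeff (\<lambda>w. rep F w + rep G w) = (\<lambda>p q. entries F p q + entries G p q)"
    using l1_add(3)[OF rep(1) rep(1)] by (simp add: rep(2))
  then show ?thesis
    unfolding plus_alg_def using l1_add(1)[OF rep(1)[of F] rep(1)[of G]] by (subst Alg_inverse) auto
qed

lemma entries_uminus: "entries (- F) p q = - entries F p q"
  by (simp add: uminus_alg_def entries_scaleC)

lemma entries_diff: "entries (F - G) p q = entries F p q - entries G p q"
  by (simp add: minus_alg_def entries_add entries_uminus)

lemma entries_one: "entries 1 p q = state (p @ q)"
  unfolding one_alg_def by (simp add: entries_Alg l1_delta) (simp add: mcoeff_def l1_delta)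

lemma entries_mult: "entries (F * G) p q = (\<Sum>\<^sub>\<infinity>x. rep F x * entries G (p @ x) q)"
proof -
  have "\<exists>a. l1 a \<and> (\<lambda>p q. \<Sum>\<^sub>\<infinity>x. rep F x * entries G (p @ x) q) = mcoeff a"
    using l1_conv[OF rep(1)[of F] rep(1)[of G]] by (auto simp: rep(2))
  then show ?thesis unfolding times_alg_def by (subst Alg_inverse) auto
qed

text \<open>The double sum in \<open>mcoeff_swap\<close> may be read from either side, so a product
  can be expanded over any representative of its right factor. Used a second time, this removes the
  dependence on the chosen \<open>rep\<close> of the left factor.\<close>

lemma entries_mult_right: "l1 b \<Longrightarrow> entries G = mcoeff b \<Longrightarrow> entries (F * G) p q = (\<Sum>\<^sub>\<infinity>y. b y * entries F p (y @ q))"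
  using mcoeff_swap[OF rep(1)[of F], of b p q] by (simp add: entries_mult rep(2))

lemma entries_mult_left: "l1 a \<Longrightarrow> entries F = mcoeff a \<Longrightarrow> entries (F * G) p q = (\<Sum>\<^sub>\<infinity>x. a x * entries G (p @ x) q)"
  using mcoeff_swap[OF _ rep(1)[of G], of a p q] entries_mult_right[OF rep(1) rep(2)[symmetric], of F G p q]
  by (simp add: rep(2))

lemma qnorm_le: "l1 a \<Longrightarrow> entries F = mcoeff a \<Longrightarrow> qnorm F \<le> l1norm a"
  unfolding qnorm_def by (rule cInf_lower) (auto intro!: bdd_belowI[of _ 0] l1norm_nonneg)

lemma qnorm_approx:
  assumes "0 < e"
  shows "\<exists>a. l1 a \<and> entries F = mcoeff a \<and> l1norm a < qnorm F + e"
proof -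
  have "Inf {l1norm a |a. l1 a \<and> entries F = mcoeff a} < qnorm F + e"
    using assms by (simp add: qnorm_def)
  then show ?thesis
    by (subst (asm) cInf_less_iff) (use entries_rep in \<open>auto intro!: bdd_belowI[of _ 0] l1norm_nonneg\<close>)
qed

lemma qnorm_nonneg: "0 \<le> qnorm (F :: alg)"
  unfolding qnorm_def using entries_rep[of F] by (intro cInf_greatest) (auto simp: l1norm_nonneg)

text \<open>Each coordinate is continuous for the quotient norm; in particular the norm is
  definite.\<close>

lemma entries_bound: "cmod (entries F p q) \<le> weight p * weight q * qnorm F"
proof (rule field_le_epsilon)
  fix e :: real assume e: "0 < e"
  define d where "d = e / (weight p * weight q)"
  have d: "0 < d" "weight p * weight q * d = e"
    using e weight_pos[of p] weight_pos[of q] by (simp_all add: d_def)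
  obtain a where a: "l1 a" "entries F = mcoeff a" "l1norm a < qnorm F + d"
    using qnorm_approx[OF d(1)] by blast
  have "cmod (entries F p q) \<le> weight p * weight q * l1norm a"
    using mcoeff_bound[OF a(1)] by (simp add: a(2))
  also have "\<dots> \<le> weight p * weight q * (qnorm F + d)" using a(3) by (intro mult_left_mono) auto
  finally show "cmod (entries F p q) \<le> weight p * weight q * qnorm F + e" using d by (simp add: distrib_left)
qed

lemma qnorm_scaleC_le: "qnorm (scaleC c F) \<le> cmod c * qnorm F"
proof (rule field_le_epsilon)
  fix e :: real assume e: "0 < e"
  define d where "d = e / (cmod c + 1)"
  have d: "0 < d" "cmod c * d \<le> e"
    using e by (auto simp: d_def field_simps add_pos_nonneg)
  obtain a where a: "l1 a" "entries F = mcoeff a" "l1norm a < qnorm F + d"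
    using qnorm_approx[OF d(1)] by blast
  have "entries (scaleC c F) = mcoeff (\<lambda>w. c * a w)"
    by (simp add: fun_eq_iff entries_scaleC a(2) l1_mult(3)[OF a(1)])
  then have "qnorm (scaleC c F) \<le> cmod c * l1norm a"
    using qnorm_le[OF l1_mult(1)[OF a(1), of c]] l1_mult(2)[OF a(1)] by simp
  also have "\<dots> \<le> cmod c * (qnorm F + d)" using a(3) by (intro mult_left_mono) auto
  finally show "qnorm (scaleC c F) \<le> cmod c * qnorm F + e" using d by (simp add: distrib_left)
qed

lemma scaleC_scaleC: "scaleC c (scaleC d F) = scaleC (c * d) F"
  by (rule alg_eqI) (simp add: entries_scaleC)

lemma scaleC_one: "scaleC 1 F = F"
  by (rule alg_eqI) (simp add: entries_scaleC)

lemma qnorm_scaleC: "qnorm (scaleC c F) = cmod c * qnorm F"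
proof (cases "c = 0")
  case True
  then show ?thesis using qnorm_scaleC_le[of c F] qnorm_nonneg[of "scaleC c F"] by simp
next
  case False
  have "qnorm F = qnorm (scaleC (inverse c) (scaleC c F))" using False by (simp add: scaleC_scaleC scaleC_one)
  also have "\<dots> \<le> inverse (cmod c) * qnorm (scaleC c F)" using qnorm_scaleC_le[of "inverse c"] by (simp add: norm_inverse)
  finally have "cmod c * qnorm F \<le> qnorm (scaleC c F)" using False by (simp add: field_simps)
  then show ?thesis using qnorm_scaleC_le[of c F] by simp
qed

lemma qnorm_mult_le: "qnorm (F * G) \<le> qnorm F * qnorm (G :: alg)"
proof -
  have *: "qnorm (F * G) \<le> (qnorm F + e) * (qnorm G + e)" if e: "0 < e" for e
  proof -
    obtain a where a: "l1 a" "entries F = mcoeff a" "l1norm a < qnorm F + e" using qnorm_approx[OF e] by blast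
    obtain b where b: "l1 b" "entries G = mcoeff b" "l1norm b < qnorm G + e" using qnorm_approx[OF e] by blast
    obtain c where c: "l1 c" "l1norm c \<le> l1norm a * l1norm b" "mcoeff c = (\<lambda>p q. \<Sum>\<^sub>\<infinity>x. a x * mcoeff b (p @ x) q)"
      using l1_conv[OF a(1) b(1)] by blast
    have "entries (F * G) = mcoeff c"
      unfolding c(3) by (intro ext) (simp add: entries_mult_left[OF a(1,2)] b(2))
    then have "qnorm (F * G) \<le> l1norm c" by (rule qnorm_le[OF c(1)])
    also have "\<dots> \<le> l1norm a * l1norm b" by (rule c(2))
    also have "\<dots> \<le> (qnorm F + e) * (qnorm G + e)"
      using a(3) b(3) by (intro mult_mono) (auto simp: l1norm_nonneg intro: order_trans[OF l1norm_nonneg less_imp_le])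
    finally show ?thesis .
  qed
  have lim: "((\<lambda>e. (qnorm F + e) * (qnorm G + e)) \<longlongrightarrow> (qnorm F + 0) * (qnorm G + 0)) (at_right 0)"
    by (intro tendsto_intros)
  have "qnorm (F * G) \<le> (qnorm F + 0) * (qnorm G + 0)"
    by (rule tendsto_lowerbound[OF lim]) (use eventually_mono[OF eventually_at_right_less *] in auto)
  then show ?thesis by simp
qed

definition emb :: "letter list \<Rightarrow> alg"
  where "emb w = Alg (mcoeff (delta w))"

lemma entries_emb: "entries (emb w) p q = state (p @ w @ q)"
  unfolding emb_def by (simp add: entries_Alg l1_delta) (simp add: mcoeff_def l1_delta)

lemma qnorm_emb: "qnorm (emb w) \<le> weight w"
  using qnorm_le[of "delta w" "emb w"] by (simp add: emb_def entries_Alg l1_delta)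

lemma one_emb: "1 = emb []"
  by (simp add: one_alg_def emb_def)

lemma entries_emb_mult: "entries (emb w * F) p q = entries F (p @ w) q" "entries (F * emb w) p q = entries F p (w @ q)"
proof -
  have "l1 (delta w)" "entries (emb w) = mcoeff (delta w)"
    by (simp_all add: emb_def entries_Alg l1_delta)
  from entries_mult_left[OF this] entries_mult_right[OF this]
  show "entries (emb w * F) p q = entries F (p @ w) q" "entries (F * emb w) p q = entries F p (w @ q)"
    by (simp_all add: l1_delta)
qed

lemma emb_append: "emb u * emb v = emb (u @ v)"
  by (rule alg_eqI) (simp add: entries_emb_mult entries_emb)

lemma state_not_zero: "state [Vee] \<noteq> 0"
  using newton_1_0 by (simp add: state_def nvee_def wdeg_def cellavg_cellfun)

lemma rep_mat_summable: "(\<lambda>x. rep F x * entries G (p @ x) q) summable_on UNIV"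
proof (rule l1_pair(2)[OF rep(1)])
  fix x
  have "cmod (entries G (p @ x) q) \<le> weight (p @ x) * weight q * qnorm G" by (rule entries_bound)
  also have "\<dots> \<le> (weight p * weight x) * weight q * qnorm G"
    by (intro mult_right_mono weight_append_le qnorm_nonneg) auto
  finally show "cmod (entries G (p @ x) q) \<le> (weight p * weight q * qnorm G) * weight x" by (simp add: mult_ac)
qed

text \<open>Both sides are the same double sum over representatives of the outer factors, with the
  middle factor left as coordinates.\<close>

lemma mult_assoc_alg: "(F * G) * H = F * (G * (H :: alg))"
proof (rule alg_eqI)
  fix p q
  have bd: "cmod (entries G (p @ x) (y @ q)) \<le> weight p * weight q * qnorm G * (weight x * weight y)" for x y
  proof -
    have "cmod (entries G (p @ x) (y @ q)) \<le> weight (p @ x) * weight (y @ q) * qnorm G" by (rule entries_bound)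
    also have "\<dots> \<le> (weight p * weight x) * (weight y * weight q) * qnorm G"
      by (intro mult_right_mono mult_mono weight_append_le qnorm_nonneg) auto
    finally show ?thesis by (simp add: mult_ac)
  qed
  note H = rep(1) rep(2)[symmetric]
  have "entries ((F * G) * H) p q = (\<Sum>\<^sub>\<infinity>y. rep H y * entries (F * G) p (y @ q))"
    by (rule entries_mult_right[OF H])
  also have "\<dots> = (\<Sum>\<^sub>\<infinity>y. \<Sum>\<^sub>\<infinity>x. rep F x * rep H y * entries G (p @ x) (y @ q))"
    by (simp add: entries_mult[of F] infsum_cmult_right'[symmetric] mult_ac)
  also have "\<dots> = (\<Sum>\<^sub>\<infinity>x. \<Sum>\<^sub>\<infinity>y. rep F x * rep H y * entries G (p @ x) (y @ q))"
    by (rule infsum_swap_banach[OF l1_prod_summable(1)[OF rep(1) rep(1) bd], symmetric])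
  also have "\<dots> = entries (F * (G * H)) p q"
    by (simp add: entries_mult[of F] entries_mult_right[OF H, of G] infsum_cmult_right'[symmetric] mult.assoc)
  finally show "entries ((F * G) * H) p q = entries (F * (G * H)) p q" .
qed

section \<open>The quotient is a unital Banach algebra\<close>

instantiation alg :: real_normed_algebra_1
begin

definition "scaleR r = scaleC (of_real r)"
definition "norm = qnorm"
definition "dist F G = norm (F - G :: alg)"
definition "sgn F = scaleR (inverse (norm F)) (F :: alg)"
definition uniformity_alg :: "(alg \<times> alg) filter"
  where "uniformity_alg = (INF e\<in>{0 <..}. principal {(x, y). dist x y < e})"
definition open_alg :: "alg set \<Rightarrow> bool"
  where "open_alg U = (\<forall>x\<in>U. eventually (\<lambda>(x', y). x' = x \<longrightarrow> y \<in> U) uniformity)"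

lemma entries_scaleR: "entries (r *\<^sub>R F) p q = r *\<^sub>R entries F p q"
  by (simp add: scaleR_alg_def entries_scaleC scaleR_conv_of_real)

instance
proof
  fix F G H :: alg and r s :: real
  show "(F + G) + H = F + (G + H)" "F + G = G + F" "0 + F = F" "- F + F = 0" "F - G = F + - G"
    "r *\<^sub>R (F + G) = r *\<^sub>R F + r *\<^sub>R G" "(r + s) *\<^sub>R F = r *\<^sub>R F + s *\<^sub>R F" "r *\<^sub>R s *\<^sub>R F = (r * s) *\<^sub>R F"
    "1 *\<^sub>R F = F"
    by (rule alg_eqI; simp add: entries_add entries_zero entries_uminus entries_diff entries_scaleR algebra_simps)+
  show "(F * G) * H = F * (G * H)" by (rule mult_assoc_alg)
  show "1 * F = F" "F * 1 = F" by (rule alg_eqI; simp add: one_emb entries_emb_mult)+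
  have s: "(\<lambda>x. rep F x * entries G (p @ x) q) summable_on UNIV" for F G p q by (rule rep_mat_summable)
  show "F * (G + H) = F * G + F * H"
    by (rule alg_eqI) (simp add: entries_mult entries_add distrib_left infsum_add[OF s s])
  show dl: "(F + G) * H = F * H + G * H"
  proof (rule alg_eqI)
    fix p q
    have "entries (F + G) = mcoeff (\<lambda>w. rep F w + rep G w)"
      using l1_add(3)[OF rep(1) rep(1)] by (simp add: fun_eq_iff entries_add rep(2))
    from entries_mult_left[OF l1_add(1)[OF rep(1) rep(1)] this, of H p q]
    show "entries ((F + G) * H) p q = entries (F * H + G * H) p q"
      by (simp add: entries_add entries_mult distrib_right infsum_add[OF s s])
  qed
  show "(r *\<^sub>R F) * G = r *\<^sub>R (F * G)"
  proof (rule alg_eqI)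
    fix p q
    have "entries (r *\<^sub>R F) = mcoeff (\<lambda>w. of_real r * rep F w)"
      using l1_mult(3)[OF rep(1)] by (simp add: fun_eq_iff entries_scaleR rep(2) scaleR_conv_of_real)
    from entries_mult_left[OF l1_mult(1)[OF rep(1)] this, of G p q]
    show "entries ((r *\<^sub>R F) * G) p q = entries (r *\<^sub>R (F * G)) p q"
      by (simp add: entries_scaleR entries_mult scaleR_conv_of_real infsum_cmult_right'[symmetric] mult.assoc)
  qed
  show "F * (r *\<^sub>R G) = r *\<^sub>R (F * G)"
    by (rule alg_eqI)
      (simp add: entries_scaleR entries_mult scaleR_conv_of_real infsum_cmult_right'[symmetric] mult.left_commute)
  have "entries 1 [] [Vee] \<noteq> entries 0 [] [Vee]" using state_not_zero by (simp add: entries_one entries_zero)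
  then show one_neq: "(0 :: alg) \<noteq> 1" by metis
  show "dist F G = norm (F - G)" "sgn F = scaleR (inverse (norm F)) F"
    by (simp_all add: dist_alg_def sgn_alg_def)
  show "norm (F + G) \<le> norm F + norm G"
  proof (rule field_le_epsilon)
    fix e :: real assume e: "0 < e"
    obtain a where a: "l1 a" "entries F = mcoeff a" "l1norm a < norm F + e / 2" using qnorm_approx[folded norm_alg_def, of "e / 2"] e by auto
    obtain b where b: "l1 b" "entries G = mcoeff b" "l1norm b < norm G + e / 2" using qnorm_approx[folded norm_alg_def, of "e / 2"] e by auto
    have "entries (F + G) = mcoeff (\<lambda>w. a w + b w)"
      by (simp add: fun_eq_iff entries_add a(2) b(2) l1_add(3)[OF a(1) b(1)])
    then have "norm (F + G) \<le> l1norm a + l1norm b"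
      using qnorm_le[folded norm_alg_def, OF l1_add(1)[OF a(1) b(1)]] l1_add(2)[OF a(1) b(1)] by force
    then show "norm (F + G) \<le> norm F + norm G + e" using a(3) b(3) by simp
  qed
  show "norm (r *\<^sub>R F) = \<bar>r\<bar> * norm F" by (simp add: scaleR_alg_def qnorm_scaleC[folded norm_alg_def])
  show nz: "norm F = 0 \<longleftrightarrow> F = 0" for F :: alg
  proof
    assume "norm F = 0"
    then show "F = 0" using entries_bound[folded norm_alg_def, of F] by (intro alg_eqI) (simp add: entries_zero)
  next
    assume "F = 0"
    moreover have "scaleC 0 F = 0" by (rule alg_eqI) (simp add: entries_scaleC entries_zero)
    ultimately show "norm F = 0" using qnorm_scaleC[folded norm_alg_def, of 0 F] by simp
  qed
  show nm: "norm (F * G) \<le> norm F * norm G" for F G :: alg by (rule qnorm_mult_le[folded norm_alg_def])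
  show "norm (1 :: alg) = 1"
  proof (rule antisym)
    show "norm (1 :: alg) \<le> 1" using qnorm_emb[folded norm_alg_def, of "[]"] by (simp add: one_emb weight_Nil)
    have "1 * 1 = (1 :: alg)" by (rule alg_eqI) (simp add: one_emb entries_emb_mult)
    then have "norm (1 :: alg) \<le> norm (1 :: alg) * norm (1 :: alg)" using nm[of 1 1] by simp
    moreover have "0 < norm (1 :: alg)" using nz[of 1] one_neq qnorm_nonneg[folded norm_alg_def, of 1] by (simp add: less_le)
    ultimately show "1 \<le> norm (1 :: alg)" by simp
  qed
  show "uniformity = (INF e\<in>{0 <..}. principal {(x, y :: alg). dist x y < e})"
    by (rule uniformity_alg_def)
  show "open U = (\<forall>x\<in>U. \<forall>\<^sub>F (x', y) in uniformity. x' = x \<longrightarrow> y \<in> U)" for U :: "alg set"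
    by (rule open_alg_def)
qed

end

lemma norm_le: "l1 a \<Longrightarrow> entries F = mcoeff a \<Longrightarrow> norm F \<le> l1norm a"
  by (simp add: norm_alg_def qnorm_le)

lemma norm_approx: "0 < e \<Longrightarrow> \<exists>a. l1 a \<and> entries F = mcoeff a \<and> l1norm a < norm F + e"
  by (simp add: norm_alg_def qnorm_approx)

lemma norm_scaleC: "norm (scaleC c F) = cmod c * norm F"
  by (simp add: norm_alg_def qnorm_scaleC)

lemma norm_emb: "norm (emb w) \<le> weight w"
  by (simp add: norm_alg_def qnorm_emb)

text \<open>Completeness of a quotient norm: a rapidly Cauchy subsequence is a telescoping series
  whose terms have summable representatives.\<close>

instance alg :: banach
proof
  fix X :: "nat \<Rightarrow> alg" assume X: "Cauchy X"
  have "\<exists>N. \<forall>m\<ge>N. \<forall>n\<ge>N. norm (X m - X n) < (1/2) ^ k" for k :: nat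
    using X unfolding Cauchy_def dist_norm by simp
  then obtain N where N: "\<And>k m n. N k \<le> m \<Longrightarrow> N k \<le> n \<Longrightarrow> norm (X m - X n) < (1/2) ^ k"
    by metis
  \<comment> \<open>The summand \<open>k\<close> makes the subsequence strictly increasing; the sum
    makes it dominate every threshold \<open>N k\<close>.\<close>
  define r where "r = (\<lambda>k. k + (\<Sum>i\<le>k. N i))"
  have rN: "N k \<le> r k" for k
    unfolding r_def by (rule trans_le_add2) (rule member_le_sum, auto)
  have r_mono: "r k \<le> r (Suc k)" for k by (simp add: r_def)
  define d where "d = (\<lambda>k. X (r (Suc k)) - X (r k))"
  have nd: "norm (d k) < (1/2) ^ k" for k
    unfolding d_def using rN[of k] r_mono[of k] by (intro N) auto
  have "\<exists>a. l1 a \<and> entries (d k) = mcoeff a \<and> l1norm a < 2 * (1/2) ^ k" for k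
    using norm_approx[of "(1/2) ^ k" "d k"] nd[of k] by force
  then obtain a where a: "\<And>k. l1 (a k)" "\<And>k. entries (d k) = mcoeff (a k)" "\<And>k. l1norm (a k) < 2 * (1/2) ^ k"
    by metis
  have geo: "summable (\<lambda>k. 2 * (1/2) ^ k :: real)" by (intro summable_mult summable_geometric) simp
  have sa: "summable (\<lambda>k. l1norm (a k))"
    by (rule summable_comparison_test'[OF geo, of 0]) (use a(3) l1norm_nonneg less_imp_le in auto)
  obtain b where b: "l1 b" "\<And>p q. (\<lambda>k. mcoeff (a k) p q) sums mcoeff b p q"
    using l1_series[OF a(1) sa] by blast
  define L where "L = X (r 0) + Alg (mcoeff b)"
  have tail: "norm (L - X (r m)) \<le> (\<Sum>k. l1norm (a (k + m)))" for m
  proof -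
    obtain c where c: "l1 c" "l1norm c \<le> (\<Sum>k. l1norm (a (k + m)))"
        "\<And>p q. (\<lambda>k. mcoeff (a (k + m)) p q) sums mcoeff c p q"
      using l1_series[of "\<lambda>k. a (k + m)", OF a(1)] sa summable_iff_shift[of "\<lambda>k. l1norm (a k)" m] by blast
    have "entries (L - X (r m)) p q = mcoeff c p q" for p q
    proof -
      have "(\<Sum>k<m. mcoeff (a k) p q) = entries (X (r m)) p q - entries (X (r 0)) p q"
        by (induction m) (auto simp: a(2)[symmetric] d_def entries_diff)
      moreover have "mcoeff c p q = mcoeff b p q - (\<Sum>k<m. mcoeff (a k) p q)"
        by (rule sums_unique2[OF c(3) sums_split_initial_segment[OF b(2)]])
      ultimately show ?thesis by (simp add: L_def entries_diff entries_add entries_Alg b(1))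
    qed
    then show ?thesis using norm_le[OF c(1)] c(2) by (force simp: fun_eq_iff)
  qed
  have "(\<lambda>m. \<Sum>k. l1norm (a (k + m))) \<longlonglongrightarrow> 0" by (rule suminf_exist_split2[OF sa])
  then have "(\<lambda>m. L - X (r m)) \<longlonglongrightarrow> 0"
    by (rule Lim_null_comparison[rotated]) (use tail in auto)
  then have lim: "(\<lambda>m. X (r m)) \<longlonglongrightarrow> L"
    using tendsto_diff[OF tendsto_const[of L]] by fastforce
  have "strict_mono r" by (rule strict_monoI_Suc) (simp add: r_def)
  then have "X \<longlonglongrightarrow> L"
    using Cauchy_converges_subseq[OF X _ lim[folded comp_def]] by blast
  then show "convergent X" by (rule convergentI)
qed

section \<open>Generators and relations\<close>

lemma scaleC_simps:
  "scaleC c (F + G) = scaleC c F + scaleC c G"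
  "scaleC (c + d) F = scaleC c F + scaleC d F"
  "scaleC c (scaleC d F) = scaleC (c * d) F"
  "scaleC 1 F = F" "scaleC 0 F = 0" "scaleC c 0 = 0" "scaleC (- 1) F = - F"
  by (rule alg_eqI; simp add: entries_scaleC entries_add entries_zero entries_uminus entries_scaleR
    scaleR_conv_of_real algebra_simps)+

lemma scaleC_of_real: "scaleC (of_real r) F = r *\<^sub>R F"
  by (simp add: scaleR_alg_def)

lemma scaleC_mult: "scaleC c F = scaleC c 1 * F" "scaleC c F = F * scaleC c 1"
proof -
  have "entries (scaleC c 1) = mcoeff (\<lambda>w. c * delta [] w)"
    using l1_mult(3)[OF l1_delta(1)]
    by (simp add: fun_eq_iff entries_scaleC) (simp add: one_alg_def entries_Alg l1_delta)
  note * = l1_mult(1)[OF l1_delta(1)] this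
  show "scaleC c F = scaleC c 1 * F" "scaleC c F = F * scaleC c 1"
    by (rule alg_eqI; simp add: entries_mult_left[OF *] entries_mult_right[OF *] entries_scaleC
      mult.assoc infsum_cmult_right' l1_delta)+
qed

lemma scaleC_mult_left [simp]: "scaleC c F * G = scaleC c (F * G)"
  by (metis scaleC_mult(1) mult.assoc)

lemma scaleC_mult_right [simp]: "F * scaleC c G = scaleC c (F * G)"
  by (metis scaleC_mult mult.assoc)

definition psi :: alg where "psi = emb [Psi]"
definition vee :: alg where "vee = emb [Vee]"
definition phi :: alg where "phi = 1 + vee"
text \<open>The matrix unit in its contractive normalisation: the letter has degree
  \<open>r - r'\<close>, so the power of \<open>1 + V\<close> is built in.\<close>

definition mu :: "nat \<Rightarrow> nat \<Rightarrow> nat \<Rightarrow> nat \<Rightarrow> alg"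
  where "mu r i r' k = emb [Gen r r' [(i, True, k)]]"

lemma lop_id: "lop Psi = id" "lop Vee = id"
  by auto

text \<open>A letter that fixes all functions enters \<open>state\<close> only through the
  commutative data \<open>nvee\<close> and \<open>wdeg\<close>.\<close>

lemma state_swap:
  assumes "lop a = id"
  shows "state (p @ [a] @ w @ q) = state (p @ w @ [a] @ q)"
proof -
  have "wop (p @ [a] @ w @ q) f = wop (p @ w @ [a] @ q) f" for f using assms by simp
  moreover have "nvee (p @ [a] @ w @ q) = nvee (p @ w @ [a] @ q)" "wdeg (p @ [a] @ w @ q) = wdeg (p @ w @ [a] @ q)"
    by (simp_all only: nvee_append wdeg_append add_ac)
  ultimately show ?thesis by (simp only: state_def)
qed

lemma emb_central:
  assumes "lop a = id"
  shows "emb [a] * F = F * emb [a]"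
proof (rule alg_eqI)
  fix p q
  have "entries F (p @ [a]) q = entries F p ([a] @ q)"
    unfolding rep(2)[symmetric] mcoeff_def using state_swap[OF assms, of p _ q] by simp
  then show "entries (emb [a] * F) p q = entries (F * emb [a]) p q" by (simp only: entries_emb_mult)
qed

lemma psi_central: "psi * F = F * psi"
  unfolding psi_def by (rule emb_central) (rule lop_id)

lemma vee_central: "vee * F = F * vee"
  unfolding vee_def by (rule emb_central) (rule lop_id)

lemma phi_central: "phi * F = F * phi"
  by (simp add: phi_def algebra_simps vee_central)

text \<open>This is \<open>newton_step\<close> read in the quotient: \<open>Psi\<close> lowers the
  degree by one and \<open>Vee\<close> raises the order of the difference by one.\<close>

lemma psi_phi: "psi * phi = 1"
proof -
  have "entries (psi * phi) p q = entries 1 p q" for p q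
  proof -
    let ?t = "cellavg 0 0 (wop (p @ q) (cellfun 0 0))"
    let ?k = "nvee (p @ q)" let ?j = "wdeg (p @ q) - 1"
    have "state (p @ [Psi] @ q) = ?t * of_real (newton ?k ?j)"
      by (simp add: state_def nvee_def wdeg_def algebra_simps)
    moreover have "state (p @ [Psi, Vee] @ q) = ?t * of_real (newton (Suc ?k) ?j)"
      by (simp add: state_def nvee_def wdeg_def algebra_simps)
    moreover have "state (p @ q) = ?t * of_real (newton ?k (?j + 1))" by (simp add: state_def)
    ultimately have "state (p @ [Psi] @ q) + state (p @ [Psi, Vee] @ q) = state (p @ q)"
      unfolding newton_step by (simp add: algebra_simps)
    then show ?thesis
      by (simp add: phi_def distrib_left entries_add entries_one) (simp add: psi_def vee_def emb_append entries_emb)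
  qed
  then show ?thesis by (rule alg_eqI)
qed

lemma phi_psi: "phi * psi = 1"
  using psi_phi phi_central by metis

lemma norm_psi: "norm psi \<le> 1"
  using norm_emb[of "[Psi]"] by (simp add: psi_def weight_def nvee_def)

lemma vee_power: "vee ^ k = emb (replicate k Vee)"
proof (induction k)
  case (Suc k)
  then show ?case by (simp add: vee_def emb_append)
qed (simp add: one_emb)

lemma norm_vee_power: "norm (vee ^ k) \<le> 2 ^ k / fact k"
proof -
  have "filter ((=) Vee) (replicate k Vee) = replicate k Vee" by (induction k) auto
  then have "nvee (replicate k Vee) = k" by (simp add: nvee_def)
  then show ?thesis using norm_emb[of "replicate k Vee"] by (simp add: vee_power weight_def)
qed

lemma state_Gen:
  assumes "partial_inj l"
  shows "state (p @ [Gen r r' l] @ q) = cellavg 0 0 (wop p (genop r r' l (wop q (cellfun 0 0)))) *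
    of_real (newton (nvee (p @ q)) (wdeg (p @ q) + (int r - int r')))"
  using assms by (simp add: state_def nvee_def wdeg_def add_ac)

lemma partial_inj_single [simp]: "partial_inj [x]"
  by (simp add: partial_inj_def)

lemma genop_single: "genop r r' [(i, True, k)] f = (\<lambda>t. cellavg r' k f * cellfun r i t)"
  by (simp add: genop_def sgn_of_def fun_eq_iff)

lemma state_mu: "state (p @ [Gen r r' [(i, True, k)]] @ q) =
    cellavg r' k (wop q (cellfun 0 0)) * cellavg 0 0 (wop p (cellfun r i)) *
    of_real (newton (nvee (p @ q)) (wdeg (p @ q) + (int r - int r')))"
  by (simp only: state_Gen partial_inj_single genop_single wop_mult cellavg_mult)

lemma entries_mu: "entries (mu r i r' k) p q =
    cellavg r' k (wop q (cellfun 0 0)) * cellavg 0 0 (wop p (cellfun r i)) *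
    of_real (newton (nvee (p @ q)) (wdeg (p @ q) + (int r - int r')))"
  unfolding mu_def entries_emb by (rule state_mu)

text \<open>The degrees \<open>r - r'\<close> and \<open>r' - r''\<close> add up to
  \<open>r - r''\<close>, so no further power of \<open>1 + V\<close> appears.\<close>

lemma mu_mult: "mu r i r' k * mu r' k' r'' l = (if k = k' then mu r i r'' l else 0)"
proof (rule alg_eqI)
  fix p q
  have "entries (mu r i r' k * mu r' k' r'' l) p q = entries (mu r' k' r'' l) (p @ [Gen r r' [(i, True, k)]]) q"
    unfolding mu_def[of r] entries_emb_mult ..
  also have "\<dots> = entries (if k = k' then mu r i r'' l else 0) p q"
    by (simp add: entries_mu entries_zero genop_single wop_mult cellavg_mult cellavg_cellfun nvee_def wdeg_def add_ac)
  finally show "entries (mu r i r' k * mu r' k' r'' l) p q = entries (if k = k' then mu r i r'' l else 0) p q" .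
qed

lemma entries_psi_mu: "entries (psi * mu r i r' k) p q =
    cellavg r' k (wop q (cellfun 0 0)) * cellavg 0 0 (wop p (cellfun r i)) *
    of_real (newton (nvee (p @ q)) (wdeg (p @ q) + (int r - int r') - 1))"
  unfolding psi_def entries_emb_mult entries_mu by (simp add: nvee_def wdeg_def algebra_simps)

text \<open>The indicator of a cell is the sum of the indicators of its halves. Halving the target
  raises the degree by one, which \<open>psi\<close> compensates.\<close>

lemma mu_refine_left: "mu r i r' k = psi * (mu (Suc r) (2 * i) r' k + mu (Suc r) (2 * i + 1) r' k)"
proof (rule alg_eqI)
  fix p q
  have "cellfun r i = (\<lambda>t. cellfun (Suc r) (2 * i) t + cellfun (Suc r) (2 * i + 1) t)"
    by (rule ext) (rule cellfun_split)
  then have "cellavg 0 0 (wop p (cellfun r i)) =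
      cellavg 0 0 (wop p (cellfun (Suc r) (2 * i))) + cellavg 0 0 (wop p (cellfun (Suc r) (2 * i + 1)))"
    by (simp add: wop_add cellavg_add integrable_wop)
  then show "entries (mu r i r' k) p q = entries (psi * (mu (Suc r) (2 * i) r' k + mu (Suc r) (2 * i + 1) r' k)) p q"
    by (simp add: distrib_left entries_add entries_psi_mu) (simp add: entries_mu algebra_simps)
qed

text \<open>The mean over a cell is the average of the means over its halves. Halving the source
  lowers the degree by one, as \<open>psi\<close> does.\<close>

lemma mu_refine_right_psi: "psi * mu r i r' k = (1/2) *\<^sub>R (mu r i (Suc r') (2 * k) + mu r i (Suc r') (2 * k + 1))"
proof (rule alg_eqI)
  fix p q
  have eq: "cellavg r' k (wop q (cellfun 0 0)) =
      (cellavg (Suc r') (2 * k) (wop q (cellfun 0 0)) + cellavg (Suc r') (2 * k + 1) (wop q (cellfun 0 0))) / 2"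
    by (rule cellavg_split) (simp add: integrable_wop)
  have deg: "wdeg (p @ q) + (int r - int (Suc r')) = wdeg (p @ q) + (int r - int r') - 1" by simp
  show "entries (psi * mu r i r' k) p q = entries ((1/2) *\<^sub>R (mu r i (Suc r') (2 * k) + mu r i (Suc r') (2 * k + 1))) p q"
    by (simp only: entries_psi_mu entries_scaleR entries_add entries_mu eq deg scaleR_conv_of_real[where 'a = complex])
      (simp add: algebra_simps)
qed

lemma emb_Gen:
  assumes l: "partial_inj l"
  shows "emb [Gen r r' l] = (\<Sum>(i, b, k)\<leftarrow>l. (if b then 1 else - 1) * mu r i r' k)"
proof (rule alg_eqI)
  fix p q
  define X where "X = wop q (cellfun 0 0)"
  define nu where "nu = (of_real (newton (nvee (p @ q)) (wdeg (p @ q) + (int r - int r'))) :: complex)"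
  have "cellavg 0 0 (wop p (genop r r' l X)) * nu = entries (\<Sum>(i, b, k)\<leftarrow>l. (if b then 1 else - 1) * mu r i r' k) p q"
  proof (induction l)
    case Nil
    have "genop r r' [] X = (\<lambda>t. 0 * X t)" by (simp add: genop_def fun_eq_iff)
    then show ?case by (simp only: wop_mult cellavg_mult) (simp add: entries_zero)
  next
    case (Cons x l)
    obtain i b k where x: "x = (i, b, k)" by (cases x)
    have "genop r r' (x # l) X = (\<lambda>t. (sgn_of b * cellavg r' k X) * cellfun r i t + genop r r' l X t)"
      by (simp add: x genop_def fun_eq_iff)
    then have "cellavg 0 0 (wop p (genop r r' (x # l) X)) =
        sgn_of b * cellavg r' k X * cellavg 0 0 (wop p (cellfun r i)) + cellavg 0 0 (wop p (genop r r' l X))"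
      by (simp add: wop_add wop_mult cellavg_add cellavg_mult integrable_genop integrable_wop)
    moreover have "entries (mu r i r' k) p q = cellavg r' k X * cellavg 0 0 (wop p (cellfun r i)) * nu"
      unfolding entries_mu X_def nu_def ..
    moreover have "entries ((if b then 1 else - 1) * mu r i r' k) p q = sgn_of b * entries (mu r i r' k) p q"
      by (simp add: sgn_of_def entries_uminus)
    ultimately show ?case using Cons by (simp add: x entries_add algebra_simps)
  qed
  then show "entries (emb [Gen r r' l]) p q = entries (\<Sum>(i, b, k)\<leftarrow>l. (if b then 1 else - 1) * mu r i r' k) p q"
    unfolding entries_emb state_Gen[OF l] X_def nu_def by simp
qed

text \<open>The whole sum is the class of one letter. This is the reason for taking all signed
  partial permutations as generators: the norms of single matrix units would only give the bound
  \<open>m\<close>.\<close>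

lemma norm_mu_sum:
  fixes m :: nat
  assumes s: "inj_on s {..<m}" and t: "inj_on t {..<m}"
  shows "norm (\<Sum>i<m. (if b i then 1 else - 1) * mu r (s i) r' (t i)) \<le> 1"
proof -
  define l where "l = map (\<lambda>i. (s i, b i, t i)) [0..<m]"
  have l: "partial_inj l"
    using s t by (simp add: partial_inj_def l_def comp_def distinct_map atLeast0LessThan)
  have "(\<Sum>i<m. (if b i then 1 else - 1) * mu r (s i) r' (t i)) = emb [Gen r r' l]"
    unfolding emb_Gen[OF l] by (simp add: l_def comp_def sum_list_distinct_conv_sum_set atLeast0LessThan)
  then show ?thesis using norm_emb[of "[Gen r r' l]"] by (simp add: weight_def nvee_def)
qed

lemma vee_mu_nonzero: "vee * mu 0 0 0 0 \<noteq> 0"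
proof
  assume "vee * mu 0 0 0 0 = 0"
  then have "entries (vee * mu 0 0 0 0) [] [] = 0" by (simp add: entries_zero)
  then show False
    using newton_1_0 unfolding vee_def entries_emb_mult entries_mu
    by (simp add: cellavg_cellfun nvee_def wdeg_def)
qed

section \<open>The radical subalgebra\<close>

text \<open>Monomials in \<open>V\<close> and \<open>(1 + V) ^ (-1)\<close>; linear combinations are
  left to \<open>core\<close>.\<close>

inductive_set coef :: "alg set" where
  one: "1 \<in> coef"
| vee: "c \<in> coef \<Longrightarrow> vee * c \<in> coef"
| psi: "c \<in> coef \<Longrightarrow> psi * c \<in> coef"

text \<open>Only pairs of cells of equal length are listed. Matrix units between different levels,
  multiplied by \<open>V\<close>, are recovered in \<open>mu_cofactor\<close>.\<close>

inductive_set core :: "alg set" where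
  zero: "0 \<in> core"
| add: "a \<in> core \<Longrightarrow> c \<in> coef \<Longrightarrow> a + scaleC z (vee * c * mu r x r y) \<in> core"

lemma coef_central: "c \<in> coef \<Longrightarrow> c * F = F * c"
proof (induction rule: coef.induct)
  case (vee c)
  then show ?case using vee_central[of "F * c"] by (simp add: mult.assoc) (simp add: vee_central mult.assoc)
next
  case (psi c)
  then show ?case using psi_central[of "F * c"] by (simp add: mult.assoc) (simp add: psi_central mult.assoc)
qed simp

lemma coef_mult: "c \<in> coef \<Longrightarrow> d \<in> coef \<Longrightarrow> c * d \<in> coef"
  by (induction rule: coef.induct) (auto simp: mult.assoc intro: coef.intros)

lemma coef_vee: "vee \<in> coef" and coef_psi: "psi \<in> coef"
  using coef.vee[OF coef.one] coef.psi[OF coef.one] by simp_all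

lemma core_gen: "c \<in> coef \<Longrightarrow> vee * c * mu r x r y \<in> core"
  using core.add[OF core.zero, of c 1] by (simp add: scaleC_simps)

lemma core_plus: "b \<in> core \<Longrightarrow> a \<in> core \<Longrightarrow> a + b \<in> core"
  by (induction rule: core.induct) (auto simp: add.assoc[symmetric] intro: core.intros)

lemma core_scaleC: "a \<in> core \<Longrightarrow> scaleC z a \<in> core"
  by (induction rule: core.induct) (auto simp: scaleC_simps intro: core.intros)

lemma core_coef: "a \<in> core \<Longrightarrow> d \<in> coef \<Longrightarrow> d * a \<in> core"
proof (induction rule: core.induct)
  case (add a c z r x y)
  have "d * (vee * c * mu r x r y) = vee * (d * c) * mu r x r y"
    using vee_central[of d] by (simp add: mult.assoc[symmetric])
  with add show ?case by (auto simp: distrib_left intro!: core.add coef_mult)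
qed (simp add: core.zero)

text \<open>Allows statements about matrix units, which lie outside \<open>core\<close>, to be
  proved without carrying the factor \<open>V\<close>.\<close>

definition cofactor :: "alg set"
  where "cofactor = {a. \<forall>c\<in>coef. vee * c * a \<in> core}"

lemma cofactor_simps:
  "0 \<in> cofactor" "a \<in> cofactor \<Longrightarrow> b \<in> cofactor \<Longrightarrow> a + b \<in> cofactor"
  "a \<in> cofactor \<Longrightarrow> scaleR t a \<in> cofactor" "a \<in> cofactor \<Longrightarrow> d \<in> coef \<Longrightarrow> d * a \<in> cofactor"
proof -
  show "0 \<in> cofactor" by (simp add: cofactor_def core.zero)
  show "a \<in> cofactor \<Longrightarrow> b \<in> cofactor \<Longrightarrow> a + b \<in> cofactor" by (simp add: cofactor_def distrib_left core_plus)
  show "a \<in> cofactor \<Longrightarrow> scaleR t a \<in> cofactor" by (simp add: cofactor_def core_scaleC scaleC_of_real[symmetric])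
  have "vee * c * (d * a) = vee * (c * d) * a" for c by (simp add: mult.assoc)
  then show "a \<in> cofactor \<Longrightarrow> d \<in> coef \<Longrightarrow> d * a \<in> cofactor"
    by (simp add: cofactor_def coef_mult)
qed

lemma cofactor_phi: "a \<in> cofactor \<Longrightarrow> phi * a \<in> cofactor"
  by (simp add: phi_def distrib_right cofactor_simps coef_vee)

lemma mu_refine_right: "mu r i r' k = phi * ((1/2) *\<^sub>R (mu r i (Suc r') (2 * k) + mu r i (Suc r') (2 * k + 1)))"
  unfolding mu_refine_right_psi[symmetric] by (simp add: mult.assoc[symmetric] phi_psi)

text \<open>Induction on the difference of levels: the coarser of the two cells is halved until the
  lengths agree.\<close>

lemma mu_cofactor: "mu r x r' y \<in> cofactor"
proof -
  have "r + d = r' \<or> r = r' + d \<Longrightarrow> mu r x r' y \<in> cofactor" for d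
  proof (induction d arbitrary: r r' x y)
    case 0
    then show ?case by (auto simp: cofactor_def core_gen)
  next
    case (Suc d)
    show ?case
    proof (cases "r + Suc d = r'")
      case True
      then show ?thesis
        by (subst mu_refine_left) (intro cofactor_simps coef_psi Suc.IH, auto)
    next
      case False
      then show ?thesis using Suc.prems
        by (subst mu_refine_right) (intro cofactor_phi cofactor_simps Suc.IH, auto)
    qed
  qed
  moreover obtain d where "r + d = r' \<or> r = r' + d" by (metis le_Suc_ex nat_le_linear)
  ultimately show ?thesis by blast
qed

lemma psi_left: "F * (psi * G) = psi * (F * G)"
  by (simp only: mult.assoc[symmetric] psi_central[of F])

text \<open>The coarser of the two inner cells is halved until both have the same level, where
  \<open>mu_mult\<close> applies.\<close>

lemma mu_mu_cofactor: "mu r x s y * mu s' y' r' x' \<in> cofactor"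
proof -
  have "s + d = s' \<or> s = s' + d \<Longrightarrow> mu r x s y * mu s' y' r' x' \<in> cofactor" for d
  proof (induction d arbitrary: s s' y y')
    case 0
    then show ?case by (auto simp: mu_mult mu_cofactor cofactor_simps)
  next
    case (Suc d)
    show ?case
    proof (cases "s + Suc d = s'")
      case True
      then show ?thesis
        by (subst mu_refine_right) (simp only: mult.assoc distrib_right scaleR_left_distrib mult_scaleR_left,
          intro cofactor_phi cofactor_simps Suc.IH, auto)
    next
      case False
      have "mu r x s y * mu s' y' r' x' =
          psi * (mu r x s y * mu (Suc s') (2 * y') r' x' + mu r x s y * mu (Suc s') (2 * y' + 1) r' x')"
        by (subst mu_refine_left[of s']) (simp only: psi_left distrib_left)
      also have "\<dots> \<in> cofactor"
        using False Suc.prems by (intro cofactor_simps coef_psi Suc.IH) auto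
      finally show ?thesis .
    qed
  qed
  moreover obtain d where "s + d = s' \<or> s = s' + d" by (metis le_Suc_ex nat_le_linear)
  ultimately show ?thesis by blast
qed

lemma mu_core: "a \<in> core \<Longrightarrow> mu r x r' y * a \<in> core" "a \<in> core \<Longrightarrow> a * mu r x r' y \<in> core"
proof -
  have *: "vee * c * (mu r x r' y * mu s x' s' y') \<in> core" if "c \<in> coef" for c r x r' y s x' s' y'
    using mu_mu_cofactor that by (auto simp: cofactor_def)
  show "mu r x r' y * a \<in> core" if "a \<in> core"
    using that
  proof (induction rule: core.induct)
    case (add a c z s x' y')
    have "mu r x r' y * (vee * c * mu s x' s y') = vee * c * (mu r x r' y * mu s x' s y')"
      using coef_central[OF coef.vee[OF add.hyps(2)], of "mu r x r' y"] by (simp add: mult.assoc[symmetric])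
    then show ?case using add by (auto simp: distrib_left intro!: core_plus core_scaleC *)
  qed (simp add: core.zero)
  show "a * mu r x r' y \<in> core" if "a \<in> core"
    using that
  proof (induction rule: core.induct)
    case (add a c z s x' y')
    then show ?case
      using *[OF add.hyps(2), of s x' s y' r x r' y]
      by (auto simp: distrib_right mult.assoc intro!: core_plus core_scaleC)
  qed (simp add: core.zero)
qed

lemma core_mult: "b \<in> core \<Longrightarrow> a \<in> core \<Longrightarrow> a * b \<in> core"
proof (induction rule: core.induct)
  case (add b c z r x y)
  have "a * (vee * c * mu r x r y) = (vee * c) * (a * mu r x r y)"
    using coef_central[OF coef.vee[OF add.hyps(2)], of a] by (simp add: mult.assoc[symmetric])
  also have "\<dots> \<in> core" using add by (intro core_coef mu_core coef.vee)
  finally show ?case using add by (auto simp: distrib_left intro!: core_plus core_scaleC)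
qed (simp add: core.zero)

definition radalg :: "alg set" where "radalg = closure core"

lemma radalg_lim: "(\<And>n. X n \<in> radalg) \<Longrightarrow> X \<longlonglongrightarrow> a \<Longrightarrow> a \<in> radalg"
  unfolding radalg_def using closed_sequentially[OF closed_closure] by blast

lemma radalg_core: "a \<in> core \<Longrightarrow> a \<in> radalg"
  unfolding radalg_def using closure_subset by blast

lemma radalg_seq: "a \<in> radalg \<Longrightarrow> \<exists>X. (\<forall>n. X n \<in> core) \<and> X \<longlonglongrightarrow> a"
  unfolding radalg_def closure_sequential .

lemma radalg_map:
  assumes "a \<in> radalg" "\<And>b. b \<in> core \<Longrightarrow> h b \<in> radalg" "\<And>X. X \<longlonglongrightarrow> a \<Longrightarrow> (\<lambda>n. h (X n)) \<longlonglongrightarrow> h a"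
  shows "h a \<in> radalg"
proof -
  obtain X where X: "\<And>n. X n \<in> core" "X \<longlonglongrightarrow> a" using radalg_seq[OF assms(1)] by blast
  show ?thesis by (rule radalg_lim[OF assms(2) assms(3)]) (use X in auto)
qed

lemma radalg_zero: "0 \<in> radalg"
  by (simp add: radalg_core core.zero)

lemma radalg_add: "a \<in> radalg \<Longrightarrow> b \<in> radalg \<Longrightarrow> a + b \<in> radalg"
  by (rule radalg_map[where h = "\<lambda>a. a + b"], assumption, rule radalg_map[where a = b])
    (auto intro!: tendsto_intros radalg_core core_plus)

lemma tendsto_scaleC: "X \<longlonglongrightarrow> a \<Longrightarrow> (\<lambda>n. scaleC z (X n)) \<longlonglongrightarrow> scaleC z a"
  by (subst (1 2) scaleC_mult(1)) (intro tendsto_intros)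

lemma radalg_scaleC: "a \<in> radalg \<Longrightarrow> scaleC z a \<in> radalg"
  by (rule radalg_map[where h = "scaleC z"]) (auto intro!: tendsto_scaleC radalg_core core_scaleC)

lemma radalg_scaleR: "a \<in> radalg \<Longrightarrow> t *\<^sub>R a \<in> radalg"
  unfolding scaleC_of_real[symmetric] by (rule radalg_scaleC)

lemma radalg_diff: "a \<in> radalg \<Longrightarrow> b \<in> radalg \<Longrightarrow> a - b \<in> radalg"
  using radalg_add[of a "(-1) *\<^sub>R b"] radalg_scaleR[of b "-1"] by simp

lemma radalg_coef: "a \<in> radalg \<Longrightarrow> d \<in> coef \<Longrightarrow> d * a \<in> radalg"
  by (rule radalg_map[where h = "\<lambda>a. d * a"]) (auto intro!: tendsto_intros radalg_core core_coef)

lemma radalg_mu: "a \<in> radalg \<Longrightarrow> mu r x r' y * a \<in> radalg" "a \<in> radalg \<Longrightarrow> a * mu r x r' y \<in> radalg"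
  by (rule radalg_map[where h = "\<lambda>a. mu r x r' y * a"] radalg_map[where h = "\<lambda>a. a * mu r x r' y"];
    auto intro!: tendsto_intros radalg_core mu_core)+

lemma radalg_mult: "a \<in> radalg \<Longrightarrow> b \<in> radalg \<Longrightarrow> a * b \<in> radalg"
  by (rule radalg_map[where h = "\<lambda>a. a * b"], assumption, rule radalg_map[where a = b])
    (auto intro!: tendsto_intros radalg_core core_mult)

lemma radalg_sum: "(\<And>i. i \<in> I \<Longrightarrow> h i \<in> radalg) \<Longrightarrow> (\<Sum>i\<in>I. h i) \<in> radalg"
  by (induction I rule: infinite_finite_induct) (auto simp: radalg_zero radalg_add)

lemma vee_mu_radalg: "vee * mu r x r' y \<in> radalg"
proof -
  have "vee * 1 * mu r x r' y \<in> core" using mu_cofactor coef.one unfolding cofactor_def by blast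
  then show ?thesis by (simp add: radalg_core)
qed

section \<open>A central approximate identity divisible by \<open>V\<close>\<close>

definition quot :: "nat \<Rightarrow> alg"
  where "quot n = (1 / real n) *\<^sub>R (\<Sum>i<n. \<Sum>j<Suc i. psi * psi ^ j)"

text \<open>This form displays divisibility by \<open>V\<close>; the uniform bound comes from
  \<open>fcen_eq\<close>, one minus a Cesaro mean of powers of \<open>psi\<close>.\<close>

definition fcen :: "nat \<Rightarrow> alg" where "fcen n = vee * quot n"

lemma psi_vee: "psi * vee = 1 - psi"
  using psi_phi by (simp add: phi_def algebra_simps)

lemma one_minus_psi_power: "1 - psi ^ k = vee * (\<Sum>j<k. psi * psi ^ j)"
proof -
  have "vee * (\<Sum>j<k. psi * psi ^ j) = (vee * psi) * (\<Sum>j<k. psi ^ j)"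
    by (simp add: sum_distrib_left mult.assoc)
  also have "\<dots> = (1 - psi) * (\<Sum>j<k. psi ^ j)" by (simp add: vee_central psi_vee)
  also have "\<dots> = 1 - psi ^ k" by (induction k) (simp_all add: distrib_left, simp add: left_diff_distrib)
  finally show ?thesis by simp
qed

lemma fcen_eq: "fcen n = (1 / real n) *\<^sub>R (\<Sum>i<n. 1 - psi ^ Suc i)"
  unfolding fcen_def quot_def one_minus_psi_power by (simp add: sum_distrib_left)

lemma norm_psi_power: "norm (psi ^ k) \<le> 1"
  using norm_power_ineq[of psi k] power_le_one[OF norm_ge_zero norm_psi] order_trans by blast

lemma norm_one_minus_psi: "norm (1 - psi ^ k) \<le> 2"
  using norm_triangle_ineq4[of 1 "psi ^ k"] norm_psi_power[of k] by simp

lemma norm_fcen: "norm (fcen n) \<le> 2"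
proof (cases "n = 0")
  case False
  have "norm (\<Sum>i<n. 1 - psi ^ Suc i) \<le> (\<Sum>i<n. 2)"
    by (rule sum_norm_le) (rule norm_one_minus_psi)
  then show ?thesis using False by (simp add: fcen_eq field_simps)
qed (simp add: fcen_eq)

text \<open>The mean ergodic computation: \<open>vee\<close> times the sum of the powers of
  \<open>psi\<close> collapses to \<open>1 - psi ^ n\<close>, which is bounded, so dividing by
  \<open>n\<close> makes the difference tend to zero.\<close>

lemma vee_fcen:
  assumes "0 < n"
  shows "vee - fcen n * vee = (1 / real n) *\<^sub>R (1 - psi ^ n)"
proof -
  have "fcen n = 1 - (1 / real n) *\<^sub>R (\<Sum>i<n. psi ^ Suc i)"
  proof -
    have "(1 / real n) *\<^sub>R (of_nat n :: alg) = 1"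
      using assms by (subst of_real_of_nat_eq[symmetric]) (simp add: of_real_def)
    then show ?thesis by (simp add: fcen_eq sum_subtractf scaleR_diff_right del: power_Suc)
  qed
  then have "vee - fcen n * vee = (1 / real n) *\<^sub>R ((\<Sum>i<n. psi * psi ^ i) * vee)"
    by (simp add: left_diff_distrib)
  also have "(\<Sum>i<n. psi * psi ^ i) * vee = 1 - psi ^ n"
    unfolding one_minus_psi_power by (rule vee_central[symmetric])
  finally show ?thesis .
qed

lemma fcen_vee_lim: "(\<lambda>n. fcen n * vee) \<longlonglongrightarrow> vee"
proof -
  have "(\<lambda>n. vee - fcen n * vee) \<longlonglongrightarrow> 0"
  proof (rule Lim_null_comparison)
    show "\<forall>\<^sub>F n in sequentially. norm (vee - fcen n * vee) \<le> 2 * inverse (real n)"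
      using eventually_gt_at_top[of 0]
      by eventually_elim (use norm_one_minus_psi in \<open>auto simp: vee_fcen divide_simps\<close>)
    show "(\<lambda>n. 2 * inverse (real n)) \<longlonglongrightarrow> 0"
      by (rule tendsto_mult_right_zero[OF lim_inverse_n])
  qed
  then show ?thesis using tendsto_diff[OF tendsto_const[of vee]] by fastforce
qed

lemma psi_power_coef: "psi ^ k \<in> coef"
  by (induction k) (auto intro: coef.intros)

lemma quot_central: "quot n * F = F * quot n"
  unfolding quot_def
  by (simp add: sum_distrib_left sum_distrib_right coef_central[OF coef.psi[OF psi_power_coef]]
    del: sum.lessThan_Suc)

lemma fcen_central: "fcen n * F = F * fcen n"
  unfolding fcen_def using quot_central[of n F] vee_central[of F] by (metis mult.assoc)

lemma radalg_quot: "a \<in> radalg \<Longrightarrow> quot n * a \<in> radalg"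
  unfolding quot_def
  by (auto simp: sum_distrib_right simp del: sum.lessThan_Suc
    intro!: radalg_scaleR radalg_sum radalg_coef coef.psi psi_power_coef)

lemma radalg_fcen: "a \<in> radalg \<Longrightarrow> fcen n * a \<in> radalg"
  unfolding fcen_def mult.assoc by (intro radalg_coef radalg_quot coef_vee)

lemma fcen_mu_radalg: "fcen n * mu r x r' y \<in> radalg"
proof -
  have "fcen n * mu r x r' y = quot n * (vee * mu r x r' y)"
    by (simp add: fcen_def vee_central[of "quot n"] mult.assoc)
  then show ?thesis by (simp add: radalg_quot vee_mu_radalg)
qed

text \<open>For uniformly bounded additive maps, convergence to zero on the dense set
  \<open>core\<close> extends to its closure.\<close>

lemma lim_on_radalg:
  assumes bd: "\<And>n a. a \<in> radalg \<Longrightarrow> norm (h n a) \<le> C * norm a"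
    and diff: "\<And>n a b. a \<in> radalg \<Longrightarrow> b \<in> radalg \<Longrightarrow> h n (a - b) = h n a - h n b"
    and core: "\<And>a. a \<in> core \<Longrightarrow> (\<lambda>n. h n a) \<longlonglongrightarrow> 0" and a: "a \<in> radalg"
  shows "(\<lambda>n. h n a :: 'b :: real_normed_vector) \<longlonglongrightarrow> 0"
proof (rule LIMSEQ_I)
  fix e :: real assume e: "0 < e"
  obtain X where X: "\<And>n. X n \<in> core" "X \<longlonglongrightarrow> a" using radalg_seq[OF a] by blast
  have "0 < e / (2 * (\<bar>C\<bar> + 1))" using e by simp
  then obtain k where k: "norm (X k - a) < e / (2 * (\<bar>C\<bar> + 1))" using LIMSEQ_D[OF X(2)] by blast
  have "\<bar>C\<bar> * norm (a - X k) \<le> \<bar>C\<bar> * (e / (2 * (\<bar>C\<bar> + 1)))"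
    using k by (intro mult_left_mono) (auto simp: norm_minus_commute)
  also have "\<dots> < e / 2" using e by (simp add: field_simps)
  finally have ak: "\<bar>C\<bar> * norm (a - X k) < e / 2" .
  obtain N where N: "\<And>n. N \<le> n \<Longrightarrow> norm (h n (X k) - 0) < e / 2"
    using LIMSEQ_D[OF core[OF X(1)], of "e / 2"] e by fastforce
  have "norm (h n a - 0) < e" if "N \<le> n" for n
  proof -
    have "norm (h n a) \<le> norm (h n (a - X k)) + norm (h n (X k))"
      using norm_triangle_ineq[of "h n a - h n (X k)" "h n (X k)"] by (simp add: diff a radalg_core X)
    moreover have "norm (h n (a - X k)) \<le> \<bar>C\<bar> * norm (a - X k)"
      using bd[OF radalg_diff[OF a radalg_core[OF X(1)]], of n k] abs_ge_self[of C] by (meson mult_right_mono norm_ge_zero order_trans)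
    ultimately show ?thesis using ak N[OF that] by simp
  qed
  then show "\<exists>no. \<forall>n\<ge>no. norm (h n a - 0) < e" by blast
qed

lemma fcen_lim_core: "a \<in> core \<Longrightarrow> (\<lambda>n. fcen n * a) \<longlonglongrightarrow> a"
proof (induction rule: core.induct)
  case (add a c z r x y)
  have "(\<lambda>n. fcen n * a + scaleC z (fcen n * vee * (c * mu r x r y))) \<longlonglongrightarrow> a + scaleC z (vee * (c * mu r x r y))"
    by (intro tendsto_intros tendsto_scaleC add fcen_vee_lim)
  then show ?case by (simp add: distrib_left mult.assoc)
qed simp

lemma fcen_lim:
  assumes "a \<in> radalg"
  shows "(\<lambda>n. fcen n * a) \<longlonglongrightarrow> a"
proof -
  have "(\<lambda>n. fcen n * a - a) \<longlonglongrightarrow> 0"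
  proof (rule lim_on_radalg[where C = 3, OF _ _ _ assms])
    show "norm (fcen n * a - a) \<le> 3 * norm a" for n a
    proof -
      have "norm (fcen n * a) \<le> 2 * norm a"
        using norm_mult_ineq[of "fcen n" a] mult_right_mono[OF norm_fcen, of "norm a" n] by simp
      then show ?thesis using norm_triangle_ineq4[of "fcen n * a" a] by simp
    qed
    show "(\<lambda>n. fcen n * a - a) \<longlonglongrightarrow> 0" if "a \<in> core" for a
      using tendsto_diff[OF fcen_lim_core[OF that] tendsto_const[of a]] by simp
  qed (simp add: algebra_simps)
  then show ?thesis by (simp add: LIM_zero_iff)
qed

lemma central_power: "(\<And>F. x * F = F * x) \<Longrightarrow> x ^ d * F = F * x ^ d" for x :: alg
  by (induction d) (auto simp: mult.assoc, metis mult.assoc)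

text \<open>Split \<open>a\<close> into a part \<open>u\<close> of norm below \<open>1\<close> and
  \<open>fcen n * a\<close>. A Neumann series inverts \<open>1 - u\<close>, and multiplying
  \<open>1 - a\<close> by that inverse leaves \<open>1 - fcen n * c\<close>. Here
  \<open>fcen n * c\<close> is divisible by the central quasinilpotent \<open>vee\<close>, so a
  second Neumann series applies.\<close>

lemma radalg_quasi_regular:
  assumes a: "a \<in> radalg"
  shows "\<exists>s\<in>radalg. s = a + s * a"
proof -
  obtain n where n: "norm (fcen n * a - a) < 1" using LIMSEQ_D[OF fcen_lim[OF a], of 1] by auto
  define u where "u = a - fcen n * a"
  have u: "u \<in> radalg" "norm u < 1"
    using n a by (auto simp: u_def norm_minus_commute intro: radalg_diff radalg_fcen)
  \<comment> \<open>Summability of the norms of the powers is all that is assumed, so this serves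
    both the small element \<open>u\<close> and the quasinilpotent
    \<open>fcen n * c\<close>.\<close>
  have *: "\<exists>t\<in>radalg. (1 + t) * (1 - v) = 1" if v: "v \<in> radalg" and s: "summable (\<lambda>k. norm (v ^ k))" for v
  proof
    define S where "S = (\<Sum>k. v ^ Suc k)"
    have s1: "summable (\<lambda>k. v ^ k)" by (rule summable_norm_cancel[OF s])
    then have s2: "summable (\<lambda>k. v ^ Suc k)" by (subst summable_Suc_iff)
    have vk: "v ^ Suc k \<in> radalg" for k by (induction k) (use v in \<open>auto intro: radalg_mult\<close>)
    show "S \<in> radalg"
      by (rule radalg_lim[OF _ summable_LIMSEQ[OF s2, folded S_def]]) (intro radalg_sum vk)
    have "S * v = (\<Sum>k. v ^ Suc k * v)" unfolding S_def by (rule suminf_mult2[OF s2])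
    also have "\<dots> = (\<Sum>k. v ^ Suc (Suc k))" by (simp add: power_commutes mult.assoc)
    also have "\<dots> = S - v" using suminf_split_head[OF s2] by (simp add: S_def)
    finally show "(1 + S) * (1 - v) = 1" by (simp add: algebra_simps)
  qed
  have "summable (\<lambda>k. norm (u ^ k))"
    by (rule summable_comparison_test'[OF summable_geometric[of "norm u"], of 0])
      (use u(2) in \<open>auto simp: norm_power_ineq\<close>)
  then obtain t where t: "t \<in> radalg" "(1 + t) * (1 - u) = 1" using *[OF u(1)] by blast
  define c where "c = (1 + t) * a"
  have c: "c \<in> radalg" using a t by (auto simp: c_def distrib_right intro: radalg_add radalg_mult)
  \<comment> \<open>Since \<open>vee\<close> is central, its \<open>k\<close>-th power splits off
    and brings the decay \<open>2 ^ k / k!\<close>.\<close>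
  have power: "(fcen n * c) ^ k = vee ^ k * (quot n * c) ^ k" for k
  proof -
    note comm = central_power[of vee, OF vee_central]
    show ?thesis
    proof (induction k)
      case (Suc k)
      have "(fcen n * c) ^ Suc k = vee * (quot n * c) * (vee ^ k * (quot n * c) ^ k)"
        using Suc by (simp add: fcen_def mult.assoc)
      also have "\<dots> = vee * (vee ^ k * (quot n * c)) * (quot n * c) ^ k"
        by (simp only: comm[of k "quot n * c"] mult.assoc)
      finally show ?case by (simp add: mult.assoc)
    qed simp
  qed
  have "summable (\<lambda>k. norm ((fcen n * c) ^ k))"
  proof (rule summable_comparison_test'[where N = 0])
    let ?R = "2 * norm (quot n * c)"
    show "summable (\<lambda>k. ?R ^ k /\<^sub>R fact k)" by (rule summable_exp_generic)
    fix k
    have "norm ((fcen n * c) ^ k) \<le> norm (vee ^ k) * norm ((quot n * c) ^ k)"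
      unfolding power by (rule norm_mult_ineq)
    also have "\<dots> \<le> (2 ^ k / fact k) * norm (quot n * c) ^ k"
      by (intro mult_mono norm_vee_power norm_power_ineq) auto
    finally show "norm (norm ((fcen n * c) ^ k)) \<le> ?R ^ k /\<^sub>R fact k"
      by (simp add: power_mult_distrib field_simps)
  qed
  then obtain t' where t': "t' \<in> radalg" "(1 + t') * (1 - fcen n * c) = 1"
    using *[OF radalg_fcen[OF c]] by blast
  define s where "s = t' + t + t' * t"
  have s: "1 + s = (1 + t') * (1 + t)" by (simp add: s_def algebra_simps)
  have "(1 + t) * (1 - a) = 1 - fcen n * c"
  proof -
    have "(1 + t) * (1 - a) = (1 + t) * (1 - u) - (1 + t) * (fcen n * a)"
      by (simp add: u_def algebra_simps)
    also have "(1 + t) * (fcen n * a) = fcen n * c"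
      using fcen_central[of n "1 + t"] by (simp add: c_def mult.assoc[symmetric])
    finally show ?thesis by (simp add: t(2))
  qed
  then have "(1 + s) * (1 - a) = 1" unfolding s mult.assoc by (simp add: t'(2))
  then have "s = a + s * a" by (simp add: algebra_simps)
  moreover have "s \<in> radalg" using t t' by (auto simp: s_def intro: radalg_add radalg_mult)
  ultimately show ?thesis by blast
qed

section \<open>The approximate diagonal\<close>

text \<open>A tensor is represented by its values at all bounded bilinear forms, in place of an
  element of the projective tensor product. The explicit constant \<open>K\<close> keeps the
  estimates uniform.\<close>

definition bilin :: "real \<Rightarrow> (alg \<Rightarrow> alg \<Rightarrow> complex) \<Rightarrow> bool"
  where "bilin K B \<longleftrightarrow> 0 \<le> K \<and>
    (\<forall>a\<in>radalg. \<forall>b\<in>radalg. cmod (B a b) \<le> K * norm a * norm b) \<and>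
    (\<forall>a\<in>radalg. \<forall>b\<in>radalg. \<forall>c\<in>radalg. B (a + b) c = B a c + B b c \<and> B c (a + b) = B c a + B c b) \<and>
    (\<forall>z. \<forall>a\<in>radalg. \<forall>b\<in>radalg. B (scaleC z a) b = z * B a b \<and> B a (scaleC z b) = z * B a b)"

lemma bilinD:
  assumes "bilin K B" "a \<in> radalg" "b \<in> radalg"
  shows "cmod (B a b) \<le> K * norm a * norm b"
    "c \<in> radalg \<Longrightarrow> B (a + b) c = B a c + B b c" "c \<in> radalg \<Longrightarrow> B c (a + b) = B c a + B c b"
    "B (scaleC z a) b = z * B a b" "B a (scaleC z b) = z * B a b"
    "B (t *\<^sub>R a) b = of_real t * B a b" "B a (t *\<^sub>R b) = of_real t * B a b"
  using assms by (auto simp: bilin_def scaleC_of_real[symmetric])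

lemma bilin_nonneg: "bilin K B \<Longrightarrow> 0 \<le> K"
  by (simp add: bilin_def)

lemma bilin_zero:
  assumes "bilin K B" "a \<in> radalg"
  shows "B 0 a = 0" "B a 0 = 0"
  using bilinD(4,5)[OF assms(1) radalg_zero assms(2), of 0] bilinD(4,5)[OF assms(1) assms(2) radalg_zero, of 0]
  by (simp_all add: scaleC_simps)

lemma bilin_sum:
  assumes "bilin K B" "c \<in> radalg" "\<And>i. i \<in> I \<Longrightarrow> h i \<in> radalg"
  shows "B (\<Sum>i\<in>I. h i) c = (\<Sum>i\<in>I. B (h i) c)" "B c (\<Sum>i\<in>I. h i) = (\<Sum>i\<in>I. B c (h i))"
  using assms(3)
  by (induction I rule: infinite_finite_induct)
    (auto simp: bilin_zero[OF assms(1,2)] bilinD(2,3)[OF assms(1)] assms(2) radalg_sum)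

text \<open>Matrix units, \<open>psi\<close> and \<open>phi\<close> act on \<open>radalg\<close>
  from the ambient algebra; forms on \<open>radalg\<close> can be composed with these
  actions.\<close>

definition multiplier :: "alg \<Rightarrow> bool"
  where "multiplier x \<longleftrightarrow> (\<forall>a\<in>radalg. x * a \<in> radalg \<and> a * x \<in> radalg)"

lemma multiplierD: "multiplier x \<Longrightarrow> a \<in> radalg \<Longrightarrow> x * a \<in> radalg" "multiplier x \<Longrightarrow> a \<in> radalg \<Longrightarrow> a * x \<in> radalg"
  by (simp_all add: multiplier_def)

lemma multiplier_radalg: "x \<in> radalg \<Longrightarrow> multiplier x"
  by (simp add: multiplier_def radalg_mult)

lemma multiplier_coef: "x \<in> coef \<Longrightarrow> multiplier x"
  using coef_central[of x] radalg_coef[of _ x] by (simp add: multiplier_def)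

lemma multiplier_mu: "multiplier (mu r x r' y)"
  by (simp add: multiplier_def radalg_mu)

lemma multiplier_simps: "multiplier 1" "multiplier x \<Longrightarrow> multiplier y \<Longrightarrow> multiplier (x * y)"
  "multiplier x \<Longrightarrow> multiplier y \<Longrightarrow> multiplier (x + y)" "multiplier x \<Longrightarrow> multiplier (t *\<^sub>R x)"
proof -
  show "multiplier (x * y)" if "multiplier x" "multiplier y"
    using that by (simp add: multiplier_def mult.assoc) (simp add: mult.assoc[symmetric])
qed (auto simp: multiplier_def distrib_left distrib_right intro: radalg_add radalg_scaleR)

lemma bilin_left:
  assumes B: "bilin K B" and x: "multiplier x"
  shows "bilin (K * norm x) (\<lambda>p q. B (x * p) q)" "bilin (K * norm x) (\<lambda>p q. B p (q * x))"
proof -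
  have K: "0 \<le> K" using B by (simp add: bilin_def)
  have b: "cmod (B (x * a) b) \<le> K * norm x * norm a * norm b" "cmod (B a (b * x)) \<le> K * norm x * norm a * norm b"
    if "a \<in> radalg" "b \<in> radalg" for a b
  proof -
    have "cmod (B (x * a) b) \<le> K * norm (x * a) * norm b"
      using bilinD(1)[OF B] multiplierD[OF x] that by blast
    also have "\<dots> \<le> K * (norm x * norm a) * norm b"
      by (intro mult_right_mono mult_left_mono norm_mult_ineq K) auto
    finally show "cmod (B (x * a) b) \<le> K * norm x * norm a * norm b" by (simp add: mult_ac)
    have "cmod (B a (b * x)) \<le> K * norm a * norm (b * x)"
      using bilinD(1)[OF B] multiplierD[OF x] that by blast
    also have "\<dots> \<le> K * norm a * (norm b * norm x)"
      by (intro mult_left_mono norm_mult_ineq mult_nonneg_nonneg K) auto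
    finally show "cmod (B a (b * x)) \<le> K * norm x * norm a * norm b" by (simp add: mult_ac)
  qed
  show "bilin (K * norm x) (\<lambda>p q. B (x * p) q)" "bilin (K * norm x) (\<lambda>p q. B p (q * x))"
    using K b bilinD(2-5)[OF B] multiplierD[OF x]
    by (auto simp: bilin_def distrib_left distrib_right radalg_scaleC)
qed

lemma bilin_central:
  assumes "bilin K B" "multiplier x" "\<And>F. x * F = F * x"
  shows "bilin (K * norm x) (\<lambda>p q. B p (x * q))"
  using bilin_left(2)[OF assms(1,2)] assms(3) by simp

lemma multiplier_phi: "multiplier phi"
  by (simp add: phi_def multiplier_simps multiplier_coef coef_vee)

section \<open>Passing to finer dyadic levels\<close>

lemma sum_double: "(\<Sum>i\<in>{a..<b}. h (2 * i) + h (2 * i + 1)) = (\<Sum>j\<in>{2 * a..<2 * b}. h j)"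
  for a b :: nat and h :: "nat \<Rightarrow> 'a :: comm_monoid_add"
proof (induction b)
  case (Suc b)
  show ?case
  proof (cases "a \<le> b")
    case True
    have "{2 * a..<2 * Suc b} = insert (2 * b + 1) (insert (2 * b) {2 * a..<2 * b})"
      using True by auto
    then show ?thesis using Suc True by (simp add: add_ac)
  qed simp
qed simp

text \<open>The cells of level \<open>r + d\<close> that make up cell \<open>x\<close> of level
  \<open>r\<close>.\<close>

abbreviation block :: "nat \<Rightarrow> nat \<Rightarrow> nat set"
  where "block d x \<equiv> {x * 2 ^ d..<Suc x * 2 ^ d}"

lemma mu_refine_left_block: "mu r x s k = psi ^ d * (\<Sum>i\<in>block d x. mu (r + d) i s k)"
proof (induction d)
  case (Suc d)
  have "mu r x s k = psi ^ d * (\<Sum>i\<in>block d x. psi * (mu (Suc (r + d)) (2 * i) s k + mu (Suc (r + d)) (2 * i + 1) s k))"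
    unfolding mu_refine_left[symmetric] by (rule Suc)
  also have "\<dots> = psi ^ Suc d * (\<Sum>i\<in>block d x. mu (Suc (r + d)) (2 * i) s k + mu (Suc (r + d)) (2 * i + 1) s k)"
    by (simp only: sum_distrib_left[symmetric] power_Suc2 mult.assoc)
  also have "\<dots> = psi ^ Suc d * (\<Sum>i\<in>{2 * (x * 2 ^ d)..<2 * (Suc x * 2 ^ d)}. mu (Suc (r + d)) i s k)"
    using sum_double[of "\<lambda>i. mu (Suc (r + d)) i s k"] by simp
  finally show ?case by (simp add: mult_ac)
qed simp

lemma mu_refine_right_block: "psi ^ d * mu s k r y = (1/2) ^ d *\<^sub>R (\<Sum>i\<in>block d y. mu s k (r + d) i)"
proof (induction d)
  case (Suc d)
  have "psi ^ Suc d * mu s k r y = psi * ((1/2) ^ d *\<^sub>R (\<Sum>i\<in>block d y. mu s k (r + d) i))"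
    using Suc by (simp add: mult.assoc)
  also have "\<dots> = (1/2) ^ Suc d *\<^sub>R (\<Sum>i\<in>block d y. mu s k (Suc (r + d)) (2 * i) + mu s k (Suc (r + d)) (2 * i + 1))"
    by (simp add: sum_distrib_left mu_refine_right_psi scaleR_sum_right[symmetric] del: mult_scaleR_right)
      (simp add: sum_distrib_left mu_refine_right_psi scaleR_sum_right[symmetric])
  also have "\<dots> = (1/2) ^ Suc d *\<^sub>R (\<Sum>i\<in>{2 * (y * 2 ^ d)..<2 * (Suc y * 2 ^ d)}. mu s k (Suc (r + d)) i)"
    by (simp only: sum_double)
  finally show ?case by (simp add: mult_ac)
qed simp

lemma power_mult_power: "x * y = 1 \<Longrightarrow> x ^ d * y ^ d = 1" for x y :: alg
proof (induction d)
  case (Suc d)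
  have "x ^ Suc d * y ^ Suc d = x ^ d * (x * y) * y ^ d"
    by (simp only: power_Suc2[of x] power_Suc[of y] mult.assoc)
  then show ?case using Suc by simp
qed simp

lemmas phi_psi_power = power_mult_power[OF phi_psi] power_mult_power[OF psi_phi]

lemma mu_refine_left_phi: "(\<Sum>i\<in>block d x. mu (r + d) i s k) = phi ^ d * mu r x s k"
  by (simp add: mu_refine_left_block[of r x s k d] mult.assoc[symmetric] phi_psi_power)

lemma mu_refine_right_phi: "mu s k r y = (1/2) ^ d *\<^sub>R (phi ^ d * (\<Sum>i\<in>block d y. mu s k (r + d) i))"
proof -
  have "mu s k r y = phi ^ d * (psi ^ d * mu s k r y)" by (simp add: mult.assoc[symmetric] phi_psi_power)
  then show ?thesis unfolding mu_refine_right_block by simp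
qed

text \<open>The factor \<open>g\<close>, later \<open>fcen n\<close>, brings the matrix units into
  \<open>radalg\<close>. Summing over \<open>k\<close> yields \<open>m\<close> equal products
  \<open>mu r i r i\<close>, whence the division by \<open>m\<close>.\<close>

definition diag :: "nat \<Rightarrow> nat \<Rightarrow> alg \<Rightarrow> (alg \<Rightarrow> alg \<Rightarrow> complex) \<Rightarrow> complex"
  where "diag r m g B = (\<Sum>i<m. \<Sum>k<m. B (g * mu r i 0 k) (g * mu 0 k r i)) / of_nat m"

text \<open>For \<open>i \<noteq> j\<close>, toggling the membership of \<open>i\<close> is an
  involution that reverses the sign of the summand.\<close>

lemma sign_orthogonality:
  assumes "i < m" "j < m"
  shows "(\<Sum>S\<in>Pow {..<m}. (if i \<in> S then 1 else - 1) * (if j \<in> S then 1 else - 1)) =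
    (if i = j then 2 ^ m else 0 :: complex)"
proof (cases "i = j")
  case True
  then have "(\<Sum>S\<in>Pow {..<m}. (if i \<in> S then 1 else - 1) * (if j \<in> S then 1 else - 1)) = (\<Sum>S\<in>Pow {..<m}. 1 :: complex)"
    by (intro sum.cong) auto
  then show ?thesis using True by (simp add: card_Pow)
next
  case False
  let ?f = "\<lambda>S. (if i \<in> S then 1 else - 1) * (if j \<in> S then 1 else - 1) :: complex"
  define h where "h = (\<lambda>S. if i \<in> S then S - {i} else insert i S)"
  have "sum ?f (Pow {..<m}) = (\<Sum>S\<in>Pow {..<m}. ?f (h S))"
    by (rule sum.reindex_bij_witness[of _ h h]) (use assms in \<open>auto simp: h_def\<close>)
  also have "\<dots> = - sum ?f (Pow {..<m})"
    unfolding sum_negf[symmetric] by (rule sum.cong) (use False in \<open>auto simp: h_def\<close>)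
  finally show ?thesis using False by simp
qed

text \<open>\<^const>\<open>diag\<close> is a mean, over all sign changes and cyclic shifts, of values of \<open>B\<close> at
  elementary tensors of partial isometries (times \<open>g\<close>).\<close>

lemma diag_bound:
  assumes B: "bilin K B" and g: "\<And>r i r' k. g * mu r i r' k \<in> radalg"
  shows "cmod (diag r m g B) \<le> K * (norm g)\<^sup>2"
proof (cases "m = 0")
  case True
  then show ?thesis using bilin_nonneg[OF B] by (simp add: diag_def)
next
  case False
  define sg where "sg = (\<lambda>S (i::nat). if i \<in> S then 1 else - 1 :: complex)"
  \<comment> \<open>For each sign pattern \<open>S\<close> and shift \<open>a\<close>, the partial
    isometries \<open>u S a\<close> and \<open>v S a\<close> are inverse to each other between the
    first \<open>m\<close> cells of level \<open>r\<close> and those of level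
    \<open>0\<close>.\<close>
  define u where "u = (\<lambda>S a. \<Sum>i<m. (if i \<in> S then 1 else - 1) * mu r i 0 ((i + a) mod m))"
  define v where "v = (\<lambda>S a. \<Sum>i<m. (if i \<in> S then 1 else - 1) * mu 0 ((i + a) mod m) r i)"
  have inj: "inj_on (\<lambda>i. (i + a) mod m) {..<m}" for a
  proof (rule inj_onI)
    have "(i + a) mod m = (if i + a mod m < m then i + a mod m else i + a mod m - m)" if "i < m" for i
    proof -
      have "(i + a) mod m = (i + a mod m) mod m" by (simp add: mod_add_right_eq)
      also have "\<dots> = (if i + a mod m < m then i + a mod m else i + a mod m - m)"
      proof -
        have "i + a mod m - m < m" if "\<not> i + a mod m < m"
          using \<open>i < m\<close> that mod_less_divisor[of m a] False by linarith
        then show ?thesis by (simp add: mod_if[of "i + a mod m"])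
      qed
      finally show ?thesis .
    qed
    moreover fix i j assume "i \<in> {..<m}" "j \<in> {..<m}" "(i + a) mod m = (j + a) mod m"
    ultimately show "i = j" by (auto split: if_splits)
  qed
  have nu: "norm (u S a) \<le> 1" "norm (v S a) \<le> 1" for S a
    unfolding u_def v_def using norm_mu_sum[OF inj_on_id2 inj] norm_mu_sum[OF inj inj_on_id2] by auto
  have gu: "g * u S a = (\<Sum>i<m. scaleC (sg S i) (g * mu r i 0 ((i + a) mod m)))"
      "g * v S a = (\<Sum>i<m. scaleC (sg S i) (g * mu 0 ((i + a) mod m) r i))" for S a
    unfolding u_def v_def sum_distrib_left by (rule sum.cong; simp add: sg_def scaleC_simps)+
  have gR: "g * u S a \<in> radalg" "g * v S a \<in> radalg" for S a
    unfolding gu by (intro radalg_sum radalg_scaleC g)+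
  have Buv: "B (g * u S a) (g * v S a) =
      (\<Sum>i<m. \<Sum>j<m. sg S i * sg S j * B (g * mu r i 0 ((i + a) mod m)) (g * mu 0 ((j + a) mod m) r j))" for S a
    unfolding gu
    by (subst bilin_sum(1)[OF B]; (intro radalg_sum radalg_scaleC g)?)
      (simp add: bilin_sum(2)[OF B] bilinD(4,5)[OF B] radalg_scaleC g sum_distrib_left mult_ac)
  have shift: "(\<Sum>a<m. B (g * mu r i 0 ((i + a) mod m)) (g * mu 0 ((i + a) mod m) r i)) =
      (\<Sum>k<m. B (g * mu r i 0 k) (g * mu 0 k r i))" for i
  proof -
    have "bij_betw (\<lambda>a. (i + a) mod m) {..<m} {..<m}"
    proof -
      have "inj_on (\<lambda>a. (i + a) mod m) {..<m}" using inj[of i] by (simp add: add.commute)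
      moreover from this have "(\<lambda>a. (i + a) mod m) ` {..<m} = {..<m}"
        using False by (intro endo_inj_surj) auto
      ultimately show ?thesis by (simp add: bij_betw_def)
    qed
    then show ?thesis by (rule sum.reindex_bij_betw)
  qed
  \<comment> \<open>Summing over the signs kills the terms with \<open>i \<noteq> j\<close>; summing
    over the shifts then lets \<open>(i + a) mod m\<close> run freely through all
    \<open>k\<close>.\<close>
  have "(\<Sum>S\<in>Pow {..<m}. \<Sum>a<m. B (g * u S a) (g * v S a)) =
      (\<Sum>a<m. \<Sum>i<m. \<Sum>j<m. \<Sum>S\<in>Pow {..<m}. sg S i * sg S j * B (g * mu r i 0 ((i + a) mod m)) (g * mu 0 ((j + a) mod m) r j))"
    unfolding Buv
    by (subst sum.swap, rule sum.cong, simp, subst sum.swap, rule sum.cong, simp, rule sum.swap)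
  also have "\<dots> = (\<Sum>a<m. \<Sum>i<m. \<Sum>j<m. (if i = j then 2 ^ m else 0) *
      B (g * mu r i 0 ((i + a) mod m)) (g * mu 0 ((j + a) mod m) r j))"
    unfolding sum_distrib_right[symmetric] sg_def by (intro sum.cong refl) (simp add: sign_orthogonality)
  also have "\<dots> = (\<Sum>a<m. \<Sum>i<m. 2 ^ m * B (g * mu r i 0 ((i + a) mod m)) (g * mu 0 ((i + a) mod m) r i))"
    by (intro sum.cong refl) (simp add: if_distrib[of "\<lambda>x. x * _"] cong: if_cong)
  also have "\<dots> = 2 ^ m * (\<Sum>i<m. \<Sum>k<m. B (g * mu r i 0 k) (g * mu 0 k r i))"
    by (subst sum.swap) (simp add: sum_distrib_left[symmetric] shift)
  finally have eq: "(\<Sum>S\<in>Pow {..<m}. \<Sum>a<m. B (g * u S a) (g * v S a)) = 2 ^ m * of_nat m * diag r m g B"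
    using False by (simp add: diag_def)
  have "cmod (B (g * u S a) (g * v S a)) \<le> K * (norm g)\<^sup>2" for S a
  proof -
    have "norm (g * u S a) \<le> norm g" "norm (g * v S a) \<le> norm g"
      using norm_mult_ineq[of g "u S a"] norm_mult_ineq[of g "v S a"]
        mult_left_mono[OF nu(1), of "norm g" S a] mult_left_mono[OF nu(2), of "norm g" S a] by simp_all
    then have "K * norm (g * u S a) * norm (g * v S a) \<le> K * norm g * norm g"
      by (intro mult_mono mult_left_mono mult_nonneg_nonneg bilin_nonneg[OF B]) auto
    then show ?thesis using bilinD(1)[OF B gR[of S a]] by (simp add: power2_eq_square mult.assoc)
  qed
  then have "cmod (\<Sum>S\<in>Pow {..<m}. \<Sum>a<m. B (g * u S a) (g * v S a)) \<le> (\<Sum>S\<in>Pow {..<m}. \<Sum>a<m. K * (norm g)\<^sup>2)"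
    by (intro sum_norm_le)
  also have "\<dots> = 2 ^ m * real m * (K * (norm g)\<^sup>2)" by (simp add: card_Pow)
  finally have "2 ^ m * real m * cmod (diag r m g B) \<le> 2 ^ m * real m * (K * (norm g)\<^sup>2)"
    unfolding eq by (simp add: norm_mult norm_power)
  then show ?thesis using False by (subst (asm) mult_le_cancel_left_pos) auto
qed

text \<open>The diagonal of level \<open>r + d\<close> multiplied by \<open>mu r x r y\<close> from
  either side, see \<open>diag_left\<close> and \<open>diag_right\<close>; \<open>d\<close> survives
  only as an exponent.\<close>

definition inner_diag :: "nat \<Rightarrow> nat \<Rightarrow> nat \<Rightarrow> nat \<Rightarrow> alg \<Rightarrow> nat \<Rightarrow> (alg \<Rightarrow> alg \<Rightarrow> complex) \<Rightarrow> complex"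
  where "inner_diag r x y m g d B =
    (\<Sum>k<m. B (g * (phi ^ d * mu r x 0 k)) (g * (psi ^ d * mu 0 k r y))) / of_nat m"

lemma multiplier_power: "multiplier x \<Longrightarrow> multiplier (x ^ d)"
  by (induction d) (auto intro: multiplier_simps)

lemma central_left: "(\<And>F. x * F = F * x) \<Longrightarrow> G * (x * H) = x * (G * H)" for x :: alg
  by (metis mult.assoc)

text \<open>With the source of \<open>mu r x r y\<close> refined to level \<open>r + d\<close>, only
  the \<open>i\<close> inside cell \<open>y\<close> survive, each giving
  \<open>phi ^ d * mu r x 0 k\<close>. The factors \<open>(1/2) ^ d\<close> then average the second
  components into \<open>psi ^ d * mu 0 k r y\<close>. The bound on \<open>m\<close> puts all these
  cells among the summation indices.\<close>

lemma diag_left: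
  assumes B: "bilin K B" and g: "\<And>r i r' k. g * mu r i r' k \<in> radalg" "\<And>F. g * F = F * g"
    and m: "Suc y * 2 ^ d \<le> m"
  shows "diag (r + d) m g (\<lambda>p q. B (mu r x r y * p) q) = inner_diag r x y m g d B"
proof -
  note phi = central_power[of phi, OF phi_central] and psi = central_power[of psi, OF psi_central]
  have gphi: "g * (phi ^ d * mu r i r' k) \<in> radalg" for r i r' k
    unfolding central_left[OF phi] by (intro multiplierD multiplier_power multiplier_phi g)
  have blk: "block d y \<subseteq> {..<m}" using m by auto
  have e: "mu r x r y * (g * mu (r + d) i 0 k) =
      (if i \<in> block d y then (1/2) ^ d *\<^sub>R (g * (phi ^ d * mu r x 0 k)) else 0)" for i k
  proof -
    have "mu r x r y * mu (r + d) i 0 k = (1/2) ^ d *\<^sub>R (phi ^ d * (\<Sum>j\<in>block d y. mu r x (r + d) j * mu (r + d) i 0 k))"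
      by (subst mu_refine_right_phi[of r x r y d]) (simp add: mult.assoc sum_distrib_right)
    also have "\<dots> = (if i \<in> block d y then (1/2) ^ d *\<^sub>R (phi ^ d * mu r x 0 k) else 0)"
      by (simp add: mu_mult)
    finally show ?thesis by (simp only: central_left[OF g(2), of "mu r x r y"]) simp
  qed
  have "(\<Sum>i<m. B (mu r x r y * (g * mu (r + d) i 0 k)) (g * mu 0 k (r + d) i)) =
      B (g * (phi ^ d * mu r x 0 k)) (g * (psi ^ d * mu 0 k r y))" for k
  proof -
    have "(\<Sum>i<m. B (mu r x r y * (g * mu (r + d) i 0 k)) (g * mu 0 k (r + d) i)) =
        (\<Sum>i\<in>block d y. B (mu r x r y * (g * mu (r + d) i 0 k)) (g * mu 0 k (r + d) i))"
      using blk bilin_zero[OF B g(1)] by (intro sum.mono_neutral_right) (auto simp: e)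
    also have "\<dots> = (\<Sum>i\<in>block d y. B (g * (phi ^ d * mu r x 0 k)) ((1/2) ^ d *\<^sub>R (g * mu 0 k (r + d) i)))"
      by (intro sum.cong refl) (simp add: e bilinD(6,7)[OF B gphi g(1)])
    also have "\<dots> = B (g * (phi ^ d * mu r x 0 k)) (\<Sum>i\<in>block d y. (1/2) ^ d *\<^sub>R (g * mu 0 k (r + d) i))"
      by (intro bilin_sum(2)[OF B, symmetric] gphi radalg_scaleR g)
    also have "(\<Sum>i\<in>block d y. (1/2) ^ d *\<^sub>R (g * mu 0 k (r + d) i)) = g * (psi ^ d * mu 0 k r y)"
      unfolding mu_refine_right_block by (simp add: sum_distrib_left scaleR_sum_right)
    finally show ?thesis .
  qed
  then show ?thesis unfolding diag_def inner_diag_def by (subst sum.swap) simp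
qed

text \<open>Here the target is refined: the \<open>i\<close> inside cell \<open>x\<close> survive,
  the second component becomes \<open>psi ^ d * mu 0 k r y\<close> at once, and the first ones add
  up to \<open>phi ^ d * mu r x 0 k\<close>. This agrees with \<open>diag_left\<close>, so for large
  \<open>m\<close> the matrix unit commutes with the diagonal exactly.\<close>

lemma diag_right:
  assumes B: "bilin K B" and g: "\<And>r i r' k. g * mu r i r' k \<in> radalg" "\<And>F. g * F = F * g"
    and m: "Suc x * 2 ^ d \<le> m"
  shows "diag (r + d) m g (\<lambda>p q. B p (q * mu r x r y)) = inner_diag r x y m g d B"
proof -
  note phi = central_power[of phi, OF phi_central] and psi = central_power[of psi, OF psi_central]
  have gpsi: "g * (psi ^ d * mu r i r' k) \<in> radalg" for r i r' k
    unfolding central_left[OF psi] by (intro multiplierD multiplier_power multiplier_coef coef_psi g)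
  have blk: "block d x \<subseteq> {..<m}" using m by auto
  have e: "(g * mu 0 k (r + d) i) * mu r x r y = (if i \<in> block d x then g * (psi ^ d * mu 0 k r y) else 0)" for i k
  proof -
    have "mu 0 k (r + d) i * mu r x r y = psi ^ d * (\<Sum>j\<in>block d x. mu 0 k (r + d) i * mu (r + d) j r y)"
      by (subst mu_refine_left_block[of r x r y d]) (simp add: central_left[OF psi] sum_distrib_left[symmetric])
    also have "\<dots> = (if i \<in> block d x then psi ^ d * mu 0 k r y else 0)"
      by (simp add: mu_mult)
    finally show ?thesis by (simp add: mult.assoc)
  qed
  have "(\<Sum>i<m. B (g * mu (r + d) i 0 k) ((g * mu 0 k (r + d) i) * mu r x r y)) =
      B (g * (phi ^ d * mu r x 0 k)) (g * (psi ^ d * mu 0 k r y))" for k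
  proof -
    have "(\<Sum>i<m. B (g * mu (r + d) i 0 k) ((g * mu 0 k (r + d) i) * mu r x r y)) =
        (\<Sum>i\<in>block d x. B (g * mu (r + d) i 0 k) ((g * mu 0 k (r + d) i) * mu r x r y))"
      using blk bilin_zero[OF B g(1)] by (intro sum.mono_neutral_right) (auto simp: e)
    also have "\<dots> = (\<Sum>i\<in>block d x. B (g * mu (r + d) i 0 k) (g * (psi ^ d * mu 0 k r y)))"
      by (intro sum.cong refl) (simp add: e)
    also have "\<dots> = B (\<Sum>i\<in>block d x. g * mu (r + d) i 0 k) (g * (psi ^ d * mu 0 k r y))"
      by (intro bilin_sum(1)[OF B, symmetric] gpsi g)
    also have "(\<Sum>i\<in>block d x. g * mu (r + d) i 0 k) = g * (phi ^ d * mu r x 0 k)"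
      unfolding mu_refine_left_phi[symmetric] by (simp add: sum_distrib_left)
    finally show ?thesis .
  qed
  then show ?thesis unfolding diag_def inner_diag_def by (subst sum.swap) simp
qed

text \<open>So many cells of any level below \<open>2 * n\<close> cover the interval from
  \<open>0\<close> to \<open>n\<close>, as \<open>4 ^ n = 2 ^ (2 * n)\<close>.\<close>

definition cells :: "nat \<Rightarrow> nat" where "cells n = n * 4 ^ n"

text \<open>Levels from \<open>n\<close> on eventually exceed that of any given matrix unit, and
  having \<open>n\<close> of them makes bounded boundary terms of a telescoping sum
  negligible.\<close>

definition mean_diag :: "nat \<Rightarrow> (alg \<Rightarrow> alg \<Rightarrow> complex) \<Rightarrow> complex"
  where "mean_diag n B = (\<Sum>r\<in>{n..<2 * n}. diag r (cells n) (fcen n) B) / of_nat n"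

text \<open>Uniform in \<open>d\<close> although the powers \<open>phi ^ d\<close> are not bounded:
  the value is that of the diagonal multiplied by \<open>mu r x r y\<close>, to which
  \<open>diag_bound\<close> applies.\<close>

lemma inner_diag_bound:
  assumes B: "bilin K B" and g: "\<And>r i r' k. g * mu r i r' k \<in> radalg" "\<And>F. g * F = F * g"
    and m: "Suc y * 2 ^ d \<le> m"
  shows "cmod (inner_diag r x y m g d B) \<le> K * (norm (mu r x r y) * (norm g)\<^sup>2)"
  unfolding diag_left[OF B g m, symmetric]
  using diag_bound[OF bilin_left(1)[OF B multiplier_mu] g(1)] by (simp add: mult.assoc)

lemma inner_diag_cong:
  assumes "\<And>a b. a \<in> radalg \<Longrightarrow> b \<in> radalg \<Longrightarrow> B a b = B' a b"
    and g: "\<And>r i r' k. g * mu r i r' k \<in> radalg"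
  shows "inner_diag r x y m g d B = inner_diag r x y m g d B'"
proof -
  note phi = central_power[of phi, OF phi_central] and psi = central_power[of psi, OF psi_central]
  have "g * (phi ^ d * mu r i r' k) \<in> radalg" "g * (psi ^ d * mu r i r' k) \<in> radalg" for r i r' k
    unfolding central_left[OF phi] central_left[OF psi]
    by (intro multiplierD multiplier_power multiplier_phi multiplier_coef coef_psi g)+
  then show ?thesis unfolding inner_diag_def by (simp add: assms(1))
qed

lemma inner_diag_phi:
  assumes g: "\<And>F. g * F = F * g"
  shows "inner_diag r x y m g d (\<lambda>p q. B (phi * p) q) = inner_diag r x y m g (Suc d) (\<lambda>p q. B p (phi * q))"
proof -
  have "phi * (g * (phi ^ d * F)) = g * (phi ^ Suc d * F)" for F
    by (simp only: central_left[OF phi_central, of g, symmetric] power_Suc mult.assoc)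
  moreover have "phi * (g * (psi ^ Suc d * F)) = g * (psi ^ d * F)" for F
  proof -
    have "phi * (g * (psi ^ Suc d * F)) = g * (phi * (psi ^ Suc d * F))"
      by (rule central_left[OF phi_central, symmetric])
    also have "phi * (psi ^ Suc d * F) = (phi * psi) * (psi ^ d * F)" by (simp only: power_Suc mult.assoc)
    finally show ?thesis by (simp add: phi_psi)
  qed
  ultimately show ?thesis by (simp add: inner_diag_def)
qed

lemma inner_diag_psi:
  assumes g: "\<And>F. g * F = F * g"
  shows "inner_diag r x y m g (Suc d) (\<lambda>p q. B (psi * p) q) = inner_diag r x y m g d (\<lambda>p q. B p (psi * q))"
proof -
  have "psi * (g * (psi ^ d * F)) = g * (psi ^ Suc d * F)" for F
    by (simp only: central_left[OF psi_central, of g, symmetric] power_Suc mult.assoc)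
  moreover have "psi * (g * (phi ^ Suc d * F)) = g * (phi ^ d * F)" for F
  proof -
    have "psi * (g * (phi ^ Suc d * F)) = g * (psi * (phi ^ Suc d * F))"
      by (rule central_left[OF psi_central, symmetric])
    also have "psi * (phi ^ Suc d * F) = (psi * phi) * (phi ^ d * F)" by (simp only: power_Suc mult.assoc)
    finally show ?thesis by (simp add: psi_phi)
  qed
  ultimately show ?thesis by (simp add: inner_diag_def)
qed

text \<open>The degrees telescope: moving \<^const>\<open>phi\<close> or \<^const>\<open>psi\<close> across the tensor sign
  shifts \<open>d\<close> by one.\<close>

definition telescopes :: "real \<Rightarrow> alg \<Rightarrow> bool"
  where "telescopes L c \<longleftrightarrow> (\<forall>K B N1 N2 m r x y g. bilin K B \<longrightarrow> (\<forall>r i r' k. g * mu r i r' k \<in> radalg) \<longrightarrow> (\<forall>F. g * F = F * g) \<longrightarrow>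
    0 < N1 \<longrightarrow> N1 \<le> N2 \<longrightarrow> Suc y * 2 ^ N2 \<le> m \<longrightarrow>
    cmod (\<Sum>d\<in>{N1..<N2}. inner_diag r x y m g d (\<lambda>p q. B (c * p) q) - inner_diag r x y m g d (\<lambda>p q. B p (c * q)))
      \<le> L * (K * (norm (mu r x r y) * (norm g)\<^sup>2)))"

text \<open>For \<open>phi\<close> and \<open>psi\<close> the sum telescopes, and
  \<open>inner_diag_bound\<close> controls the two boundary terms; the remaining monomials are
  reduced to these.\<close>

lemma telescope:
  assumes "c \<in> coef"
  shows "\<exists>L\<ge>0. telescopes L c"
proof -
  have mono: "Suc y * 2 ^ d \<le> m" if "Suc y * 2 ^ N2 \<le> m" "d \<le> N2" for y d N2 m :: nat
    using that by (meson le_trans mult_le_mono2 one_le_numeral power_increasing)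
  have "telescopes (2 * norm phi) phi"
    unfolding telescopes_def
  proof (intro allI impI)
    fix K :: real and B :: "alg \<Rightarrow> alg \<Rightarrow> complex" and N1 N2 m r x y :: nat and g
    assume B: "bilin K B" and g: "\<forall>r i r' k. g * mu r i r' k \<in> radalg" "\<forall>F. g * F = F * g"
      and N: "0 < N1" "N1 \<le> N2" and m: "Suc y * 2 ^ N2 \<le> m"
    let ?T = "\<lambda>d. inner_diag r x y m g d (\<lambda>p q. B p (phi * q))"
    have b: "cmod (?T d) \<le> K * norm phi * (norm (mu r x r y) * (norm g)\<^sup>2)" if "d \<le> N2" for d
      by (rule inner_diag_bound[OF bilin_central[OF B multiplier_phi phi_central]]) (use g mono[OF m that] in auto)
    have "(\<Sum>d\<in>{N1..<N2}. inner_diag r x y m g d (\<lambda>p q. B (phi * p) q) - ?T d) = (\<Sum>d\<in>{N1..<N2}. ?T (Suc d) - ?T d)"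
      using g(2) by (simp add: inner_diag_phi)
    also have "\<dots> = ?T N2 - ?T N1" by (rule sum_Suc_diff'[OF N(2)])
    also have "cmod \<dots> \<le> cmod (?T N2) + cmod (?T N1)" by (rule norm_triangle_ineq4)
    also have "\<dots> \<le> (2 * norm phi) * (K * (norm (mu r x r y) * (norm g)\<^sup>2))"
      using b[of N1] b[of N2] N by (simp add: mult_ac)
    finally show "cmod (\<Sum>d\<in>{N1..<N2}. inner_diag r x y m g d (\<lambda>p q. B (phi * p) q) - ?T d)
        \<le> (2 * norm phi) * (K * (norm (mu r x r y) * (norm g)\<^sup>2))" .
  qed
  then have phi_sum: "\<exists>L\<ge>0. telescopes L phi" by (intro exI[of _ "2 * norm phi"]) simp
  have "telescopes (2 * norm psi) psi"
    unfolding telescopes_def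
  proof (intro allI impI)
    fix K :: real and B :: "alg \<Rightarrow> alg \<Rightarrow> complex" and N1 N2 m r x y :: nat and g
    assume B: "bilin K B" and g: "\<forall>r i r' k. g * mu r i r' k \<in> radalg" "\<forall>F. g * F = F * g"
      and N: "0 < N1" "N1 \<le> N2" and m: "Suc y * 2 ^ N2 \<le> m"
    let ?T = "\<lambda>d. inner_diag r x y m g d (\<lambda>p q. B p (psi * q))"
    \<comment> \<open>Truncated subtraction is harmless in the sum because
      \<open>0 < N1\<close>.\<close>
    let ?S = "\<lambda>d. - ?T (d - 1)"
    have b: "cmod (?T d) \<le> K * norm psi * (norm (mu r x r y) * (norm g)\<^sup>2)" if "d \<le> N2" for d
      by (rule inner_diag_bound[OF bilin_central[OF B multiplier_coef[OF coef_psi] psi_central]])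
        (use g mono[OF m that] in auto)
    have "inner_diag r x y m g d (\<lambda>p q. B (psi * p) q) = ?T (d - 1)" if "d \<in> {N1..<N2}" for d
      using inner_diag_psi[of g r x y m "d - 1" B] g(2) that N(1) by simp
    then have "(\<Sum>d\<in>{N1..<N2}. inner_diag r x y m g d (\<lambda>p q. B (psi * p) q) - ?T d) = (\<Sum>d\<in>{N1..<N2}. ?S (Suc d) - ?S d)"
      by simp
    also have "\<dots> = ?S N2 - ?S N1" by (rule sum_Suc_diff'[OF N(2)])
    also have "cmod \<dots> \<le> cmod (?S N2) + cmod (?S N1)" by (rule norm_triangle_ineq4)
    also have "\<dots> \<le> (2 * norm psi) * (K * (norm (mu r x r y) * (norm g)\<^sup>2))"
    proof -
      have "N1 - 1 \<le> N2" "N2 - 1 \<le> N2" using N by linarith+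
      from this[THEN b] show ?thesis by (simp add: mult_ac)
    qed
    finally show "cmod (\<Sum>d\<in>{N1..<N2}. inner_diag r x y m g d (\<lambda>p q. B (psi * p) q) - ?T d)
        \<le> (2 * norm psi) * (K * (norm (mu r x r y) * (norm g)\<^sup>2))" .
  qed
  then have psi_sum: "\<exists>L\<ge>0. telescopes L psi" by (intro exI[of _ "2 * norm psi"]) simp
  have vee_sum: "\<exists>L\<ge>0. telescopes L vee"
  proof -
    obtain L where L: "0 \<le> L" "telescopes L phi" using phi_sum by blast
    \<comment> \<open>As \<open>phi = 1 + vee\<close>, both forms change by the same summand
      \<open>B p q\<close>, so \<open>vee\<close> and \<open>phi\<close> have the same commutator
      with the diagonal.\<close>
    have eq: "inner_diag r x y m g d (\<lambda>p q. B (vee * p) q) - inner_diag r x y m g d (\<lambda>p q. B p (vee * q)) =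
        inner_diag r x y m g d (\<lambda>p q. B (phi * p) q) - inner_diag r x y m g d (\<lambda>p q. B p (phi * q))"
      if B: "bilin K B" and g: "\<forall>r i r' k. g * mu r i r' k \<in> radalg" for K B g r x y m d
    proof -
      have 1: "inner_diag r x y m g d (\<lambda>p q. B (phi * p) q) = inner_diag r x y m g d (\<lambda>p q. B p q + B (vee * p) q)"
        by (rule inner_diag_cong)
          (use g in \<open>auto simp: phi_def distrib_right bilinD(2)[OF B] radalg_coef coef_vee\<close>)
      have 2: "inner_diag r x y m g d (\<lambda>p q. B p (phi * q)) = inner_diag r x y m g d (\<lambda>p q. B p q + B p (vee * q))"
        by (rule inner_diag_cong)
          (use g in \<open>auto simp: phi_def distrib_right bilinD(3)[OF B] radalg_coef coef_vee\<close>)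
      show ?thesis unfolding 1 2 by (simp add: inner_diag_def sum.distrib add_divide_distrib)
    qed
    have "telescopes L vee"
      unfolding telescopes_def
    proof (intro allI impI)
      fix K :: real and B :: "alg \<Rightarrow> alg \<Rightarrow> complex" and N1 N2 m r x y :: nat and g
      assume *: "bilin K B" "\<forall>r i r' k. g * mu r i r' k \<in> radalg" "\<forall>F. g * F = F * g"
        "0 < N1" "N1 \<le> N2" "Suc y * 2 ^ N2 \<le> m"
      show "cmod (\<Sum>d\<in>{N1..<N2}. inner_diag r x y m g d (\<lambda>p q. B (vee * p) q) - inner_diag r x y m g d (\<lambda>p q. B p (vee * q)))
          \<le> L * (K * (norm (mu r x r y) * (norm g)\<^sup>2))"
        unfolding eq[OF *(1,2)] using L(2)[unfolded telescopes_def] * by blast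
    qed
    then show ?thesis using L(1) by blast
  qed
  \<comment> \<open>The factor \<open>c\<close> is moved across the tensor sign under the form
    \<open>B (h * p) q\<close>, and then \<open>h\<close> under the form \<open>B p (c * q)\<close>;
    hence the two constants.\<close>
  have step: "\<exists>L\<ge>0. telescopes L (h * c)" if h: "\<exists>L\<ge>0. telescopes L h" and c: "\<exists>L\<ge>0. telescopes L c" and hc: "h \<in> coef" "c \<in> coef" for h c
  proof -
    obtain L1 L2 where L: "0 \<le> L1" "telescopes L1 h" "0 \<le> L2" "telescopes L2 c" using h c by blast
    have "telescopes (L2 * norm h + L1 * norm c) (h * c)"
      unfolding telescopes_def
    proof (intro allI impI)
      fix K :: real and B :: "alg \<Rightarrow> alg \<Rightarrow> complex" and N1 N2 m r x y :: nat and g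
      assume B: "bilin K B" and g: "\<forall>r i r' k. g * mu r i r' k \<in> radalg" "\<forall>F. g * F = F * g"
        and N: "0 < N1" "N1 \<le> N2" and m: "Suc y * 2 ^ N2 \<le> m"
      let ?I = "\<lambda>d. inner_diag r x y m g d" let ?C = "norm (mu r x r y) * (norm g)\<^sup>2"
      have 1: "cmod (\<Sum>d\<in>{N1..<N2}. ?I d (\<lambda>p q. B (h * (c * p)) q) - ?I d (\<lambda>p q. B (h * p) (c * q))) \<le> L2 * (K * norm h * ?C)"
        using L(4)[unfolded telescopes_def] bilin_left(1)[OF B multiplier_coef[OF hc(1)]] g N m by blast
      have 2: "cmod (\<Sum>d\<in>{N1..<N2}. ?I d (\<lambda>p q. B (h * p) (c * q)) - ?I d (\<lambda>p q. B p (c * (h * q)))) \<le> L1 * (K * norm c * ?C)"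
        using L(2)[unfolded telescopes_def] bilin_central[OF B multiplier_coef[OF hc(2)] coef_central[OF hc(2)]] g N m by blast
      have "c * (h * q) = h * c * q" for q by (simp add: mult.assoc[symmetric] coef_central[OF hc(1), of c])
      then have "(\<Sum>d\<in>{N1..<N2}. ?I d (\<lambda>p q. B (h * c * p) q) - ?I d (\<lambda>p q. B p (h * c * q))) =
          (\<Sum>d\<in>{N1..<N2}. ?I d (\<lambda>p q. B (h * (c * p)) q) - ?I d (\<lambda>p q. B (h * p) (c * q))) +
          (\<Sum>d\<in>{N1..<N2}. ?I d (\<lambda>p q. B (h * p) (c * q)) - ?I d (\<lambda>p q. B p (c * (h * q))))"
        by (simp add: sum.distrib[symmetric] mult.assoc)
      then show "cmod (\<Sum>d\<in>{N1..<N2}. ?I d (\<lambda>p q. B (h * c * p) q) - ?I d (\<lambda>p q. B p (h * c * q)))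
          \<le> (L2 * norm h + L1 * norm c) * (K * ?C)"
        using norm_triangle_le[OF add_mono[OF 1 2]] by (simp add: algebra_simps)
    qed
    then show ?thesis using L(1,3) by (intro exI[of _ "L2 * norm h + L1 * norm c"]) simp
  qed
  show ?thesis
    using assms
  proof (induction rule: coef.induct)
    case one
    have "telescopes 0 1" by (simp add: telescopes_def)
    then show ?case by blast
  next
    case (vee c)
    then show ?case using step[OF vee_sum _ coef_vee] by blast
  next
    case (psi c)
    then show ?case using step[OF psi_sum _ coef_psi] by blast
  qed
qed

section \<open>The averaged diagonal commutes asymptotically with the algebra\<close>

lemma mean_diag_cong:
  assumes "\<And>a b. a \<in> radalg \<Longrightarrow> b \<in> radalg \<Longrightarrow> B a b = B' a b"
  shows "mean_diag n B = mean_diag n B'"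
  unfolding mean_diag_def diag_def by (simp add: assms fcen_mu_radalg)

lemma mean_diag_add: "mean_diag n (\<lambda>p q. B p q + B' p q) = mean_diag n B + mean_diag n B'"
  by (simp add: mean_diag_def diag_def sum.distrib add_divide_distrib)

lemma mean_diag_mult: "mean_diag n (\<lambda>p q. z * B p q) = z * mean_diag n B"
  by (simp add: mean_diag_def diag_def sum_distrib_left)

lemma mean_diag_bound:
  assumes B: "bilin K B"
  shows "cmod (mean_diag n B) \<le> 4 * K"
proof (cases "n = 0")
  case False
  have "cmod (diag r (cells n) (fcen n) B) \<le> 4 * K" for r
  proof -
    have "(norm (fcen n))\<^sup>2 \<le> 2\<^sup>2" by (intro power_mono norm_fcen) simp
    then have "K * (norm (fcen n))\<^sup>2 \<le> K * 4" using bilin_nonneg[OF B] by (intro mult_left_mono) auto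
    then show ?thesis using diag_bound[OF B fcen_mu_radalg, of r "cells n" n] by simp
  qed
  then have "cmod (\<Sum>r\<in>{n..<2 * n}. diag r (cells n) (fcen n) B) \<le> (\<Sum>r\<in>{n..<2 * n}. 4 * K)"
    by (intro sum_norm_le)
  then show ?thesis using False by (simp add: mean_diag_def norm_divide field_simps)
qed (use bilin_nonneg[OF B] in \<open>simp add: mean_diag_def\<close>)

lemma cells_large:
  assumes "x < n" "r \<le> n" "d \<le> 2 * n - r"
  shows "Suc x * 2 ^ d \<le> cells n"
proof -
  have "2 ^ d \<le> (2 :: nat) ^ (2 * n)" using assms by (intro power_increasing) auto
  also have "\<dots> = 4 ^ n" by (simp add: power_mult)
  finally show ?thesis unfolding cells_def using assms(1) by (intro mult_le_mono) auto
qed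

text \<open>The matrix unit passes through each diagonal exactly; the central factor
  \<open>vee * c\<close> costs a telescoping sum that is bounded in \<open>n\<close> and gets
  divided by \<open>n\<close>.\<close>

lemma mean_diag_commutes_gen:
  assumes B: "bilin K B" and c: "c \<in> coef"
  shows "(\<lambda>n. mean_diag n (\<lambda>p q. B (vee * c * mu r x r y * p) q) - mean_diag n (\<lambda>p q. B p (q * (vee * c * mu r x r y)))) \<longlonglongrightarrow> 0"
proof -
  define h where "h = vee * c"
  have h: "h \<in> coef" unfolding h_def by (rule coef.vee[OF c])
  let ?e = "mu r x r y"
  obtain L where L: "0 \<le> L" "telescopes L h" using telescope[OF h] by blast
  \<comment> \<open>The one inequality on \<open>n\<close> places the level \<open>r\<close> below
    the averaged levels and the cells \<open>x\<close>, \<open>y\<close> in the range of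
    \<open>cells_large\<close>.\<close>
  have bd: "cmod (mean_diag n (\<lambda>p q. B (h * ?e * p) q) - mean_diag n (\<lambda>p q. B p (q * (h * ?e))))
      \<le> (L * (K * (norm ?e * 4))) * inverse (real n)" if n: "n > r + x + y" for n
  proof -
    let ?I = "inner_diag r x y (cells n) (fcen n)"
    have eq: "diag (r + d) (cells n) (fcen n) (\<lambda>p q. B (h * ?e * p) q) = ?I d (\<lambda>p q. B (h * p) q)"
        "diag (r + d) (cells n) (fcen n) (\<lambda>p q. B p (q * (h * ?e))) = ?I d (\<lambda>p q. B p (h * q))"
      if d: "d < 2 * n - r" for d
    proof -
      show "diag (r + d) (cells n) (fcen n) (\<lambda>p q. B (h * ?e * p) q) = ?I d (\<lambda>p q. B (h * p) q)"
        using diag_left[OF bilin_left(1)[OF B multiplier_coef[OF h]] fcen_mu_radalg[of n] fcen_central,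
            where r = r and x = x and y = y and d = d and m = "cells n"]
          cells_large[of y n r d] n d by (simp add: mult.assoc)
      have "q * (h * ?e) = h * (q * ?e)" for q by (rule central_left[OF coef_central[OF h]])
      then show "diag (r + d) (cells n) (fcen n) (\<lambda>p q. B p (q * (h * ?e))) = ?I d (\<lambda>p q. B p (h * q))"
        using diag_right[OF bilin_central[OF B multiplier_coef[OF h] coef_central[OF h]] fcen_mu_radalg[of n] fcen_central,
            where r = r and x = x and y = y and d = d and m = "cells n"] cells_large[of x n r d] n d by simp
    qed
    have re: "(\<Sum>s\<in>{n..<2 * n}. f s) = (\<Sum>d\<in>{n - r..<2 * n - r}. f (r + d))" for f :: "nat \<Rightarrow> complex"
      by (rule sum.reindex_bij_witness[of _ "\<lambda>d. r + d" "\<lambda>s. s - r"]) (use n in auto)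
    define S where "S = (\<Sum>d\<in>{n - r..<2 * n - r}. ?I d (\<lambda>p q. B (h * p) q) - ?I d (\<lambda>p q. B p (h * q)))"
    have eq': "mean_diag n (\<lambda>p q. B (h * ?e * p) q) - mean_diag n (\<lambda>p q. B p (q * (h * ?e))) =
        S / of_nat n"
      unfolding mean_diag_def re S_def by (simp add: eq diff_divide_distrib[symmetric] sum_subtractf)
    have "cmod S \<le> L * (K * (norm ?e * (norm (fcen n))\<^sup>2))"
      unfolding S_def by (rule L(2)[unfolded telescopes_def, rule_format, OF B]) (use n fcen_mu_radalg fcen_central cells_large[of y n r "2 * n - r"] in auto)
    moreover have "L * (K * (norm ?e * (norm (fcen n))\<^sup>2)) \<le> L * (K * (norm ?e * 2\<^sup>2))"
      by (intro mult_left_mono power_mono norm_fcen norm_ge_zero L(1) bilin_nonneg[OF B])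
    ultimately have "cmod S * inverse (real n) \<le> (L * (K * (norm ?e * 4))) * inverse (real n)"
      by (intro mult_right_mono) auto
    then show ?thesis using eq' by (simp add: norm_mult norm_inverse divide_inverse)
  qed
  have "(\<lambda>n. (L * (K * (norm ?e * 4))) * inverse (real n)) \<longlonglongrightarrow> 0"
    by (rule tendsto_mult_right_zero[OF lim_inverse_n])
  then show ?thesis
    unfolding h_def[symmetric]
    by (rule Lim_null_comparison[rotated]) (use bd in \<open>auto simp: eventually_sequentially intro!: exI[of _ "Suc (r + x + y)"]\<close>)
qed

lemma mean_diag_commutes:
  assumes B: "bilin K B" and a: "a \<in> radalg"
  shows "(\<lambda>n. mean_diag n (\<lambda>p q. B (a * p) q) - mean_diag n (\<lambda>p q. B p (q * a))) \<longlonglongrightarrow> 0"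
proof (rule lim_on_radalg[where C = "8 * K", OF _ _ _ a])
  let ?h = "\<lambda>n a. mean_diag n (\<lambda>p q. B (a * p) q) - mean_diag n (\<lambda>p q. B p (q * a))"
  have add: "?h n (a + scaleC z b) = ?h n a + z * ?h n b" if "a \<in> radalg" "b \<in> radalg" for n a b z
  proof -
    have "mean_diag n (\<lambda>p q. B ((a + scaleC z b) * p) q) = mean_diag n (\<lambda>p q. B (a * p) q + z * B (b * p) q)"
      by (rule mean_diag_cong)
        (use that in \<open>simp add: distrib_right bilinD(2,4)[OF B] radalg_mult radalg_scaleC\<close>)
    moreover have "mean_diag n (\<lambda>p q. B p (q * (a + scaleC z b))) = mean_diag n (\<lambda>p q. B p (q * a) + z * B p (q * b))"
      by (rule mean_diag_cong)
        (use that in \<open>simp add: distrib_left bilinD(3,5)[OF B] radalg_mult radalg_scaleC\<close>)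
    ultimately show ?thesis by (simp add: mean_diag_add mean_diag_mult algebra_simps)
  qed
  show "cmod (?h n a) \<le> 8 * K * norm a" if "a \<in> radalg" for n a
    using mean_diag_bound[OF bilin_left(1)[OF B multiplier_radalg[OF that]], of n]
      mean_diag_bound[OF bilin_left(2)[OF B multiplier_radalg[OF that]], of n]
      norm_triangle_ineq4[of "mean_diag n (\<lambda>p q. B (a * p) q)" "mean_diag n (\<lambda>p q. B p (q * a))"] by simp
  show "?h n (a - b) = ?h n a - ?h n b" if "a \<in> radalg" "b \<in> radalg" for n a b
    using add[OF that, of n "- 1"] by (simp add: scaleC_simps)
  show "(\<lambda>n. ?h n a) \<longlonglongrightarrow> 0" if "a \<in> core" for a
    using that
  proof (induction rule: core.induct)
    case zero
    have "?h n 0 = 0" for n using add[OF radalg_zero radalg_zero, of n 1] by (simp add: scaleC_simps)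
    then show ?case by simp
  next
    case (add a c z r x y)
    have "(\<lambda>n. ?h n a + z * ?h n (vee * c * mu r x r y)) \<longlonglongrightarrow> 0 + z * 0"
      by (intro tendsto_add tendsto_mult_left add mean_diag_commutes_gen[OF B])
    then show ?case
      using \<open>\<And>n a b z. a \<in> radalg \<Longrightarrow> b \<in> radalg \<Longrightarrow> ?h n (a + scaleC z b) = ?h n a + z * ?h n b\<close>[OF radalg_core[OF add.hyps(1)] radalg_core[OF core_gen[OF add.hyps(2)]]]
      by (simp only:) simp
  qed
qed

section \<open>The image of the approximate diagonal under multiplication\<close>

definition mean_unit :: "nat \<Rightarrow> alg"
  where "mean_unit n = (1 / real n) *\<^sub>R (\<Sum>r\<in>{n..<2 * n}. fcen n * (fcen n * (\<Sum>i<cells n. mu r i r i)))"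

lemma mean_unit_radalg: "mean_unit n \<in> radalg"
  unfolding mean_unit_def
  by (auto simp: sum_distrib_left intro!: radalg_scaleR radalg_sum radalg_fcen fcen_mu_radalg)

lemma norm_mean_unit: "norm (mean_unit n) \<le> 4"
proof (cases "n = 0")
  case False
  have "norm (fcen n * (fcen n * (\<Sum>i<cells n. mu r i r i))) \<le> 2 * (2 * 1)" for r
  proof -
    have "norm (\<Sum>i<cells n. mu r i r i) \<le> 1"
      using norm_mu_sum[of "\<lambda>i. i" "cells n" "\<lambda>i. i" "\<lambda>_. True" r r] by simp
    then show ?thesis
      by (intro order_trans[OF norm_mult_ineq] mult_mono norm_fcen) auto
  qed
  then have "norm (\<Sum>r\<in>{n..<2 * n}. fcen n * (fcen n * (\<Sum>i<cells n. mu r i r i))) \<le> (\<Sum>r\<in>{n..<2 * n}. 4)"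
    by (intro sum_norm_le) simp
  then show ?thesis using False by (simp add: mean_unit_def field_simps)
qed (simp add: mean_unit_def)

lemma mean_diag_product:
  assumes add: "\<And>a b. a \<in> radalg \<Longrightarrow> b \<in> radalg \<Longrightarrow> l (a + b) = l a + l b"
    and scale: "\<And>z a. a \<in> radalg \<Longrightarrow> l (scaleC z a) = z * l a"
  shows "mean_diag n (\<lambda>p q. l (p * q)) = (l (mean_unit n) :: complex)"
proof -
  have l0: "l 0 = 0" using scale[OF radalg_zero, of 0] by (simp add: scaleC_simps)
  have ls: "l (\<Sum>i\<in>I. h i) = (\<Sum>i\<in>I. l (h i))" if "\<And>i. i \<in> I \<Longrightarrow> h i \<in> radalg" for I :: "nat set" and h
    using that by (induction I rule: infinite_finite_induct) (auto simp: l0 add radalg_sum)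
  have lr: "l (t *\<^sub>R a) = of_real t * l a" if "a \<in> radalg" for t a
    using scale[OF that, of "of_real t"] by (simp add: scaleC_of_real)
  have ff: "fcen n * (fcen n * mu r i r i) \<in> radalg" for r i by (intro radalg_fcen fcen_mu_radalg)
  have "diag r (cells n) (fcen n) (\<lambda>p q. l (p * q)) = l (fcen n * (fcen n * (\<Sum>i<cells n. mu r i r i)))" if "0 < n" for r
  proof -
    have "fcen n * mu r i 0 k * (fcen n * mu 0 k r i) = fcen n * (fcen n * mu r i r i)" for i k
      using central_left[OF fcen_central, of "mu r i 0 k" n "mu 0 k r i"] by (simp add: mult.assoc mu_mult)
    moreover have "cells n > 0" using that by (simp add: cells_def)
    ultimately have "diag r (cells n) (fcen n) (\<lambda>p q. l (p * q)) = (\<Sum>i<cells n. l (fcen n * (fcen n * mu r i r i)))"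
      by (simp add: diag_def sum_divide_distrib)
    also have "\<dots> = l (fcen n * (fcen n * (\<Sum>i<cells n. mu r i r i)))"
      by (simp add: sum_distrib_left ls ff)
    finally show ?thesis .
  qed
  moreover have "fcen n * (fcen n * (\<Sum>i<cells n. mu r i r i)) \<in> radalg" for r
    by (auto simp: sum_distrib_left intro!: radalg_sum ff)
  ultimately show ?thesis
    unfolding mean_diag_def mean_unit_def
    by (cases "n = 0") (simp_all add: l0 lr ls radalg_sum divide_inverse mult.commute)
qed

lemma average_const: "0 < n \<Longrightarrow> (1 / real n) *\<^sub>R (of_nat n * F) = (F :: alg)"
  by (subst of_real_of_nat_eq[symmetric]) (simp add: of_real_def)

text \<open>Refined to a level \<open>s \<ge> n\<close>, both cells of \<open>mu r x r y\<close> lie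
  among the first \<open>cells n\<close>, on which the sum of the \<open>mu s i s i\<close> is the
  identity; only the two factors \<open>fcen n\<close> remain.\<close>

lemma mean_unit_mu:
  assumes n: "r + x + y < n"
  shows "mean_unit n * mu r x r y = fcen n * (fcen n * mu r x r y)"
    "mu r x r y * mean_unit n = fcen n * (fcen n * mu r x r y)"
proof -
  note psi = central_power[of psi, OF psi_central] and phi = central_power[of phi, OF phi_central]
  have l: "(\<Sum>i<cells n. mu s i s i) * mu r x r y = mu r x r y" and r: "mu r x r y * (\<Sum>i<cells n. mu s i s i) = mu r x r y"
    if s: "s \<in> {n..<2 * n}" for s
  proof -
    define d where "d = s - r"
    have d: "s = r + d" "d \<le> 2 * n - r" using s n by (auto simp: d_def)
    have bx: "block d x \<subseteq> {..<cells n}" and bY: "block d y \<subseteq> {..<cells n}"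
      using cells_large[of x n r d] cells_large[of y n r d] n d by auto
    have "(\<Sum>i<cells n. mu s i s i) * mu s j r y = mu s j r y" if "j < cells n" for j
      using that by (simp add: sum_distrib_right mu_mult)
    then have "(\<Sum>i<cells n. mu s i s i) * (\<Sum>j\<in>block d x. mu s j r y) = (\<Sum>j\<in>block d x. mu s j r y)"
      using bx by (auto simp: sum_distrib_left intro!: sum.cong)
    then show "(\<Sum>i<cells n. mu s i s i) * mu r x r y = mu r x r y"
      unfolding mu_refine_left_block[of r x r y d] central_left[OF psi] d(1) by simp
    have "mu r x s j * (\<Sum>i<cells n. mu s i s i) = mu r x s j" if "j < cells n" for j
      using that by (simp add: sum_distrib_left mu_mult)
    then have "(\<Sum>j\<in>block d y. mu r x s j) * (\<Sum>i<cells n. mu s i s i) = (\<Sum>j\<in>block d y. mu r x s j)"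
      using bY by (auto simp: sum_distrib_right intro!: sum.cong)
    then show "mu r x r y * (\<Sum>i<cells n. mu s i s i) = mu r x r y"
      by (subst (1 2) mu_refine_right_phi[of r x r y d]) (simp add: d(1) mult.assoc)
  qed
  have "fcen n * (fcen n * (\<Sum>i<cells n. mu s i s i)) * mu r x r y = fcen n * (fcen n * mu r x r y)"
      "mu r x r y * (fcen n * (fcen n * (\<Sum>i<cells n. mu s i s i))) = fcen n * (fcen n * mu r x r y)"
    if "s \<in> {n..<2 * n}" for s
    using l[OF that] r[OF that] by (simp_all add: mult.assoc central_left[OF fcen_central, of "mu r x r y"])
  then show "mean_unit n * mu r x r y = fcen n * (fcen n * mu r x r y)"
    "mu r x r y * mean_unit n = fcen n * (fcen n * mu r x r y)"
    using n average_const[of n]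
    by (simp_all add: mean_unit_def sum_distrib_right[of _ _ "mu r x r y"] sum_distrib_left[of "mu r x r y"]
      del: sum_distrib_left sum_distrib_right)
qed

lemma mean_unit_lim:
  assumes a: "a \<in> radalg"
  shows "(\<lambda>n. mean_unit n * a) \<longlonglongrightarrow> a" "(\<lambda>n. a * mean_unit n) \<longlonglongrightarrow> a"
proof -
  have ff: "(\<lambda>n. fcen n * (fcen n * a)) \<longlonglongrightarrow> a" if "a \<in> radalg" for a
  proof -
    have "(\<lambda>n. fcen n * (fcen n * a - a)) \<longlonglongrightarrow> 0"
    proof (rule Lim_null_comparison)
      show "\<forall>\<^sub>F n in sequentially. norm (fcen n * (fcen n * a - a)) \<le> 2 * norm (fcen n * a - a)"
        by (intro always_eventually allI order_trans[OF norm_mult_ineq] mult_right_mono norm_fcen) auto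
      show "(\<lambda>n. 2 * norm (fcen n * a - a)) \<longlonglongrightarrow> 0"
        by (intro tendsto_mult_right_zero tendsto_norm_zero) (use fcen_lim[OF that] in \<open>simp add: LIM_zero_iff\<close>)
    qed
    from tendsto_add[OF this fcen_lim[OF that]] show ?thesis by (simp add: right_diff_distrib)
  qed
  have gen: "(\<lambda>n. mean_unit n * (vee * c * mu r x r y)) \<longlonglongrightarrow> vee * c * mu r x r y"
      "(\<lambda>n. (vee * c * mu r x r y) * mean_unit n) \<longlonglongrightarrow> vee * c * mu r x r y" if c: "c \<in> coef" for c r x y
  proof -
    note h = coef_central[OF coef.vee[OF c]]
    have 1: "mean_unit n * (vee * c * mu r x r y) = fcen n * (fcen n * (vee * c * mu r x r y))"
        "(vee * c * mu r x r y) * mean_unit n = fcen n * (fcen n * (vee * c * mu r x r y))" if "r + x + y < n" for n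
      using mean_unit_mu[OF that] by (simp_all only: central_left[OF h] mult.assoc[of "vee * c"])
    have "\<forall>\<^sub>F n in sequentially. fcen n * (fcen n * (vee * c * mu r x r y)) = mean_unit n * (vee * c * mu r x r y)"
        "\<forall>\<^sub>F n in sequentially. fcen n * (fcen n * (vee * c * mu r x r y)) = (vee * c * mu r x r y) * mean_unit n"
      using eventually_gt_at_top[of "r + x + y"] by (eventually_elim, simp add: 1)+
    note ev = this
    show "(\<lambda>n. mean_unit n * (vee * c * mu r x r y)) \<longlonglongrightarrow> vee * c * mu r x r y"
      by (rule Lim_transform_eventually[OF ff[OF radalg_core[OF core_gen[OF c]]] ev(1)])
    show "(\<lambda>n. (vee * c * mu r x r y) * mean_unit n) \<longlonglongrightarrow> vee * c * mu r x r y"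
      by (rule Lim_transform_eventually[OF ff[OF radalg_core[OF core_gen[OF c]]] ev(2)])
  qed
  have core: "(\<lambda>n. mean_unit n * a) \<longlonglongrightarrow> a \<and> (\<lambda>n. a * mean_unit n) \<longlonglongrightarrow> a" if "a \<in> core" for a
    using that
  proof (induction rule: core.induct)
    case (add a c z r x y)
    then show ?case
      using tendsto_add[OF _ tendsto_scaleC[OF gen(1)[OF add.hyps(2), of r x y], of z]]
        tendsto_add[OF _ tendsto_scaleC[OF gen(2)[OF add.hyps(2), of r x y], of z]]
      by (simp add: distrib_left distrib_right)
  qed simp
  have b: "norm (mean_unit n * a - a) \<le> 5 * norm a" "norm (a * mean_unit n - a) \<le> 5 * norm a" for n a
  proof -
    have "norm (mean_unit n * a) \<le> 4 * norm a" "norm (a * mean_unit n) \<le> 4 * norm a"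
      using norm_mult_ineq[of "mean_unit n" a] norm_mult_ineq[of a "mean_unit n"]
        mult_right_mono[OF norm_mean_unit, of "norm a" n] by (simp_all add: mult.commute)
    then show "norm (mean_unit n * a - a) \<le> 5 * norm a" "norm (a * mean_unit n - a) \<le> 5 * norm a"
      using norm_triangle_ineq4[of "mean_unit n * a" a] norm_triangle_ineq4[of "a * mean_unit n" a] by simp_all
  qed
  have "(\<lambda>n. mean_unit n * a - a) \<longlonglongrightarrow> 0"
    by (rule lim_on_radalg[where C = 5, OF b(1) _ _ a]) (auto simp: algebra_simps LIM_zero_iff core)
  then show "(\<lambda>n. mean_unit n * a) \<longlonglongrightarrow> a" by (simp add: LIM_zero_iff)
  have "(\<lambda>n. a * mean_unit n - a) \<longlonglongrightarrow> 0"
    by (rule lim_on_radalg[where C = 5, OF b(2) _ _ a]) (auto simp: algebra_simps LIM_zero_iff core)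
  then show "(\<lambda>n. a * mean_unit n) \<longlonglongrightarrow> a" by (simp add: LIM_zero_iff)
qed

section \<open>Amenability from an approximate diagonal, radicality from quasi-inverses\<close>

text \<open>Tychonoff for a product of discs. As the index set may be uncountable, the limit is
  taken along a finer filter and not along a subsequence.\<close>

lemma bounded_functions_cluster:
  fixes \<Phi> :: "nat \<Rightarrow> 'i \<Rightarrow> complex"
  assumes "\<And>n i. cmod (\<Phi> n i) \<le> R i"
  shows "\<exists>F \<phi>. F \<noteq> bot \<and> F \<le> sequentially \<and> (\<forall>i. ((\<lambda>n. \<Phi> n i) \<longlongrightarrow> \<phi> i) F)"
proof -
  have "compactin (product_topology (\<lambda>i. euclidean) UNIV) (PiE UNIV (\<lambda>i. cball (0 :: complex) (R i)))"
    by (simp add: compactin_PiE)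
  then have "compact (PiE UNIV (\<lambda>i. cball (0 :: complex) (R i)))"
    by (simp add: euclidean_product_topology)
  moreover have "filtermap \<Phi> sequentially \<noteq> bot" by (simp add: filtermap_bot_iff)
  moreover have "eventually (\<lambda>f. f \<in> PiE UNIV (\<lambda>i. cball 0 (R i))) (filtermap \<Phi> sequentially)"
    using assms by (simp add: eventually_filtermap PiE_def Pi_def)
  ultimately obtain \<phi> where \<phi>: "inf (nhds \<phi>) (filtermap \<Phi> sequentially) \<noteq> bot"
    unfolding compact_filter by blast
  \<comment> \<open>Pulled back to the indices, the neighbourhoods of the cluster point give a
    proper filter along which all coordinates converge at once.\<close>
  define F where "F = inf (filtercomap \<Phi> (nhds \<phi>)) sequentially"
  have "F \<noteq> bot"
  proof
    assume "F = bot"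
    then have "eventually (\<lambda>_. False) F" by simp
    then obtain P Q where PQ: "eventually P (filtercomap \<Phi> (nhds \<phi>))" "eventually Q sequentially" "\<And>n. P n \<Longrightarrow> Q n \<Longrightarrow> False"
      unfolding F_def eventually_inf by blast
    obtain P' where P': "eventually P' (nhds \<phi>)" "\<And>n. P' (\<Phi> n) \<Longrightarrow> P n"
      using PQ(1) unfolding eventually_filtercomap by blast
    have "eventually (\<lambda>f. \<not> P' f) (filtermap \<Phi> sequentially)"
      unfolding eventually_filtermap using PQ(2) by eventually_elim (use PQ(3) P'(2) in blast)
    with P'(1) have "eventually (\<lambda>_. False) (inf (nhds \<phi>) (filtermap \<Phi> sequentially))"
      unfolding eventually_inf by blast
    then show False using \<phi> by (simp add: trivial_limit_def)
  qed
  moreover have "F \<le> sequentially" by (simp add: F_def)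
  moreover have "((\<lambda>n. \<Phi> n i) \<longlongrightarrow> \<phi> i) F" for i
  proof (rule continuous_on_tendsto_compose[where s = UNIV and f = "\<lambda>f. f i"])
    show "(\<Phi> \<longlongrightarrow> \<phi>) F"
      unfolding F_def by (rule filterlim_mono[OF filterlim_filtercomap order_refl inf_le1])
  qed auto
  ultimately show ?thesis by blast
qed

definition (in banach_algebra) bounded_bilinear_form :: "real \<Rightarrow> ('a \<Rightarrow> 'a \<Rightarrow> complex) \<Rightarrow> bool"
  where "bounded_bilinear_form K B \<longleftrightarrow> 0 \<le> K \<and>
    (\<forall>a\<in>carrier A. \<forall>b\<in>carrier A. cmod (B a b) \<le> K * \<parallel>a\<parallel> * \<parallel>b\<parallel>) \<and>
    (\<forall>a\<in>carrier A. \<forall>b\<in>carrier A. \<forall>c\<in>carrier A.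
      B (a \<oplus>\<^bsub>A\<^esub> b) c = B a c + B b c \<and> B c (a \<oplus>\<^bsub>A\<^esub> b) = B c a + B c b) \<and>
    (\<forall>z. \<forall>a\<in>carrier A. \<forall>b\<in>carrier A. B (z \<odot>\<^bsub>A\<^esub> a) b = z * B a b \<and> B a (z \<odot>\<^bsub>A\<^esub> b) = z * B a b)"

text \<open>\<open>M n B\<close> stands for the value of the bilinear form \<open>B\<close> at the \<open>n\<close>-th term of a bounded
  approximate diagonal in \<open>A \<otimes> A\<close>, and \<open>e n\<close> for the image of that term under multiplication.\<close>

locale approx_diagonal = banach_algebra A for A :: "('a, 'm) normed_scheme" (structure) +
  fixes M :: "nat \<Rightarrow> ('a \<Rightarrow> 'a \<Rightarrow> complex) \<Rightarrow> complex" and e :: "nat \<Rightarrow> 'a" and C :: real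
  assumes M_cong: "(\<And>a b. a \<in> carrier A \<Longrightarrow> b \<in> carrier A \<Longrightarrow> B a b = B' a b) \<Longrightarrow> M n B = M n B'"
    and M_add: "M n (\<lambda>a b. B a b + B' a b) = M n B + M n B'"
    and M_mult: "M n (\<lambda>a b. z * B a b) = z * M n B"
    and M_bound: "bounded_bilinear_form K B \<Longrightarrow> cmod (M n B) \<le> C * K"
    and M_commutes: "bounded_bilinear_form K B \<Longrightarrow> a \<in> carrier A \<Longrightarrow>
      (\<lambda>n. M n (\<lambda>p q. B (a \<otimes>\<^bsub>A\<^esub> p) q) - M n (\<lambda>p q. B p (q \<otimes>\<^bsub>A\<^esub> a))) \<longlonglongrightarrow> 0"
    and M_product: "(\<And>a b. a \<in> carrier A \<Longrightarrow> b \<in> carrier A \<Longrightarrow> l (a \<oplus>\<^bsub>A\<^esub> b) = l a + l b) \<Longrightarrow>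
      (\<And>z a. a \<in> carrier A \<Longrightarrow> l (z \<odot>\<^bsub>A\<^esub> a) = z * l a) \<Longrightarrow> M n (\<lambda>p q. l (p \<otimes>\<^bsub>A\<^esub> q)) = l (e n)"
    and e_closed: "e n \<in> carrier A" and e_bound: "\<parallel>e n\<parallel> \<le> C"
    and e_left: "a \<in> carrier A \<Longrightarrow> (\<lambda>n. \<parallel>e n \<otimes>\<^bsub>A\<^esub> a \<ominus>\<^bsub>A\<^esub> a\<parallel>) \<longlonglongrightarrow> 0"
    and e_right: "a \<in> carrier A \<Longrightarrow> (\<lambda>n. \<parallel>a \<otimes>\<^bsub>A\<^esub> e n \<ominus>\<^bsub>A\<^esub> a\<parallel>) \<longlonglongrightarrow> 0"
begin

lemma additive_diff:
  fixes l :: "'a \<Rightarrow> complex"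
  assumes "\<And>a b. a \<in> carrier A \<Longrightarrow> b \<in> carrier A \<Longrightarrow> l (a \<oplus>\<^bsub>A\<^esub> b) = l a + l b" "u \<in> carrier A" "v \<in> carrier A"
  shows "l (u \<ominus>\<^bsub>A\<^esub> v) = l u - l v"
proof -
  have "(u \<ominus>\<^bsub>A\<^esub> v) \<oplus>\<^bsub>A\<^esub> v = u"
    using assms(2,3) by (simp add: a_minus_def M.a_assoc M.l_neg)
  then show ?thesis using assms(1)[of "u \<ominus>\<^bsub>A\<^esub> v" v] assms(2,3) by (simp add: algebra_simps)
qed

text \<open>Johnson's argument: if \<open>p \<otimes> q\<close> runs through an approximate
  diagonal, a weak-star cluster point \<open>\<phi>\<close> of the means of \<open>D q (x.p)\<close>
  satisfies \<open>\<phi> (x.a) - \<phi> (a.x) = D a x\<close>.\<close>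

theorem derivation_inner:
  fixes E :: "('a, 'e, 'k) bimodule_scheme"
  assumes E: "banach_bimodule A E" and D: "derivation A (dual E) D"
  shows "inner_derivation A (dual E) D"
proof -
  interpret B: banach_bimodule A E by fact
  interpret DE: banach_bimodule A "dual E" by (rule B.dual_bimodule)
  have Dc: "D a \<in> carrier (dual E)" if "a \<in> carrier A" for a using D that by (simp add: derivation_def)
  have Dlin: "D a (x \<oplus>\<^bsub>E\<^esub> y) = D a x + D a y" "D a (z \<odot>\<^bsub>E\<^esub> x) = z * D a x"
    if "a \<in> carrier A" "x \<in> carrier E" "y \<in> carrier E" for a x y z
    using Dc[OF that(1)] that by (auto simp: dual_carrier)
  have Dadd: "D (a \<oplus>\<^bsub>A\<^esub> b) x = D a x + D b x" "D (z \<odot>\<^bsub>A\<^esub> a) x = z * D a x"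
    if "a \<in> carrier A" "b \<in> carrier A" for a b x z
    using D that by (simp_all add: derivation_def dual_ops)
  have Dmult: "D (a \<otimes>\<^bsub>A\<^esub> b) x = D b (ract E x a) + D a (lact E b x)"
    if "a \<in> carrier A" "b \<in> carrier A" "x \<in> carrier E" for a b x
    using D that by (simp add: derivation_def dual_ops)
  obtain K0 where K0: "\<forall>a\<in>carrier A. nrm (dual E) (D a) \<le> K0 * \<parallel>a\<parallel>" using D unfolding derivation_def by blast
  define K where "K = max 0 K0"
  have K: "0 \<le> K" "\<And>a. a \<in> carrier A \<Longrightarrow> nrm (dual E) (D a) \<le> K * \<parallel>a\<parallel>"
    using K0 unfolding K_def by (auto intro: order_trans[OF _ mult_right_mono[of K0 "max 0 K0"]] nrm_nonneg)
  obtain L where L: "0 \<le> L" "\<And>a x. a \<in> carrier A \<Longrightarrow> x \<in> carrier E \<Longrightarrow> nrm E (ract E x a) \<le> L * \<parallel>a\<parallel> * nrm E x"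
    using B.ract_bound by blast
  note ac = mult_closed and rc = B.ract_closed and lc = B.lact_closed
  have C0: "0 \<le> C" using e_bound[of 0] nrm_nonneg[OF e_closed[of 0]] by linarith
  have D1: "cmod (D a x) \<le> K * \<parallel>a\<parallel> * nrm E x" if "a \<in> carrier A" "x \<in> carrier E" for a x
    using dual_bound[OF B.E.complex_normed_space_axioms Dc[OF that(1)] that(2)]
      mult_right_mono[OF K(2)[OF that(1)] B.E.nrm_nonneg[OF that(2)]] by linarith
  have D2: "cmod (D a (ract E x b)) \<le> K * L * nrm E x * \<parallel>b\<parallel> * \<parallel>a\<parallel>"
    if "a \<in> carrier A" "b \<in> carrier A" "x \<in> carrier E" for a b x
  proof -
    have "cmod (D a (ract E x b)) \<le> K * \<parallel>a\<parallel> * nrm E (ract E x b)" using that by (intro D1 rc)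
    also have "\<dots> \<le> K * \<parallel>a\<parallel> * (L * \<parallel>b\<parallel> * nrm E x)"
      using that K(1) by (intro mult_left_mono L mult_nonneg_nonneg nrm_nonneg)
    finally show ?thesis by (simp add: mult_ac)
  qed
  define form where "form = (\<lambda>x p q. D q (ract E x p))"
  have form: "bounded_bilinear_form (K * L * nrm E x) (form x)" if "x \<in> carrier E" for x
    unfolding bounded_bilinear_form_def form_def
    using that D2 K(1) L(1) B.E.nrm_nonneg[OF that]
    by (auto simp: B.ract_add_right B.ract_smult_right Dlin Dadd rc)
  \<comment> \<open>With \<open>f = e (\<alpha> n)\<close> and \<open>e = e n\<close>, the product
    of the completed diagonal is \<open>f + (1 - f)(1 - e) = 1 + (f e - e)\<close>. The index
    \<open>\<alpha> n\<close> is chosen to make the error \<open>f e - e\<close> small.\<close>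
  have "\<exists>k\<ge>n. \<parallel>e k \<otimes>\<^bsub>A\<^esub> e n \<ominus>\<^bsub>A\<^esub> e n\<parallel> < inverse (real (Suc n))" for n
  proof -
    obtain N where "\<And>k. N \<le> k \<Longrightarrow> norm (\<parallel>e k \<otimes>\<^bsub>A\<^esub> e n \<ominus>\<^bsub>A\<^esub> e n\<parallel> - 0) < inverse (real (Suc n))"
      using LIMSEQ_D[OF e_left[OF e_closed[of n]], of "inverse (real (Suc n))"] by auto
    from this[of "max n N"] show ?thesis by (intro exI[of _ "max n N"]) auto
  qed
  then obtain \<alpha> where \<alpha>: "\<And>n. n \<le> \<alpha> n" "\<And>n. \<parallel>e (\<alpha> n) \<otimes>\<^bsub>A\<^esub> e n \<ominus>\<^bsub>A\<^esub> e n\<parallel> < inverse (real (Suc n))"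
    by metis
  have \<alpha>_top: "filterlim \<alpha> at_top sequentially"
    using \<alpha>(1) by (auto simp: filterlim_at_top eventually_sequentially intro: order_trans)
  text \<open>The approximate diagonal of \<open>A\<close> is completed by \<open>(1 - e (\<alpha> n)) \<otimes> (1 - e n)\<close> to one of the
    unitization, on which \<open>D\<close> vanishes at \<open>1\<close>; no essentiality of \<open>E\<close> is then needed.\<close>
  define \<Phi> where "\<Phi> = (\<lambda>n x. if x \<in> carrier E
    then M (\<alpha> n) (form x) - D (e n) x + D (e n) (ract E x (e (\<alpha> n))) else 0)"
  define R where "R = C * (K * L) + K * C + K * L * C * C"
  have R: "cmod (\<Phi> n x) \<le> (if x \<in> carrier E then R * nrm E x else 0)" for n x
  proof (cases "x \<in> carrier E")
    case x: True
    note xn = B.E.nrm_nonneg[OF x]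
    have 1: "cmod (M (\<alpha> n) (form x)) \<le> C * (K * L * nrm E x)" by (rule M_bound[OF form[OF x]])
    have "cmod (D (e n) x) \<le> K * \<parallel>e n\<parallel> * nrm E x" by (rule D1[OF e_closed x])
    also have "\<dots> \<le> K * C * nrm E x" using K(1) xn by (intro mult_right_mono mult_left_mono e_bound)
    finally have 2: "cmod (D (e n) x) \<le> K * C * nrm E x" .
    have "cmod (D (e n) (ract E x (e (\<alpha> n)))) \<le> K * L * nrm E x * \<parallel>e (\<alpha> n)\<parallel> * \<parallel>e n\<parallel>"
      by (rule D2[OF e_closed e_closed x])
    also have "\<dots> \<le> K * L * nrm E x * C * C"
      using K(1) L(1) xn C0 by (intro mult_mono e_bound nrm_nonneg e_closed mult_nonneg_nonneg order_refl)
    finally have 3: "cmod (D (e n) (ract E x (e (\<alpha> n)))) \<le> K * L * nrm E x * C * C" .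
    have "cmod (\<Phi> n x) \<le> cmod (M (\<alpha> n) (form x)) + cmod (D (e n) x) + cmod (D (e n) (ract E x (e (\<alpha> n))))"
      using x norm_triangle_ineq[of "M (\<alpha> n) (form x) - D (e n) x" "D (e n) (ract E x (e (\<alpha> n)))"] norm_triangle_ineq4[of "M (\<alpha> n) (form x)" "D (e n) x"]
      by (simp add: \<Phi>_def)
    also have "\<dots> \<le> R * nrm E x" using 1 2 3 by (simp add: R_def algebra_simps)
    finally show ?thesis using x by simp
  qed (simp add: \<Phi>_def)
  obtain F \<phi> where F: "F \<noteq> bot" "F \<le> sequentially" and \<phi>: "\<And>x. ((\<lambda>n. \<Phi> n x) \<longlongrightarrow> \<phi> x) F"
    using bounded_functions_cluster[of \<Phi>, OF R] by blast
  have \<phi>_eq: "\<phi> x = l" if "((\<lambda>n. \<Phi> n x) \<longlongrightarrow> l) F" for x l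
    by (rule tendsto_unique[OF F(1) \<phi> that])
  have \<phi>_dual: "\<phi> \<in> carrier (dual E)"
    unfolding dual_carrier
  proof (intro conjI allI impI ballI)
    show "\<phi> x = 0" if "x \<notin> carrier E" for x using that by (intro \<phi>_eq) (simp add: \<Phi>_def)
    fix x assume x: "x \<in> carrier E"
    fix y assume y: "y \<in> carrier E"
    have "\<Phi> n (x \<oplus>\<^bsub>E\<^esub> y) = \<Phi> n x + \<Phi> n y" for n
    proof -
      have "M (\<alpha> n) (form (x \<oplus>\<^bsub>E\<^esub> y)) = M (\<alpha> n) (\<lambda>p q. form x p q + form y p q)"
        by (rule M_cong) (use x y in \<open>simp add: form_def B.ract_add_left Dlin rc\<close>)
      then show ?thesis using x y
        by (simp add: \<Phi>_def M_add B.ract_add_left Dlin rc e_closed algebra_simps)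
    qed
    then show "\<phi> (x \<oplus>\<^bsub>E\<^esub> y) = \<phi> x + \<phi> y" by (intro \<phi>_eq) (simp add: tendsto_add \<phi>)
  next
    fix z x assume x: "x \<in> carrier E"
    have "\<Phi> n (z \<odot>\<^bsub>E\<^esub> x) = z * \<Phi> n x" for n
    proof -
      have "M (\<alpha> n) (form (z \<odot>\<^bsub>E\<^esub> x)) = M (\<alpha> n) (\<lambda>p q. z * form x p q)"
        by (rule M_cong) (use x in \<open>simp add: form_def B.ract_smult_left Dlin rc\<close>)
      then show ?thesis using x
        by (simp add: \<Phi>_def M_mult B.ract_smult_left Dlin rc e_closed algebra_simps)
    qed
    then show "\<phi> (z \<odot>\<^bsub>E\<^esub> x) = z * \<phi> x" by (intro \<phi>_eq) (simp add: tendsto_mult_left \<phi>)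
  next
    have "cmod (\<phi> x) \<le> R * nrm E x" if "x \<in> carrier E" for x
      by (rule tendsto_upperbound[OF tendsto_norm[OF \<phi>] always_eventually F(1)]) (use R[of _ x] that in simp)
    then show "\<exists>K. \<forall>x\<in>carrier E. cmod (\<phi> x) \<le> K * nrm E x" by blast
  qed
  have key: "(\<lambda>n. \<Phi> n (ract E x a) - \<Phi> n (lact E a x)) \<longlonglongrightarrow> D a x" if a: "a \<in> carrier A" and x: "x \<in> carrier E" for a x
  proof -
    define m where "m = (\<lambda>n. M (\<alpha> n) (\<lambda>p q. form x (a \<otimes>\<^bsub>A\<^esub> p) q) - M (\<alpha> n) (\<lambda>p q. form x p (q \<otimes>\<^bsub>A\<^esub> a)))"
    define w where "w = (\<lambda>n. e n \<otimes>\<^bsub>A\<^esub> a \<ominus>\<^bsub>A\<^esub> a)"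
    define s where "s = (\<lambda>n. e (\<alpha> n) \<otimes>\<^bsub>A\<^esub> e n \<ominus>\<^bsub>A\<^esub> e n)"
    define t where "t = (\<lambda>n. a \<otimes>\<^bsub>A\<^esub> e (\<alpha> n) \<ominus>\<^bsub>A\<^esub> a)"
    have cl: "w n \<in> carrier A" "s n \<in> carrier A" "t n \<in> carrier A" for n
      using a e_closed by (auto simp: w_def s_def t_def ac)
    \<comment> \<open>An exact identity. The error collects the failure \<open>m n\<close> of the
      diagonal to commute with \<open>a\<close> and the failures \<open>w n\<close>,
      \<open>s n\<close>, \<open>t n\<close> of the approximate units.\<close>
    have err: "\<Phi> n (ract E x a) - \<Phi> n (lact E a x) - D a x =
        m n + D (w n) x - D (w n) (ract E x (e (\<alpha> n))) + D a (ract E x (s n)) + D (e n) (ract E x (t n))" for n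
    proof -
      let ?f = "e (\<alpha> n)" and ?e = "e n"
      note cs = e_closed[of n] e_closed[of "\<alpha> n"]
      have Da: "D a (ract E y (u \<oplus>\<^bsub>A\<^esub> v)) = D a (ract E y u) + D a (ract E y v)"
        if "y \<in> carrier E" "u \<in> carrier A" "v \<in> carrier A" "a \<in> carrier A" for a y u v
        using that by (simp add: B.ract_add_right Dlin rc)
      have 1: "M (\<alpha> n) (form (ract E x a)) = M (\<alpha> n) (\<lambda>p q. form x (a \<otimes>\<^bsub>A\<^esub> p) q)"
        by (rule M_cong) (use a x in \<open>simp add: form_def B.ract_ract\<close>)
      \<comment> \<open>The derivation rule turns the left action of \<open>a\<close> into the form
        at \<open>q a\<close>, minus a term that depends on \<open>p\<close> and \<open>q\<close>
        only through their product, so \<open>M_product\<close> evaluates it.\<close>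
      have "M (\<alpha> n) (form (lact E a x)) = M (\<alpha> n) (\<lambda>p q. form x p (q \<otimes>\<^bsub>A\<^esub> a) + (- 1) * D a (ract E x (p \<otimes>\<^bsub>A\<^esub> q)))"
        by (rule M_cong) (use a x in \<open>simp add: form_def Dmult rc B.ract_ract B.lact_ract\<close>)
      also have "\<dots> = M (\<alpha> n) (\<lambda>p q. form x p (q \<otimes>\<^bsub>A\<^esub> a)) - D a (ract E x ?f)"
        unfolding M_add M_mult
        by (subst M_product[where l = "\<lambda>c. D a (ract E x c)"])
          (use a x in \<open>auto simp: B.ract_add_right B.ract_smult_right Dlin rc\<close>)
      finally have 2: "M (\<alpha> n) (form (lact E a x)) = M (\<alpha> n) (\<lambda>p q. form x p (q \<otimes>\<^bsub>A\<^esub> a)) - D a (ract E x ?f)" .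
      have 3: "D ?e (lact E a y) = D (?e \<otimes>\<^bsub>A\<^esub> a) y - D a (ract E y ?e)" if "y \<in> carrier E" for y
        using Dmult[OF cs(1) a that] by simp
      have 4: "D (w n) y = D (?e \<otimes>\<^bsub>A\<^esub> a) y - D a y" if "y \<in> carrier E" for y
        unfolding w_def using a cs by (intro additive_diff) (auto simp: Dadd ac)
      have 5: "D a (ract E x (s n)) = D a (ract E x (?f \<otimes>\<^bsub>A\<^esub> ?e)) - D a (ract E x ?e)"
        unfolding s_def using a cs x by (intro additive_diff) (auto simp: Da ac)
      have 6: "D ?e (ract E x (t n)) = D ?e (ract E x (a \<otimes>\<^bsub>A\<^esub> ?f)) - D ?e (ract E x a)"
        unfolding t_def using a cs x by (intro additive_diff) (auto simp: Da ac)
      show ?thesis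
        using a x cs
        by (simp add: \<Phi>_def rc lc 1 2 3 4 5 6 m_def B.ract_ract B.lact_ract[symmetric])
    qed
    have m0: "m \<longlonglongrightarrow> 0"
      unfolding m_def using filterlim_compose[OF M_commutes[OF form[OF x] a] \<alpha>_top] .
    have w0: "(\<lambda>n. \<parallel>w n\<parallel>) \<longlonglongrightarrow> 0" unfolding w_def by (rule e_left[OF a])
    have t0: "(\<lambda>n. \<parallel>t n\<parallel>) \<longlonglongrightarrow> 0" unfolding t_def using filterlim_compose[OF e_right[OF a] \<alpha>_top] .
    have s0: "(\<lambda>n. \<parallel>s n\<parallel>) \<longlonglongrightarrow> 0"
    proof (rule tendsto_sandwich[OF _ _ tendsto_const LIMSEQ_inverse_real_of_nat])
      show "\<forall>\<^sub>F n in sequentially. 0 \<le> \<parallel>s n\<parallel>" using cl by (simp add: nrm_nonneg)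
      show "\<forall>\<^sub>F n in sequentially. \<parallel>s n\<parallel> \<le> inverse (real (Suc n))"
        using \<alpha>(2) unfolding s_def by (intro always_eventually allI less_imp_le)
    qed
    have "(\<lambda>n. D (w n) x) \<longlonglongrightarrow> 0"
      by (rule Lim_null_comparison[of _ "\<lambda>n. K * nrm E x * \<parallel>w n\<parallel>"])
        (use D1[OF cl(1) x] in \<open>auto simp: mult_ac intro!: tendsto_mult_right_zero w0\<close>)
    moreover have "(\<lambda>n. D (w n) (ract E x (e (\<alpha> n)))) \<longlonglongrightarrow> 0"
    proof (rule Lim_null_comparison[of _ "\<lambda>n. K * L * nrm E x * C * \<parallel>w n\<parallel>"])
      show "(\<lambda>n. K * L * nrm E x * C * \<parallel>w n\<parallel>) \<longlonglongrightarrow> 0" by (intro tendsto_mult_right_zero w0)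
      have "cmod (D (w n) (ract E x (e (\<alpha> n)))) \<le> K * L * nrm E x * C * \<parallel>w n\<parallel>" for n
        using D2[OF cl(1) e_closed x, of n "\<alpha> n"] K(1) L(1) B.E.nrm_nonneg[OF x] nrm_nonneg[OF cl(1)[of n]]
        by (elim order_trans) (intro mult_right_mono mult_left_mono e_bound mult_nonneg_nonneg)
      then show "\<forall>\<^sub>F n in sequentially. cmod (D (w n) (ract E x (e (\<alpha> n)))) \<le> K * L * nrm E x * C * \<parallel>w n\<parallel>" by simp
    qed
    moreover have "(\<lambda>n. D a (ract E x (s n))) \<longlonglongrightarrow> 0"
      by (rule Lim_null_comparison[of _ "\<lambda>n. K * L * nrm E x * \<parallel>a\<parallel> * \<parallel>s n\<parallel>"])
        (use D2[OF a cl(2) x] in \<open>auto simp: mult_ac intro!: tendsto_mult_right_zero s0\<close>)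
    moreover have "(\<lambda>n. D (e n) (ract E x (t n))) \<longlonglongrightarrow> 0"
    proof (rule Lim_null_comparison[of _ "\<lambda>n. K * L * nrm E x * C * \<parallel>t n\<parallel>"])
      show "(\<lambda>n. K * L * nrm E x * C * \<parallel>t n\<parallel>) \<longlonglongrightarrow> 0" by (intro tendsto_mult_right_zero t0)
      have "cmod (D (e n) (ract E x (t n))) \<le> K * L * nrm E x * C * \<parallel>t n\<parallel>" for n
      proof -
        have "cmod (D (e n) (ract E x (t n))) \<le> K * L * nrm E x * \<parallel>t n\<parallel> * \<parallel>e n\<parallel>" by (rule D2[OF e_closed cl(3) x])
        also have "\<dots> \<le> K * L * nrm E x * \<parallel>t n\<parallel> * C"
          using K(1) L(1) B.E.nrm_nonneg[OF x] nrm_nonneg[OF cl(3)[of n]]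
          by (intro mult_left_mono e_bound mult_nonneg_nonneg)
        finally show ?thesis by (simp add: mult_ac)
      qed
      then show "\<forall>\<^sub>F n in sequentially. cmod (D (e n) (ract E x (t n))) \<le> K * L * nrm E x * C * \<parallel>t n\<parallel>" by simp
    qed
    ultimately have "(\<lambda>n. \<Phi> n (ract E x a) - \<Phi> n (lact E a x) - D a x) \<longlonglongrightarrow> 0 + 0 - 0 + 0 + 0"
      unfolding err using m0 by (intro tendsto_add tendsto_diff)
    then show ?thesis by (simp add: LIM_zero_iff)
  qed
  have \<phi>_key: "\<phi> (ract E x a) - \<phi> (lact E a x) = D a x" if "a \<in> carrier A" "x \<in> carrier E" for a x
    by (rule tendsto_unique[OF F(1) tendsto_diff[OF \<phi> \<phi>] tendsto_mono[OF F(2) key[OF that]]])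
  \<comment> \<open>In the dual, \<open>\<psi>.a - a.\<psi>\<close> evaluated at \<open>x\<close> is
    \<open>\<psi> (a.x) - \<psi> (x.a)\<close>, opposite to the order obtained for
    \<open>\<phi>\<close>.\<close>
  define \<psi> where "\<psi> = (- 1) \<odot>\<^bsub>dual E\<^esub> \<phi>"
  have \<psi>: "\<psi> \<in> carrier (dual E)"
    unfolding \<psi>_def using \<phi>_dual DE.E.smult_closed[of "- 1" \<phi>] by simp
  show ?thesis
    unfolding inner_derivation_def
  proof (intro bexI[OF _ \<psi>] ballI)
    fix a assume a: "a \<in> carrier A"
    note minus = dual_minus[OF B.E.complex_normed_space_axioms DE.ract_closed[OF a \<psi>] DE.lact_closed[OF a \<psi>]]
    show "D a = ract (dual E) \<psi> a \<ominus>\<^bsub>dual E\<^esub> lact (dual E) a \<psi>"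
      unfolding minus using Dc[OF a] \<phi>_key[OF a]
      by (auto simp: fun_eq_iff dual_ops \<psi>_def dual_carrier)
  qed
qed

lemma amenable: "amenable A"
  unfolding amenable_def using derivation_inner by blast

end

text \<open>If \<open>a\<close> fixes \<open>v\<close>, the equation for \<open>s\<close> gives
  \<open>s v = v + s v\<close>, so \<open>v = 0\<close>. In an irreducible representation a vector
  not annihilated by the algebra is cyclic, hence fixed by some element, which is a
  contradiction.\<close>

lemma (in banach_algebra) radical_if_quasi_regular:
  assumes "\<And>a. a \<in> carrier A \<Longrightarrow> \<exists>s\<in>carrier A. s = a \<oplus>\<^bsub>A\<^esub> s \<otimes>\<^bsub>A\<^esub> a"
  shows "radical_algebra A"
  unfolding radical_algebra_iff_no_primitive_ideal
proof
  assume "\<exists>P. primitive_ideal A P"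
  then obtain V :: "(complex, 'a) module" and \<rho> where "irreducible_rep A V \<rho>" by (auto simp: primitive_ideal_def)
  then interpret irreducible_rep A V \<rho> .
  have zero: "\<zero>\<^bsub>V\<^esub> = 0 \<odot>\<^bsub>V\<^esub> v" "\<ominus>\<^bsub>V\<^esub> v = (- 1) \<odot>\<^bsub>V\<^esub> v" if "v \<in> carrier V" for v
  proof -
    show "\<zero>\<^bsub>V\<^esub> = 0 \<odot>\<^bsub>V\<^esub> v" using V.smult_l_null[OF that] by simp
    have "(- 1) \<odot>\<^bsub>V\<^esub> v \<oplus>\<^bsub>V\<^esub> 1 \<odot>\<^bsub>V\<^esub> v = \<zero>\<^bsub>V\<^esub>"
      using that V.smult_l_distr[of "- 1" 1 v] V.smult_l_null[of v] by simp
    then show "\<ominus>\<^bsub>V\<^esub> v = (- 1) \<odot>\<^bsub>V\<^esub> v"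
      using that V.smult_one[of v] V.smult_closed[of "- 1" v] by (intro V.M.minus_equality) auto
  qed
  have fixpoint: "v = \<zero>\<^bsub>V\<^esub>" if a: "a \<in> carrier A" and v: "v \<in> carrier V" and fixed: "\<rho> a v = v" for a v
  proof -
    obtain s where s: "s \<in> carrier A" "s = a \<oplus>\<^bsub>A\<^esub> s \<otimes>\<^bsub>A\<^esub> a" using assms[OF a] by blast
    have "\<rho> (a \<oplus>\<^bsub>A\<^esub> s \<otimes>\<^bsub>A\<^esub> a) v = \<rho> a v \<oplus>\<^bsub>V\<^esub> \<rho> s (\<rho> a v)"
      using a s(1) v by (simp add: rep_add_left rep_mult mult_closed)
    then have "\<rho> s v = \<rho> a v \<oplus>\<^bsub>V\<^esub> \<rho> s (\<rho> a v)" by (simp only: s(2)[symmetric])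
    then have "\<rho> s v = v \<oplus>\<^bsub>V\<^esub> \<rho> s v" by (simp add: fixed)
    then show ?thesis using V.M.add.r_cancel_one'[of "\<rho> s v" v] v rep_closed[OF s(1) v] by simp
  qed
  obtain a0 v0 where v0: "a0 \<in> carrier A" "v0 \<in> carrier V" "\<rho> a0 v0 \<noteq> \<zero>\<^bsub>V\<^esub>" using rep_nonzero by blast
  let ?W = "(\<lambda>a. \<rho> a v0) ` carrier A"
  note v = v0(2)
  have "submodule ?W \<C> V"
  proof (rule V.submoduleI)
    show "?W \<subseteq> carrier V" using v by (auto simp: rep_closed)
    have "\<rho> (0 \<odot>\<^bsub>A\<^esub> a0) v0 = 0 \<odot>\<^bsub>V\<^esub> \<rho> a0 v0" using v v0 by (simp add: rep_smult_left)
    then show "\<zero>\<^bsub>V\<^esub> \<in> ?W"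
      using zero(1)[OF rep_closed[OF v0(1) v]] v0(1) smult_closed[of 0 a0] by (intro image_eqI[of _ _ "0 \<odot>\<^bsub>A\<^esub> a0"]) auto
    show "\<ominus>\<^bsub>V\<^esub> w \<in> ?W" if "w \<in> ?W" for w
    proof -
      obtain a where a: "a \<in> carrier A" "w = \<rho> a v0" using \<open>w \<in> ?W\<close> by blast
      then have "\<ominus>\<^bsub>V\<^esub> w = \<rho> ((- 1) \<odot>\<^bsub>A\<^esub> a) v0" using v by (simp add: zero(2) rep_closed rep_smult_left)
      then show ?thesis using a smult_closed[of "- 1" a] by auto
    qed
    show "w \<oplus>\<^bsub>V\<^esub> w' \<in> ?W" if "w \<in> ?W" "w' \<in> ?W" for w w'
    proof -
      obtain a b where ab: "a \<in> carrier A" "w = \<rho> a v0" "b \<in> carrier A" "w' = \<rho> b v0"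
        using \<open>w \<in> ?W\<close> \<open>w' \<in> ?W\<close> by blast
      then show ?thesis using v by (intro image_eqI[of _ _ "a \<oplus>\<^bsub>A\<^esub> b"]) (auto simp: rep_add_left)
    qed
    show "c \<odot>\<^bsub>V\<^esub> w \<in> ?W" if "c \<in> carrier \<C>" "w \<in> ?W" for c w
    proof -
      obtain a where a: "a \<in> carrier A" "w = \<rho> a v0" using \<open>w \<in> ?W\<close> by blast
      then show ?thesis using v smult_closed[of c a] by (intro image_eqI[of _ _ "c \<odot>\<^bsub>A\<^esub> a"]) (auto simp: rep_smult_left)
    qed
  qed
  then have "?W = {\<zero>\<^bsub>V\<^esub>} \<or> ?W = carrier V"
    by (rule rep_irreducible) (use v in \<open>auto simp: rep_mult[symmetric] mult_closed\<close>)
  then have "?W = carrier V" using v0 by blast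
  then obtain a where "a \<in> carrier A" "\<rho> a v0 = v0" using v by (metis imageE)
  then have "v0 = \<zero>\<^bsub>V\<^esub>" using fixpoint v by blast
  moreover have "\<rho> a0 \<zero>\<^bsub>V\<^esub> = \<zero>\<^bsub>V\<^esub>"
    using rep_smult_right[OF v0(1) V.M.zero_closed, of 0] zero(1)[OF rep_closed[OF v0(1) V.M.zero_closed]]
      zero(1)[OF V.M.zero_closed] by simp
  ultimately show False using v0(3) by simp
qed

section \<open>Conclusion\<close>

text \<open>The coordinates are indexed by pairs of words, a countable set, so an element becomes a
  step function on the reals with one coordinate per unit interval.\<close>

definition enc :: "alg \<Rightarrow> real \<Rightarrow> complex"
  where "enc F x = case_prod (entries F) (from_nat (nat \<lfloor>x\<rfloor>))"

lemma inj_enc: "inj enc"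
proof (rule injI)
  fix F G assume eq: "enc F = enc G"
  show "F = G"
  proof (rule alg_eqI)
    fix p q
    show "entries F p q = entries G p q"
      using fun_cong[OF eq, of "real (to_nat (p, q))"] by (simp add: enc_def)
  qed
qed

definition dec :: "(real \<Rightarrow> complex) \<Rightarrow> alg" where "dec = inv_into UNIV enc"

lemma dec_enc [simp]: "dec (enc F) = F"
  by (simp add: dec_def inj_enc)

definition RA :: "(real \<Rightarrow> complex) normed"
  where "RA = \<lparr>carrier = enc ` radalg, monoid.mult = (\<lambda>f g. enc (dec f * dec g)),
    monoid.one = enc 0, zero = enc 0, add = (\<lambda>f g. enc (dec f + dec g)),
    smult = (\<lambda>z f. enc (scaleC z (dec f))), nrm = (\<lambda>f. norm (dec f))\<rparr>"

lemma RA_simps [simp]: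
  "carrier RA = enc ` radalg" "f \<otimes>\<^bsub>RA\<^esub> g = enc (dec f * dec g)" "\<zero>\<^bsub>RA\<^esub> = enc 0"
  "f \<oplus>\<^bsub>RA\<^esub> g = enc (dec f + dec g)" "z \<odot>\<^bsub>RA\<^esub> f = enc (scaleC z (dec f))"
  "nrm RA f = norm (dec f)"
  by (simp_all add: RA_def)

lemma RA_normed: "complex_normed_space RA"
proof -
  have ab: "abelian_group RA"
  proof (rule abelian_groupI)
    fix f assume "f \<in> carrier RA"
    then obtain F where F: "F \<in> radalg" "f = enc F" by auto
    have "- F \<in> radalg" using radalg_diff[OF radalg_zero F(1)] by simp
    then show "\<exists>g\<in>carrier RA. g \<oplus>\<^bsub>RA\<^esub> f = \<zero>\<^bsub>RA\<^esub>"
      using F by (intro bexI[of _ "enc (- F)"]) auto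
  qed (auto simp: radalg_add radalg_zero add_ac)
  have "Module.module \<C> RA"
    by (rule moduleI[OF cring_C ab]) (auto simp: radalg_scaleC scaleC_simps)
  then interpret Module.module \<C> RA .
  show ?thesis
    by unfold_locales (auto simp: norm_scaleC norm_triangle_ineq inj_eq[OF inj_enc])
qed

lemma RA_minus:
  assumes "F \<in> radalg" "G \<in> radalg"
  shows "enc F \<ominus>\<^bsub>RA\<^esub> enc G = enc (F - G)"
proof -
  interpret complex_normed_space RA by (rule RA_normed)
  have "- G \<in> radalg" using radalg_diff[OF radalg_zero assms(2)] by simp
  then have "\<ominus>\<^bsub>RA\<^esub> enc G = enc (- G)"
    using assms by (intro M.minus_equality) auto
  then show ?thesis by (simp add: a_minus_def)
qed

lemma RA_banach: "banach_algebra RA"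
proof -
  interpret complex_normed_space RA by (rule RA_normed)
  interpret M: Metric_space "carrier RA" "ndist RA" by (rule ndist_metric)
  have nd: "ndist RA (enc F) (enc G) = norm (F - G)" if "F \<in> radalg" "G \<in> radalg" for F G
    using that by (simp add: ndist_def RA_minus)
  have "M.mcomplete"
    unfolding M.mcomplete_def
  proof safe
    fix s assume C: "M.MCauchy s"
    then have "range s \<subseteq> enc ` radalg" unfolding M.MCauchy_def by simp
    then have "\<forall>n. \<exists>F. F \<in> radalg \<and> s n = enc F" by blast
    then obtain X where X: "\<And>n. X n \<in> radalg" "\<And>n. s n = enc (X n)" by metis
    have "Cauchy X"
    proof (rule CauchyI)
      fix r :: real assume "0 < r"
      then obtain N where "\<And>m n. N \<le> m \<Longrightarrow> N \<le> n \<Longrightarrow> ndist RA (s m) (s n) < r"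
        using C unfolding M.MCauchy_def by blast
      then show "\<exists>N. \<forall>m\<ge>N. \<forall>n\<ge>N. norm (X m - X n) < r" by (auto simp: X nd)
    qed
    then obtain F where F: "X \<longlonglongrightarrow> F" using Cauchy_convergent convergent_def by blast
    have FR: "F \<in> radalg" by (rule radalg_lim[OF X(1) F])
    have "limitin M.mtopology s (enc F) sequentially"
      unfolding M.limitin_metric
    proof (intro conjI allI impI)
      show "enc F \<in> carrier RA" using FR by simp
      fix r :: real assume "0 < r"
      then have "\<forall>\<^sub>F n in sequentially. norm (X n - F) < r" using F by (simp add: tendsto_iff dist_norm)
      then show "\<forall>\<^sub>F n in sequentially. s n \<in> carrier RA \<and> ndist RA (s n) (enc F) < r"
        by eventually_elim (simp add: X nd FR)
    qed
    then show "\<exists>f. limitin M.mtopology s f sequentially" by blast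
  qed
  then show ?thesis
    by unfold_locales (auto simp: radalg_mult mult.assoc distrib_left distrib_right norm_mult_ineq)
qed

lemma RA_approx_diagonal:
  "approx_diagonal RA (\<lambda>n B. mean_diag n (\<lambda>p q. B (enc p) (enc q))) (\<lambda>n. enc (mean_unit n)) 4"
proof -
  interpret banach_algebra RA by (rule RA_banach)
  have bil: "bilin K (\<lambda>p q. B (enc p) (enc q))" if "bounded_bilinear_form K B" for K B
    using that unfolding bounded_bilinear_form_def bilin_def by auto
  show ?thesis
  proof
    show "mean_diag n (\<lambda>p q. B (enc p) (enc q)) = mean_diag n (\<lambda>p q. B' (enc p) (enc q))"
      if "\<And>a b. a \<in> carrier RA \<Longrightarrow> b \<in> carrier RA \<Longrightarrow> B a b = B' a b" for B B' n
      using that by (intro mean_diag_cong) simp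
    show "cmod (mean_diag n (\<lambda>p q. B (enc p) (enc q))) \<le> 4 * K" if "bounded_bilinear_form K B" for K B n
      by (rule mean_diag_bound[OF bil[OF that]])
    show "(\<lambda>n. mean_diag n (\<lambda>p q. B (a \<otimes>\<^bsub>RA\<^esub> enc p) (enc q)) -
        mean_diag n (\<lambda>p q. B (enc p) (enc q \<otimes>\<^bsub>RA\<^esub> a))) \<longlonglongrightarrow> 0"
      if "bounded_bilinear_form K B" "a \<in> carrier RA" for K B a
      using mean_diag_commutes[OF bil[OF that(1)]] that(2) by auto
    show "mean_diag n (\<lambda>p q. l (enc p \<otimes>\<^bsub>RA\<^esub> enc q)) = l (enc (mean_unit n))"
      if add: "\<And>a b. a \<in> carrier RA \<Longrightarrow> b \<in> carrier RA \<Longrightarrow> l (a \<oplus>\<^bsub>RA\<^esub> b) = l a + l b"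
        and scale: "\<And>z a. a \<in> carrier RA \<Longrightarrow> l (z \<odot>\<^bsub>RA\<^esub> a) = z * l a" for l n
    proof -
      have "l (enc (a + b)) = l (enc a) + l (enc b)" "l (enc (scaleC z a)) = z * l (enc a)"
        if "a \<in> radalg" "b \<in> radalg" for a b z
        using add[of "enc a" "enc b"] scale[of "enc a" z] that by simp_all
      then show ?thesis using mean_diag_product[of "\<lambda>a. l (enc a)" n] by simp
    qed
    show "(\<lambda>n. nrm RA (enc (mean_unit n) \<otimes>\<^bsub>RA\<^esub> a \<ominus>\<^bsub>RA\<^esub> a)) \<longlonglongrightarrow> 0"
      "(\<lambda>n. nrm RA (a \<otimes>\<^bsub>RA\<^esub> enc (mean_unit n) \<ominus>\<^bsub>RA\<^esub> a)) \<longlonglongrightarrow> 0"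
      if "a \<in> carrier RA" for a
      using that mean_unit_lim
      by (auto simp: RA_minus radalg_mult mean_unit_radalg LIM_zero_iff intro!: tendsto_norm_zero)
  qed (auto simp: mean_diag_add mean_diag_mult mean_unit_radalg norm_mean_unit)
qed

theorem corollary10:
  shows "\<exists>A :: (real \<Rightarrow> complex) normed.
    banach_algebra A \<and> carrier A \<noteq> {\<zero>\<^bsub>A\<^esub>} \<and> amenable A \<and> radical_algebra A"
proof (intro exI conjI)
  interpret approx_diagonal RA "\<lambda>n B. mean_diag n (\<lambda>p q. B (enc p) (enc q))" "\<lambda>n. enc (mean_unit n)" 4
    by (rule RA_approx_diagonal)
  show "banach_algebra RA" by (rule RA_banach)
  have "enc (vee * mu 0 0 0 0) \<in> carrier RA" "enc (vee * mu 0 0 0 0) \<noteq> \<zero>\<^bsub>RA\<^esub>"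
    using vee_mu_radalg vee_mu_nonzero by (simp_all add: inj_eq[OF inj_enc])
  then show "carrier RA \<noteq> {\<zero>\<^bsub>RA\<^esub>}" by blast
  show "amenable RA" by (rule amenable)
  show "radical_algebra RA"
  proof (rule radical_if_quasi_regular)
    fix a assume "a \<in> carrier RA"
    then show "\<exists>s\<in>carrier RA. s = a \<oplus>\<^bsub>RA\<^esub> s \<otimes>\<^bsub>RA\<^esub> a"
      using radalg_quasi_regular by force
  qed
qed

end
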